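(* Let $\mathcal{A}$ be a semi-simple (infinite dimensional, complex) Banach algebra and let $T\in L(\mathcal{A})$ be a multiplier on $\mathcal{A}$, with dual operator $T^*\in L(\mathcal{A}^* )$. Then: (i) $T$ has the SVEP, $a(T)\le 1$ and $\alpha(T)\le\beta(T)$. (ii) If in addition $\mathcal{A}$ is commutative, regular and Tauberian, then properties $(z)$ and $(az)$ hold for $T$, and they hold for $T^*$ too if $T^*$ has the SVEP.
   Context: A multiplier on a Banach algebra $\mathcal{A}$ is an operator $T\in L(\mathcal{A})$ (bounded linear) with $aT(b)=T(a)b$ for all $a,b\in\mathcal{A}$. A commutative semi-simple Banach algebra is regular if for each closed subset $E$ of its maximal ideal space and each point $\varphi\notin E$ there is an element whose Gelfand transform vanishes on $E$ and is nonzero at $\varphi$; it is Tauberian if the elements whose Gelfand transform has compact support are dense. For a bounded operator $T$ on a complex Banach space $X$: $N(T)$ is the kernel, $R(T)$ the range, $\alpha(T)=\dim N(T)$, $\beta(T)=\operatorname{codim} R(T)$; $\sigma(T)$ is the spectrum and $\sigma_a(T)$ the approximate point spectrum; $\mathrm{iso}\,A$ is the set of isolated points of $A\subset\mathbb{C}$. $T$ is upper semi-Fredholm if $R(T)$ is closed and $\alpha(T)<\infty$, with index $\operatorname{ind}T=\alpha(T)-\beta(T)$; it is upper semi-Weyl if moreover $\operatorname{ind}T\le 0$. $\sigma_{uw}(T)$ is the set of $\lambda\in\mathbb{C}$ such that $T-\lambda I$ is not upper semi-Weyl. The ascent is $a(T)=\inf\{n\ge 0: N(T^n)=N(T^{n+1})\}$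 ($\inf\emptyset=\infty$). A point $\lambda\in\sigma_a(T)$ is a left pole of $T$ if $p=a(T-\lambda I)<\infty$ and $R((T-\lambda I)^{p+1})$ is closed; it is of finite rank if moreover $\alpha(T-\lambda I)<\infty$. $p_{00}^a(T)$ is the set of left poles of $T$ of finite rank. $\sigma_p^0(T)$ is the set of eigenvalues of finite multiplicity ($0<\alpha(T-\lambda I)<\infty$), and $\pi_{00}^a(T)=\mathrm{iso}\,\sigma_a(T)\cap\sigma_p^0(T)$. $T$ satisfies property $(z)$ if $\sigma(T)\setminus\sigma_{uw}(T)=\pi_{00}^a(T)$, and property $(az)$ if $\sigma(T)\setminus\sigma_{uw}(T)=p_{00}^a(T)$. $T$ has the SVEP (single valued extension property) at $\lambda_0\in\mathbb{C}$ if for every open neighborhood $U$ of $\lambda_0$ the only analytic function $f:U\to X$ with $(T-\lambda I)f(\lambda)=0$ for all $\lambda\in U$ is $f\equiv 0$; $T$ has the SVEP if this holds at every $\lambda_0\in\mathbb{C}$. *)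

theory Defs
  imports "HOL-Analysis.Analysis"
begin

section \<open>Complex Banach spaces and complex Banach algebras\<close>

class complex_normed_vector = real_normed_vector +
  fixes scaleC :: "complex \<Rightarrow> 'a \<Rightarrow> 'a"  (infixr \<open>*\<^sub>C\<close> 75)
  assumes scaleC_add_right: "c *\<^sub>C (x + y) = c *\<^sub>C x + c *\<^sub>C y"
    and scaleC_add_left: "(c + d) *\<^sub>C x = c *\<^sub>C x + d *\<^sub>C x"
    and scaleC_scaleC: "c *\<^sub>C (d *\<^sub>C x) = (c * d) *\<^sub>C x"
    and scaleC_of_real: "complex_of_real r *\<^sub>C x = r *\<^sub>R x"
    and norm_scaleC: "norm (c *\<^sub>C x) = cmod c * norm x"

class complex_banach = complex_normed_vector + complete_space

subclass (in complex_banach) banach ..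

text \<open>A unit is not assumed; submultiplicativity of the norm is part of
  \<^class>\<open>real_normed_algebra\<close>.\<close>

class complex_banach_algebra = complex_banach + real_normed_algebra +
  assumes mult_scaleC_left: "(c *\<^sub>C x) * y = c *\<^sub>C (x * y)"
    and mult_scaleC_right: "x * (c *\<^sub>C y) = c *\<^sub>C (x * y)"

lemma scaleC_one: "1 *\<^sub>C (x :: 'a::complex_normed_vector) = x"
  using scaleC_of_real[of 1 x] by simp

global_interpretation complex_vector: vector_space
  "scaleC :: complex \<Rightarrow> 'a \<Rightarrow> 'a :: complex_normed_vector"
  defines cdependent = complex_vector.dependent
    and crepresentation = complex_vector.representation
    and csubspace = complex_vector.subspace
    and cspan = complex_vector.span
    and cextend_basis = complex_vector.extend_basis
    and cdim = complex_vector.dim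
  by unfold_locales
    (simp_all add: scaleC_add_right scaleC_add_left scaleC_scaleC scaleC_one)

definition infinite_dimensional :: "'a::complex_normed_vector itself \<Rightarrow> bool" where
  "infinite_dimensional _ \<longleftrightarrow> \<not> (\<exists>B :: 'a set. finite B \<and> cspan B = UNIV)"

definition bounded_clinear ::
    "('a::complex_normed_vector \<Rightarrow> 'b::complex_normed_vector) \<Rightarrow> bool" where
  "bounded_clinear f \<longleftrightarrow> bounded_linear f \<and> (\<forall>c x. f (c *\<^sub>C x) = c *\<^sub>C f x)"

instantiation complex :: complex_normed_vector
begin
definition scaleC_complex :: "complex \<Rightarrow> complex \<Rightarrow> complex" where
  "scaleC_complex c z = c * z"
instance
  by standard (simp_all add: scaleC_complex_def algebra_simps norm_mult scaleR_conv_of_real)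
end

section \<open>The dual space and the dual operator\<close>

text \<open>The type \<open>'a \<Rightarrow>\<^sub>L complex\<close> consists of the bounded real-linear maps with the operator
  norm; the dual is its closed subspace of complex-linear maps.\<close>

typedef (overloaded) 'a cdual =
    "{f :: 'a::complex_normed_vector \<Rightarrow>\<^sub>L complex. \<forall>c x. blinfun_apply f (c *\<^sub>C x) = c * blinfun_apply f x}"
  by (rule exI[of _ 0]) simp

setup_lifting type_definition_cdual

lift_definition cdual_apply :: "'a::complex_normed_vector cdual \<Rightarrow> 'a \<Rightarrow> complex"
  is blinfun_apply .

instantiation cdual :: (complex_normed_vector) complex_normed_vector
begin

lift_definition zero_cdual :: "'a cdual" is 0 by simp
lift_definition plus_cdual :: "'a cdual \<Rightarrow> 'a cdual \<Rightarrow> 'a cdual" is "(+)"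
  by (simp add: blinfun.add_left algebra_simps)
lift_definition minus_cdual :: "'a cdual \<Rightarrow> 'a cdual \<Rightarrow> 'a cdual" is "(-)"
  by (simp add: blinfun.diff_left algebra_simps)
lift_definition uminus_cdual :: "'a cdual \<Rightarrow> 'a cdual" is "uminus"
  by (simp add: blinfun.minus_left)
lift_definition scaleR_cdual :: "real \<Rightarrow> 'a cdual \<Rightarrow> 'a cdual" is "scaleR"
  by (simp add: blinfun.scaleR_left)
lift_definition scaleC_cdual :: "complex \<Rightarrow> 'a cdual \<Rightarrow> 'a cdual"
  is "\<lambda>c f. blinfun_mult_right c o\<^sub>L f"
  by simp
lift_definition norm_cdual :: "'a cdual \<Rightarrow> real" is norm .

definition dist_cdual :: "'a cdual \<Rightarrow> 'a cdual \<Rightarrow> real" where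
  "dist_cdual f g = norm (f - g)"
definition sgn_cdual :: "'a cdual \<Rightarrow> 'a cdual" where
  "sgn_cdual f = scaleR (inverse (norm f)) f"
definition uniformity_cdual :: "('a cdual \<times> 'a cdual) filter" where
  "uniformity_cdual = (INF e\<in>{0 <..}. principal {(x, y). dist x y < e})"
definition open_cdual :: "'a cdual set \<Rightarrow> bool" where
  "open_cdual U = (\<forall>x\<in>U. eventually (\<lambda>(x', y). x' = x \<longrightarrow> y \<in> U) uniformity)"

instance
proof
  fix f g h :: "'a cdual" and r s :: real and c d :: complex
  show "f + g + h = f + (g + h)" by transfer (simp add: algebra_simps)
  show "f + g = g + f" by transfer (simp add: algebra_simps)
  show "0 + f = f" by transfer simp
  show "- f + f = 0" by transfer simp
  show "f - g = f + - g" by transfer simp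
  show "r *\<^sub>R (f + g) = r *\<^sub>R f + r *\<^sub>R g" by transfer (simp add: algebra_simps)
  show "(r + s) *\<^sub>R f = r *\<^sub>R f + s *\<^sub>R f" by transfer (simp add: algebra_simps)
  show "r *\<^sub>R s *\<^sub>R f = (r * s) *\<^sub>R f" by transfer simp
  show "1 *\<^sub>R f = f" by transfer simp
  show "dist f g = norm (f - g)" by (rule dist_cdual_def)
  show "sgn f = scaleR (inverse (norm f)) f" by (rule sgn_cdual_def)
  show "uniformity = (INF e\<in>{0 <..}. principal {(x :: 'a cdual, y). dist x y < e})"
    by (rule uniformity_cdual_def)
  show "open U = (\<forall>x\<in>U. eventually (\<lambda>(x', y). x' = x \<longrightarrow> y \<in> U) uniformity)" for U :: "'a cdual set"
    by (rule open_cdual_def)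
  show "(norm f = 0) = (f = 0)" by transfer simp
  show "norm (f + g) \<le> norm f + norm g" by transfer (rule norm_triangle_ineq)
  show "norm (r *\<^sub>R f) = \<bar>r\<bar> * norm f" by transfer simp
  show "c *\<^sub>C (f + g) = c *\<^sub>C f + c *\<^sub>C g"
    by transfer (auto intro!: blinfun_eqI simp: blinfun.add_left blinfun.add_right algebra_simps)
  show "(c + d) *\<^sub>C f = c *\<^sub>C f + d *\<^sub>C f"
    by transfer (auto intro!: blinfun_eqI simp: blinfun.add_left algebra_simps)
  show "c *\<^sub>C d *\<^sub>C f = (c * d) *\<^sub>C f"
    by transfer (auto intro!: blinfun_eqI)
  show "complex_of_real r *\<^sub>C f = r *\<^sub>R f"
    by transfer (auto intro!: blinfun_eqI simp: blinfun.scaleR_left scaleR_conv_of_real)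
  show "norm (c *\<^sub>C f) = cmod c * norm f"
  proof (transfer fixing: c)
    fix f :: "'a \<Rightarrow>\<^sub>L complex"
    have le: "norm (blinfun_mult_right c o\<^sub>L g) \<le> cmod c * norm g"
      for c and g :: "'a \<Rightarrow>\<^sub>L complex"
      by (rule norm_blinfun_bound)
        (use norm_blinfun[of g] in \<open>auto simp: norm_mult mult.assoc intro!: mult_left_mono\<close>)
    show "norm (blinfun_mult_right c o\<^sub>L f) = cmod c * norm f"
    proof (cases "c = 0")
      case True
      then show ?thesis using le[of c f] by simp
    next
      case False
      have "f = blinfun_mult_right (inverse c) o\<^sub>L (blinfun_mult_right c o\<^sub>L f)"
        by (rule blinfun_eqI) (use False in simp)
      then have "norm f \<le> cmod (inverse c) * norm (blinfun_mult_right c o\<^sub>L f)"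
        using le[of "inverse c" "blinfun_mult_right c o\<^sub>L f"] by simp
      then have "cmod c * norm f \<le> norm (blinfun_mult_right c o\<^sub>L f)"
        using False by (simp add: norm_divide field_simps)
      then show ?thesis using le[of c f] by simp
    qed
  qed
qed

end

instance cdual :: (complex_normed_vector) complex_banach
proof
  fix X :: "nat \<Rightarrow> 'a cdual"
  assume X: "Cauchy X"
  have dist_Rep: "dist (Rep_cdual f) (Rep_cdual g) = dist f g" for f g :: "'a cdual"
    by (simp add: dist_cdual_def dist_norm norm_cdual.rep_eq minus_cdual.rep_eq)
  have "Cauchy (\<lambda>n. Rep_cdual (X n))"
    using X by (simp add: Cauchy_def dist_Rep)
  then obtain F where F: "(\<lambda>n. Rep_cdual (X n)) \<longlonglongrightarrow> F"
    using Cauchy_convergent convergent_def by blast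
  have app: "(\<lambda>n. blinfun_apply (Rep_cdual (X n)) x) \<longlonglongrightarrow> blinfun_apply F x" for x
    by (rule tendsto_intros F)+
  have "blinfun_apply F (c *\<^sub>C x) = c * blinfun_apply F x" for c x
  proof (rule LIMSEQ_unique[OF app])
    show "(\<lambda>n. blinfun_apply (Rep_cdual (X n)) (c *\<^sub>C x)) \<longlonglongrightarrow> c * blinfun_apply F x"
      using tendsto_mult_left[OF app[of x], of c] Rep_cdual[of "X _"] by simp
  qed
  then have "Rep_cdual (Abs_cdual F) = F"
    by (simp add: Abs_cdual_inverse)
  then have "X \<longlonglongrightarrow> Abs_cdual F"
    using F by (simp add: tendsto_dist_iff[where 'b = "'a cdual"] dist_Rep[symmetric]
        tendsto_dist_iff[of _ F])
  then show "convergent X"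
    by (auto simp: convergent_def)
qed

text \<open>Meaningful for \<open>T\<close> with \<open>bounded_clinear T\<close>, see \<open>cdual_apply_dual_operator\<close>.\<close>

definition dual_operator ::
    "('a::complex_normed_vector \<Rightarrow> 'b::complex_normed_vector) \<Rightarrow> 'b cdual \<Rightarrow> 'a cdual" where
  "dual_operator T f = Abs_cdual (Blinfun (\<lambda>x. cdual_apply f (T x)))"

lemma cdual_apply_dual_operator:
  assumes "bounded_clinear T"
  shows "cdual_apply (dual_operator T f) x = cdual_apply f (T x)"
proof -
  have "bounded_linear (\<lambda>x. blinfun_apply (Rep_cdual f) (T x))"
    using assms by (intro bounded_linear_intros) (simp add: bounded_clinear_def)
  then have *: "blinfun_apply (Blinfun (\<lambda>x. blinfun_apply (Rep_cdual f) (T x)))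
      = (\<lambda>x. blinfun_apply (Rep_cdual f) (T x))"
    by (rule bounded_linear_Blinfun_apply)
  show ?thesis
    using assms Rep_cdual[of f]
    by (simp add: dual_operator_def cdual_apply.rep_eq Abs_cdual_inverse * bounded_clinear_def)
qed

section \<open>Spectral theory of operators\<close>

definition edim :: "'a::complex_normed_vector set \<Rightarrow> enat" where
  "edim S = (if \<exists>B. finite B \<and> cspan B = S then enat (cdim S) else \<infinity>)"

text \<open>The dimension of the quotient by the subspace \<open>S\<close>, as the least number of vectors whose
  cosets span the quotient (\<open>Inf {} = \<infinity>\<close>).\<close>

definition ecodim :: "'a::complex_normed_vector set \<Rightarrow> enat" where
  "ecodim S = Inf {enat (card B) | B. finite B \<and> cspan (S \<union> B) = UNIV}"

lemma ecodim_eq_edim_complement: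
  fixes S C :: "'a::complex_normed_vector set"
  assumes S: "csubspace S" and C: "csubspace C"
    and disjoint: "S \<inter> C = {0}" and sum: "\<And>x. \<exists>s\<in>S. \<exists>c\<in>C. x = s + c"
  shows "ecodim S = edim C"
proof -
  have upper: "finite B \<Longrightarrow> cspan B = C \<Longrightarrow> ecodim S \<le> enat (cdim C)" for B
  proof -
    assume B: "finite B" "cspan B = C"
    obtain D where D: "D \<subseteq> C" "\<not> cdependent D" "C \<subseteq> cspan D" "card D = cdim C"
      by (rule complex_vector.basis_exists[of C])
    have "finite D"
      using complex_vector.independent_span_bound[OF B(1) D(2)] D(1) B(2) by blast
    have "x \<in> cspan (S \<union> D)" for x
    proof -
      obtain s c where "s \<in> S" "c \<in> C" "x = s + c" using sum by blast
      then have "s \<in> cspan (S \<union> D)" "c \<in> cspan (S \<union> D)"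
        using D(3) complex_vector.span_mono[of D "S \<union> D"] by (auto intro: complex_vector.span_base)
      then show ?thesis
        using \<open>x = s + c\<close> complex_vector.span_add by blast
    qed
    then have "enat (cdim C) \<in> {enat (card B) | B. finite B \<and> cspan (S \<union> B) = UNIV}"
      using D(4) \<open>finite D\<close> by (metis (mono_tags, lifting) UNIV_eq_I mem_Collect_eq)
    then show ?thesis
      unfolding ecodim_def by (rule Inf_lower)
  qed
  have lower: "(\<exists>B'. finite B' \<and> cspan B' = C) \<and> cdim C \<le> card B"
    if B: "finite B" "cspan (S \<union> B) = UNIV" for B
  proof -
    obtain p where p: "\<And>x. p x \<in> C" "\<And>x. x - p x \<in> S"
    proof -
      have "\<exists>c. c \<in> C \<and> x - c \<in> S" for x
        using sum[of x] by (metis add_diff_cancel_right')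
      then show ?thesis using that by metis
    qed
    have sub: "cspan (p ` B) \<subseteq> C"
      using p(1) C by (intro complex_vector.span_minimal) auto
    have "\<exists>c\<in>cspan (p ` B). x - c \<in> S" for x
    proof -
      have "x \<in> cspan (S \<union> B)" using B by simp
      then show ?thesis
      proof (induction rule: complex_vector.span_induct_alt)
        case base
        show ?case using complex_vector.subspace_0[OF S] complex_vector.span_zero by force
      next
        case (step k x y)
        then obtain c where c: "c \<in> cspan (p ` B)" "y - c \<in> S" by blast
        show ?case
        proof (cases "x \<in> S")
          case True
          have "k *\<^sub>C x + (y - c) \<in> S"
            using S True c by (intro complex_vector.subspace_add complex_vector.subspace_scale)
          then show ?thesis using c(1) by (metis add_diff_eq)
        next
          case False
          then have "x \<in> B" using step by blast
          then have "k *\<^sub>C p x + c \<in> cspan (p ` B)"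
            using c by (intro complex_vector.span_add complex_vector.span_scale) (auto intro: complex_vector.span_base)
          moreover have "k *\<^sub>C (x - p x) + (y - c) \<in> S"
            using S p(2) c by (intro complex_vector.subspace_add complex_vector.subspace_scale)
          then have "(k *\<^sub>C x + y) - (k *\<^sub>C p x + c) \<in> S"
            by (simp add: complex_vector.scale_right_diff_distrib algebra_simps)
          ultimately show ?thesis by blast
        qed
      qed
    qed
    then have "x \<in> cspan (p ` B)" if "x \<in> C" for x
    proof -
      obtain c where c: "c \<in> cspan (p ` B)" "x - c \<in> S"
        using \<open>\<And>x. \<exists>c\<in>cspan (p ` B). x - c \<in> S\<close> by blast
      then have "x - c \<in> S \<inter> C"
        using sub that complex_vector.subspace_diff[OF C] by blast
      then show ?thesis using c disjoint by simp
    qed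
    then have eq: "cspan (p ` B) = C" using sub by blast
    then have "cdim C \<le> card (p ` B)"
      using B by (intro complex_vector.dim_le_card) auto
    also have "\<dots> \<le> card B" using B by (intro card_image_le)
    finally show ?thesis using eq B(1) by blast
  qed
  show ?thesis
  proof (cases "\<exists>B. finite B \<and> cspan B = C")
    case True
    have "enat (cdim C) \<le> ecodim S"
      unfolding ecodim_def by (rule Inf_greatest) (use lower in auto)
    then show ?thesis using upper True by (auto simp: edim_def intro: antisym)
  next
    case False
    then have "{enat (card B) | B. finite B \<and> cspan (S \<union> B) = UNIV} = {}"
      using lower by blast
    then show ?thesis using False by (simp only: edim_def ecodim_def) (simp add: top_enat_def)
  qed
qed

abbreviation kernel :: "('a \<Rightarrow> 'b::zero) \<Rightarrow> 'a set" where
  "kernel T \<equiv> {x. T x = 0}"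

definition nullity :: "('a::complex_normed_vector \<Rightarrow> 'b::complex_normed_vector) \<Rightarrow> enat" where
  "nullity T = edim (kernel T)"

definition deficiency :: "('a::complex_normed_vector \<Rightarrow> 'b::complex_normed_vector) \<Rightarrow> enat" where
  "deficiency T = ecodim (range T)"

definition shift :: "('a::complex_normed_vector \<Rightarrow> 'a) \<Rightarrow> complex \<Rightarrow> 'a \<Rightarrow> 'a" where
  "shift T \<mu> = (\<lambda>x. T x - \<mu> *\<^sub>C x)"

definition spectrum :: "('a::complex_normed_vector \<Rightarrow> 'a) \<Rightarrow> complex set" where
  "spectrum T = {\<mu>. \<not> (\<exists>S. bounded_clinear S \<and> S \<circ> shift T \<mu> = id \<and> shift T \<mu> \<circ> S = id)}"

definition approx_point_spectrum :: "('a::complex_normed_vector \<Rightarrow> 'a) \<Rightarrow> complex set" where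
  "approx_point_spectrum T =
    {\<mu>. \<exists>x :: nat \<Rightarrow> 'a. (\<forall>n. norm (x n) = 1) \<and> (\<lambda>n. shift T \<mu> (x n)) \<longlonglongrightarrow> 0}"

definition upper_semi_Fredholm :: "('a::complex_normed_vector \<Rightarrow> 'a) \<Rightarrow> bool" where
  "upper_semi_Fredholm T \<longleftrightarrow> closed (range T) \<and> nullity T < \<infinity>"

text \<open>Only meaningful if one of the two terms is finite, as for upper semi-Fredholm operators.\<close>

definition fredholm_index :: "('a::complex_normed_vector \<Rightarrow> 'a) \<Rightarrow> ereal" where
  "fredholm_index T = ereal_of_enat (nullity T) - ereal_of_enat (deficiency T)"

definition upper_semi_Weyl :: "('a::complex_normed_vector \<Rightarrow> 'a) \<Rightarrow> bool" where
  "upper_semi_Weyl T \<longleftrightarrow> upper_semi_Fredholm T \<and> fredholm_index T \<le> 0"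

definition upper_semi_Weyl_spectrum :: "('a::complex_normed_vector \<Rightarrow> 'a) \<Rightarrow> complex set" where
  "upper_semi_Weyl_spectrum T = {\<mu>. \<not> upper_semi_Weyl (shift T \<mu>)}"

definition ascent :: "('a::complex_normed_vector \<Rightarrow> 'a) \<Rightarrow> enat" where
  "ascent T = Inf {enat n | n. kernel (T ^^ n) = kernel (T ^^ (n + 1))}"

definition left_poles :: "('a::complex_normed_vector \<Rightarrow> 'a) \<Rightarrow> complex set" where
  "left_poles T = {\<mu> \<in> approx_point_spectrum T.
    \<exists>p. ascent (shift T \<mu>) = enat p \<and> closed (range (shift T \<mu> ^^ (p + 1)))}"

definition finite_rank_left_poles :: "('a::complex_normed_vector \<Rightarrow> 'a) \<Rightarrow> complex set" where
  "finite_rank_left_poles T = {\<mu> \<in> left_poles T. nullity (shift T \<mu>) < \<infinity>}"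

definition finite_mult_eigenvalues :: "('a::complex_normed_vector \<Rightarrow> 'a) \<Rightarrow> complex set" where
  "finite_mult_eigenvalues T = {\<mu>. 0 < nullity (shift T \<mu>) \<and> nullity (shift T \<mu>) < \<infinity>}"

definition isolated_points :: "complex set \<Rightarrow> complex set" where
  "isolated_points A = {z. z isolated_in A}"

definition property_z :: "('a::complex_normed_vector \<Rightarrow> 'a) \<Rightarrow> bool" where
  "property_z T \<longleftrightarrow> spectrum T - upper_semi_Weyl_spectrum T
    = isolated_points (approx_point_spectrum T) \<inter> finite_mult_eigenvalues T"

definition property_az :: "('a::complex_normed_vector \<Rightarrow> 'a) \<Rightarrow> bool" where
  "property_az T \<longleftrightarrow> spectrum T - upper_semi_Weyl_spectrum T = finite_rank_left_poles T"

definition analytic_into :: "(complex \<Rightarrow> 'a::complex_normed_vector) \<Rightarrow> complex set \<Rightarrow> bool" where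
  "analytic_into f U \<longleftrightarrow> (\<forall>z\<in>U. \<exists>D. (f has_derivative (\<lambda>h. h *\<^sub>C D)) (at z))"

definition SVEP_at :: "('a::complex_normed_vector \<Rightarrow> 'a) \<Rightarrow> complex \<Rightarrow> bool" where
  "SVEP_at T z \<longleftrightarrow> (\<forall>U f. open U \<and> z \<in> U \<and> analytic_into f U \<and> (\<forall>\<mu>\<in>U. shift T \<mu> (f \<mu>) = 0)
    \<longrightarrow> (\<forall>\<mu>\<in>U. f \<mu> = 0))"

definition SVEP :: "('a::complex_normed_vector \<Rightarrow> 'a) \<Rightarrow> bool" where
  "SVEP T \<longleftrightarrow> (\<forall>z. SVEP_at T z)"

section \<open>Banach algebras\<close>

definition multiplier :: "('a::complex_banach_algebra \<Rightarrow> 'a) \<Rightarrow> bool" where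
  "multiplier T \<longleftrightarrow> bounded_clinear T \<and> (\<forall>a b. a * T b = T a * b)"

definition left_ideal :: "'a::complex_banach_algebra set \<Rightarrow> bool" where
  "left_ideal L \<longleftrightarrow> csubspace L \<and> (\<forall>a. \<forall>x\<in>L. a * x \<in> L)"

definition modular_left_ideal :: "'a::complex_banach_algebra set \<Rightarrow> bool" where
  "modular_left_ideal L \<longleftrightarrow> left_ideal L \<and> (\<exists>u. \<forall>a. a - a * u \<in> L)"

definition maximal_modular_left_ideal :: "'a::complex_banach_algebra set \<Rightarrow> bool" where
  "maximal_modular_left_ideal L \<longleftrightarrow> modular_left_ideal L \<and> L \<noteq> UNIV \<and>
    (\<forall>M. left_ideal M \<and> L \<subseteq> M \<longrightarrow> M = L \<or> M = UNIV)"

text \<open>The whole algebra if there is no maximal modular left ideal.\<close>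

definition jacobson_radical :: "'a::complex_banach_algebra set" where
  "jacobson_radical = \<Inter> {L. maximal_modular_left_ideal L}"

definition semisimple :: "'a::complex_banach_algebra itself \<Rightarrow> bool" where
  "semisimple _ \<longleftrightarrow> (jacobson_radical :: 'a set) = {0}"

definition commutative :: "'a::complex_banach_algebra itself \<Rightarrow> bool" where
  "commutative _ \<longleftrightarrow> (\<forall>a b :: 'a. a * b = b * a)"

text \<open>The maximal ideal space of a commutative Banach algebra, each maximal modular ideal being
  identified with the nonzero multiplicative functional of which it is the kernel. Its topology is
  that of pointwise convergence, i.e. the subspace topology of the product topology that functions
  carry.\<close>

definition characters :: "('a::complex_banach_algebra \<Rightarrow> complex) set" where
  "characters = {\<phi>. bounded_clinear \<phi> \<and> (\<forall>a b. \<phi> (a * b) = \<phi> a * \<phi> b) \<and> (\<exists>a. \<phi> a \<noteq> 0)}"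

definition gelfand_topology :: "('a::complex_banach_algebra \<Rightarrow> complex) topology" where
  "gelfand_topology = top_of_set characters"

definition gelfand_transform :: "'a::complex_banach_algebra \<Rightarrow> ('a \<Rightarrow> complex) \<Rightarrow> complex" where
  "gelfand_transform a \<phi> = \<phi> a"

definition regular_algebra :: "'a::complex_banach_algebra itself \<Rightarrow> bool" where
  "regular_algebra _ \<longleftrightarrow> (\<forall>E (\<phi> :: 'a \<Rightarrow> complex).
    closedin gelfand_topology E \<and> \<phi> \<in> characters - E \<longrightarrow>
    (\<exists>a. (\<forall>\<psi>\<in>E. gelfand_transform a \<psi> = 0) \<and> gelfand_transform a \<phi> \<noteq> 0))"

definition gelfand_support :: "'a::complex_banach_algebra \<Rightarrow> ('a \<Rightarrow> complex) set" where
  "gelfand_support a = gelfand_topology closure_of {\<phi> \<in> characters. gelfand_transform a \<phi> \<noteq> 0}"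

definition tauberian :: "'a::complex_banach_algebra itself \<Rightarrow> bool" where
  "tauberian _ \<longleftrightarrow> closure {a :: 'a. compactin gelfand_topology (gelfand_support a)} = UNIV"

end

theory Submission
  imports Defs
begin

text \<open>
  The whole proposition rests on one observation about a multiplier \<open>S\<close> of a semisimple algebra. If
  \<open>S x = 0\<close> and \<open>x\<close> is a limit of elements \<open>S a\<close>, then \<open>x b x\<close> is a limit of elements
  \<open>(S a) b x = a b (S x) = 0\<close>, and \<open>x A x = 0\<close> forces \<open>x = 0\<close>. So the kernel of \<open>S\<close> meets the closure of the
  range of \<open>S\<close> only in \<open>0\<close> (\<open>multiplier_kernel_closure_range\<close>). Applied to \<open>S = T - \<mu>\<close>, which is again a
  multiplier, this gives the ascent, the inequality between nullity and deficiency, and the SVEP,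
  because an analytic family of eigenvectors takes its value at \<open>\<mu>\<close> in the kernel and in the closure of
  the range of \<open>T - \<mu>\<close>.

  Call an operator group invertible if the space is the direct sum of its kernel and of a closed
  complement on which it is invertible. If \<open>T - \<mu>\<close> is group invertible with finite nullity, then each of
  the three conditions occurring in the properties \<open>(z)\<close> and \<open>(az)\<close> holds at \<open>\<mu>\<close> exactly if \<open>\<mu>\<close> is an
  eigenvalue (\<open>group_invertible_spectral_characterization\<close>). Hence it suffices to show that each of
  these conditions implies group invertibility.

  Let \<open>S = T - \<mu>\<close> have finite-dimensional kernel in the commutative case. The kernel is an ideal with a
  unit \<open>e\<close>, and \<open>S + e\<close> is an injective multiplier; \<open>S\<close> is group invertible once \<open>S + e\<close> is invertible. If
  some power of \<open>S\<close> has closed range, then \<open>S + e\<close> is bounded below; if \<open>\<mu>\<close> is isolated in the approximate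
  point spectrum, then \<open>S + e - \<nu>\<close> is invertible for all small \<open>\<nu> \<noteq> 0\<close>. In a regular Tauberian algebra both
  imply that \<open>S + e\<close> is invertible (\<open>bounded_below_multiplier_invertible\<close>, \<open>isolated_multiplier_invertible\<close>).
  Regularity shows in each case that no character annihilates the range: otherwise there would be
  an element concentrated where the symbol of the multiplier is small. It also provides
  local units (\<open>local_unit\<close>), so the range contains all elements of compact support. In the first
  case the range is closed, hence everything. In the second case a lower bound on the elements
  of compact support is obtained from means of the resolvent over a small circle.

  The Gelfand theory behind this is developed without quotient algebras: one works modulo an ideal by
  means of the distance to it. Spectral radius formula and Gelfand--Mazur theorem both follow from
  the fact that the mean of \<open>(1 - \<omega> z y)\<^sup>-\<^sup>1\<close> over the \<open>n\<close>-th roots of unity \<open>\<omega>\<close> is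
  \<open>(1 - (z y)\<^sup>n)\<^sup>-\<^sup>1\<close> (\<open>powers_tendsto_0\<close>).

  For the dual operator the conditions are transported to \<open>S\<close>. By the Hahn--Banach theorem closed
  range of \<open>S\<^sup>*\<close> implies closed range of \<open>S\<close> (\<open>closed_range_of_dual\<close>), and finite nullity of
  \<open>S\<^sup>*\<close> implies finite nullity of \<open>S\<close> (\<open>multiplier_nullity_finite_if_dual\<close>). So \<open>S\<close> is group
  invertible, and therefore \<open>S\<^sup>*\<close> is.
\<close>

section \<open>Bounded operators on complex Banach spaces\<close>

lemma bounded_clinearI:
  assumes "\<And>x y. f (x + y) = f x + f y" "\<And>c x. f (c *\<^sub>C x) = c *\<^sub>C f x"
    and "\<And>x. norm (f x) \<le> K * norm x"
  shows "bounded_clinear f"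
proof -
  have "f (r *\<^sub>R x) = r *\<^sub>R f x" for r x
    using assms(2)[of "complex_of_real r" x] by (simp add: scaleC_of_real)
  then show ?thesis
    unfolding bounded_clinear_def
    using assms by (auto intro!: bounded_linear_intro[where K = K] simp: mult.commute)
qed

lemma bounded_clinear_bounded_linear: "bounded_clinear f \<Longrightarrow> bounded_linear f"
  by (simp add: bounded_clinear_def)

lemma bounded_clinear_scaleC: "bounded_clinear f \<Longrightarrow> f (c *\<^sub>C x) = c *\<^sub>C f x"
  by (simp add: bounded_clinear_def)

lemma bounded_clinear_linear: "bounded_clinear f \<Longrightarrow> linear f"
  using bounded_linear.linear bounded_clinear_bounded_linear by blast

lemma bounded_clinear_add: "bounded_clinear f \<Longrightarrow> f (x + y) = f x + f y"
  by (rule linear_add[OF bounded_clinear_linear])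

lemma bounded_clinear_diff: "bounded_clinear f \<Longrightarrow> f (x - y) = f x - f y"
  by (rule linear_diff[OF bounded_clinear_linear])

lemma bounded_clinear_0: "bounded_clinear f \<Longrightarrow> f 0 = 0"
  by (rule linear_0[OF bounded_clinear_linear])

lemma bounded_clinear_bound:
  assumes "bounded_clinear f"
  obtains K where "K > 0" "\<And>x. norm (f x) \<le> K * norm x"
  using bounded_linear.pos_bounded[OF bounded_clinear_bounded_linear[OF assms]]
  by (auto simp: mult.commute)

lemma bounded_clinear_ident: "bounded_clinear (\<lambda>x. x)"
  by (simp add: bounded_clinear_def)

lemma bounded_clinear_compose:
  "bounded_clinear f \<Longrightarrow> bounded_clinear g \<Longrightarrow> bounded_clinear (\<lambda>x. f (g x))"
  by (auto simp: bounded_clinear_def intro: bounded_linear_compose)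

lemma bounded_clinear_plus:
  "bounded_clinear f \<Longrightarrow> bounded_clinear g \<Longrightarrow> bounded_clinear (\<lambda>x. f x + g x)"
  by (auto simp: bounded_clinear_def scaleC_add_right intro: bounded_linear_add)

lemma bounded_clinear_minus:
  "bounded_clinear f \<Longrightarrow> bounded_clinear g \<Longrightarrow> bounded_clinear (\<lambda>x. f x - g x)"
  by (auto simp: bounded_clinear_def complex_vector.scale_right_diff_distrib intro: bounded_linear_sub)

lemma bounded_clinear_scale:
  assumes "bounded_clinear f"
  shows "bounded_clinear (\<lambda>x. c *\<^sub>C f x)"
proof -
  obtain K where K: "\<And>x. norm (f x) \<le> K * norm x" using bounded_clinear_bound[OF assms] by blast
  show ?thesis
  proof (rule bounded_clinearI[where K = "cmod c * K"])
    show "c *\<^sub>C f (x + y) = c *\<^sub>C f x + c *\<^sub>C f y" for x y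
      by (simp add: bounded_clinear_add[OF assms] scaleC_add_right)
    show "c *\<^sub>C f (d *\<^sub>C x) = d *\<^sub>C c *\<^sub>C f x" for d x
      by (simp add: bounded_clinear_scaleC[OF assms] scaleC_scaleC mult.commute)
    show "norm (c *\<^sub>C f x) \<le> cmod c * K * norm x" for x
      using mult_left_mono[OF K, of "cmod c" x] by (simp add: norm_scaleC mult.assoc)
  qed
qed

lemma bounded_clinear_shift: "bounded_clinear T \<Longrightarrow> bounded_clinear (shift T \<mu>)"
  unfolding shift_def
  by (intro bounded_clinear_minus bounded_clinear_scale bounded_clinear_ident)

lemma bounded_clinear_funpow:
  fixes f :: "'a::complex_normed_vector \<Rightarrow> 'a"
  shows "bounded_clinear f \<Longrightarrow> bounded_clinear (f ^^ n)"
proof (induction n)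
  case 0
  show ?case unfolding funpow.simps id_def by (rule bounded_clinear_ident)
next
  case (Suc n)
  then show ?case using bounded_clinear_compose[of f "f ^^ n"] by (simp add: comp_def)
qed

lemma csubspace_kernel:
  assumes "bounded_clinear f" shows "csubspace (kernel f)"
  by (rule complex_vector.subspaceI)
    (auto simp: bounded_clinear_0[OF assms] bounded_clinear_add[OF assms] bounded_clinear_scaleC[OF assms])

lemma csubspace_range:
  assumes "bounded_clinear f" shows "csubspace (range f)"
proof (rule complex_vector.subspaceI)
  show "0 \<in> range f" by (rule range_eqI[of _ _ 0]) (simp add: bounded_clinear_0[OF assms])
  show "x + y \<in> range f" if "x \<in> range f" "y \<in> range f" for x y
    using that by (auto simp flip: bounded_clinear_add[OF assms])
  show "c *\<^sub>C x \<in> range f" if "x \<in> range f" for c x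
    using that by (auto simp flip: bounded_clinear_scaleC[OF assms])
qed

lemma closed_kernel:
  assumes "bounded_clinear f" shows "closed (kernel f)"
  using continuous_closed_vimage[of "{0}" f] bounded_clinear_bounded_linear[OF assms]
  by (simp add: vimage_def linear_continuous_at)

lemma tendsto_bounded_clinear:
  "bounded_clinear f \<Longrightarrow> (g \<longlongrightarrow> l) F \<Longrightarrow> ((\<lambda>x. f (g x)) \<longlongrightarrow> f l) F"
  using bounded_linear.tendsto bounded_clinear_bounded_linear by blast

subsection \<open>Operators bounded below\<close>

definition bounded_below ::
    "('a::complex_normed_vector \<Rightarrow> 'b::complex_normed_vector) \<Rightarrow> bool" where
  "bounded_below U \<longleftrightarrow> (\<exists>c>0. \<forall>x. c * norm x \<le> norm (U x))"

definition invertible_operator :: "('a::complex_normed_vector \<Rightarrow> 'a) \<Rightarrow> bool" where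
  "invertible_operator U \<longleftrightarrow> (\<exists>V. bounded_clinear V \<and> V \<circ> U = id \<and> U \<circ> V = id)"

lemma not_in_spectrum_iff: "\<mu> \<notin> spectrum T \<longleftrightarrow> invertible_operator (shift T \<mu>)"
  by (auto simp: spectrum_def invertible_operator_def)

lemma invertible_operatorI:
  "bounded_clinear V \<Longrightarrow> (\<And>x. V (U x) = x) \<Longrightarrow> (\<And>x. U (V x) = x) \<Longrightarrow> invertible_operator U"
  unfolding invertible_operator_def by (intro exI[of _ V]) auto

lemma invertible_operatorE:
  assumes "invertible_operator U"
  obtains V where "bounded_clinear V" "\<And>x. V (U x) = x" "\<And>x. U (V x) = x"
  using assms unfolding invertible_operator_def by (metis comp_apply id_apply)

lemma invertible_operator_bounded_below:
  assumes "invertible_operator U" shows "bounded_below U"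
proof -
  obtain V where V: "bounded_clinear V" "\<And>x. V (U x) = x" using invertible_operatorE[OF assms] by metis
  obtain K where K: "K > 0" "\<And>x. norm (V x) \<le> K * norm x" using bounded_clinear_bound[OF V(1)] by blast
  have "(1 / K) * norm x \<le> norm (U x)" for x
    using K(2)[of "U x"] K(1) V(2) by (simp add: field_simps)
  then show ?thesis using K(1) unfolding bounded_below_def by (intro exI[of _ "1 / K"]) auto
qed

lemma bounded_below_surj_imp_invertible:
  assumes U: "bounded_clinear U" and "bounded_below U" and surj: "range U = UNIV"
  shows "invertible_operator U"
proof -
  obtain c where c: "c > 0" "\<And>x. c * norm x \<le> norm (U x)"
    using assms(2) unfolding bounded_below_def by blast
  have inj: "x = y" if "U x = U y" for x y
    using c(2)[of "x - y"] c(1) that bounded_clinear_diff[OF U, of x y]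
    by (simp add: mult_le_0_iff)
  obtain V where V: "\<And>y. U (V y) = y" using surj by (metis surj_def)
  have "bounded_clinear V"
  proof (rule bounded_clinearI[where K = "1 / c"])
    show "V (x + y) = V x + V y" for x y by (rule inj) (simp add: V bounded_clinear_add[OF U])
    show "V (d *\<^sub>C x) = d *\<^sub>C V x" for d x by (rule inj) (simp add: V bounded_clinear_scaleC[OF U])
    show "norm (V x) \<le> 1 / c * norm x" for x
      using c(2)[of "V x"] c(1) V[of x] by (simp add: field_simps)
  qed
  then show ?thesis by (rule invertible_operatorI) (auto intro: inj V)
qed

lemma bounded_below_closed_range:
  fixes U :: "'a::complex_banach \<Rightarrow> 'b::complex_normed_vector"
  assumes U: "bounded_clinear U" and "bounded_below U"
  shows "closed (range U)"
proof -
  obtain c where c: "c > 0" "\<And>x. c * norm x \<le> norm (U x)"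
    using assms(2) unfolding bounded_below_def by blast
  have "complete (range U)"
    using complete_isometric_image[OF c(1) _ bounded_clinear_bounded_linear[OF U], of UNIV] c(2)
    by (simp add: complete_UNIV)
  then show ?thesis by (rule complete_imp_closed)
qed

text \<open>The approximate point spectrum is defined through sequences, so a compact set of
  parameters outside it has a common lower bound, by the Bolzano--Weierstrass theorem.\<close>

lemma uniformly_bounded_below:
  fixes T :: "'a::complex_normed_vector \<Rightarrow> 'a"
  assumes T: "bounded_clinear T" and K: "compact K" "K \<inter> approx_point_spectrum T = {}"
  obtains c where "c > 0" "\<And>\<mu> x. \<mu> \<in> K \<Longrightarrow> c * norm x \<le> norm (shift T \<mu> x)"
proof (rule ccontr)
  assume contra: "\<not> thesis"
  have "\<exists>\<mu> x. \<mu> \<in> K \<and> norm x = 1 \<and> norm (shift T \<mu> x) < 1 / Suc n" for n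
  proof (rule ccontr)
    assume no: "\<not> ?thesis"
    have "1 / Suc n * norm x \<le> norm (shift T \<mu> x)" if "\<mu> \<in> K" for \<mu> x
    proof (cases "x = 0")
      case False
      define y where "y = complex_of_real (1 / norm x) *\<^sub>C x"
      have "norm y = 1" using False by (simp add: y_def norm_scaleC norm_divide)
      then have "1 / Suc n \<le> norm (shift T \<mu> y)" using no that by force
      also have "shift T \<mu> y = complex_of_real (1 / norm x) *\<^sub>C shift T \<mu> x"
        unfolding y_def by (rule bounded_clinear_scaleC[OF bounded_clinear_shift[OF T]])
      also have "norm \<dots> = norm (shift T \<mu> x) / norm x"
        by (simp add: norm_scaleC norm_divide)
      finally show ?thesis using False by (simp add: field_simps)
    qed simp
    then show False using contra that[of "1 / Suc n"] by auto
  qed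
  then obtain \<mu> x where mx: "\<And>n. \<mu> n \<in> K" "\<And>n. norm (x n) = 1"
      "\<And>n. norm (shift T (\<mu> n) (x n)) < 1 / Suc n"
    by metis
  obtain l r where lr: "l \<in> K" "strict_mono r" "(\<mu> \<circ> r) \<longlonglongrightarrow> l"
    using K(1) mx(1) unfolding compact_def by blast
  have "(\<lambda>n. norm (shift T (\<mu> n) (x n))) \<longlonglongrightarrow> 0"
  proof (rule Lim_null_comparison)
    show "\<forall>\<^sub>F n in sequentially. norm (norm (shift T (\<mu> n) (x n))) \<le> 1 / real (Suc n)"
      using mx(3) by (intro always_eventually allI) (simp add: less_imp_le)
    show "(\<lambda>n. 1 / real (Suc n)) \<longlonglongrightarrow> 0"
      using LIMSEQ_inverse_real_of_nat unfolding inverse_eq_divide .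
  qed
  from LIMSEQ_subseq_LIMSEQ[OF this lr(2)]
  have "(\<lambda>n. norm (shift T (\<mu> (r n)) (x (r n)))) \<longlonglongrightarrow> 0" unfolding o_def .
  then have lim1: "(\<lambda>n. shift T (\<mu> (r n)) (x (r n))) \<longlonglongrightarrow> 0"
    by (rule tendsto_norm_zero_cancel)
  have "(\<lambda>n. cmod ((\<mu> \<circ> r) n - l)) \<longlonglongrightarrow> 0" by (rule tendsto_norm_zero[OF LIM_zero[OF lr(3)]])
  then have "(\<lambda>n. norm ((\<mu> (r n) - l) *\<^sub>C x (r n))) \<longlonglongrightarrow> 0" by (simp add: norm_scaleC mx(2))
  then have lim2: "(\<lambda>n. (\<mu> (r n) - l) *\<^sub>C x (r n)) \<longlonglongrightarrow> 0" by (rule tendsto_norm_zero_cancel)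
  from tendsto_add[OF lim1 lim2]
  have "(\<lambda>n. shift T (\<mu> (r n)) (x (r n)) + (\<mu> (r n) - l) *\<^sub>C x (r n)) \<longlonglongrightarrow> 0" by simp
  then have "(\<lambda>n. shift T l (x (r n))) \<longlonglongrightarrow> 0"
    by (simp add: shift_def complex_vector.scale_left_diff_distrib)
  then have "l \<in> approx_point_spectrum T"
    unfolding approx_point_spectrum_def using mx(2) by (intro CollectI exI[of _ "\<lambda>n. x (r n)"]) auto
  then show False using lr(1) K(2) by blast
qed

lemma not_in_approx_point_spectrum_iff:
  assumes T: "bounded_clinear T"
  shows "\<mu> \<notin> approx_point_spectrum T \<longleftrightarrow> bounded_below (shift T \<mu>)"
proof
  assume "\<mu> \<notin> approx_point_spectrum T"
  then have disj: "{\<mu>} \<inter> approx_point_spectrum T = {}" by simp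
  obtain c where "c > 0" "\<And>\<nu> x. \<nu> \<in> {\<mu>} \<Longrightarrow> c * norm x \<le> norm (shift T \<nu> x)"
    using uniformly_bounded_below[OF T compact_sing disj] by blast
  then show "bounded_below (shift T \<mu>)" unfolding bounded_below_def by (intro exI[of _ c]) simp
next
  assume "bounded_below (shift T \<mu>)"
  then obtain c where c: "c > 0" "\<And>x. c * norm x \<le> norm (shift T \<mu> x)"
    unfolding bounded_below_def by blast
  show "\<mu> \<notin> approx_point_spectrum T"
  proof
    assume "\<mu> \<in> approx_point_spectrum T"
    then obtain x where x: "\<And>n. norm (x n) = 1" "(\<lambda>n. shift T \<mu> (x n)) \<longlonglongrightarrow> 0"
      unfolding approx_point_spectrum_def by blast
    have "(\<lambda>n. norm (shift T \<mu> (x n))) \<longlonglongrightarrow> 0" using x(2) by (rule tendsto_norm_zero)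
    moreover have "c \<le> norm (shift T \<mu> (x n))" for n using c(2)[of "x n"] x(1) by simp
    ultimately have "c \<le> 0" by (intro tendsto_lowerbound) auto
    then show False using c(1) by simp
  qed
qed

subsection \<open>The open mapping theorem for closed ranges\<close>

text \<open>Approximate solutions of \<open>U x = y\<close> with a norm bound can be corrected successively: the error
  is halved in each step, so that the corrections form a convergent geometric series.\<close>

lemma almost_open_imp_open:
  fixes U :: "'a::complex_banach \<Rightarrow> 'b::complex_normed_vector"
  assumes U: "bounded_clinear U" and Y: "csubspace Y" "range U \<subseteq> Y" and "C > 0"
    and approx: "\<And>y e. y \<in> Y \<Longrightarrow> e > 0 \<Longrightarrow> \<exists>x. norm x \<le> C * norm y \<and> norm (y - U x) \<le> e"
    and y: "y \<in> Y"
  shows "\<exists>x. U x = y \<and> norm x \<le> 2 * C * norm y"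
proof (cases "y = 0")
  case True
  then show ?thesis using bounded_clinear_0[OF U] by (intro exI[of _ 0]) auto
next
  case False
  have "\<exists>x. norm x \<le> C * norm z \<and> norm (z - U x) \<le> norm z / 2" if "z \<in> Y" for z
  proof (cases "z = 0")
    case True
    then show ?thesis using bounded_clinear_0[OF U] by (intro exI[of _ 0]) auto
  next
    case False
    then show ?thesis using approx[OF that, of "norm z / 2"] by auto
  qed
  then obtain g where g: "\<And>z. z \<in> Y \<Longrightarrow> norm (g z) \<le> C * norm z"
      "\<And>z. z \<in> Y \<Longrightarrow> norm (z - U (g z)) \<le> norm z / 2"
    by metis
  define z where "z n = ((\<lambda>z. z - U (g z)) ^^ n) y" for n
  have z_Suc: "z (Suc n) = z n - U (g (z n))" for n by (simp add: z_def)
  have zY: "z n \<in> Y" for n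
  proof (induction n)
    case (Suc n)
    then show ?case using Y z_Suc complex_vector.subspace_diff by (metis rangeI subsetD)
  qed (simp add: z_def y)
  have z_norm: "norm (z n) \<le> norm y * (1 / 2) ^ n" for n
  proof (induction n)
    case (Suc n)
    then show ?case using g(2)[OF zY[of n]] z_Suc[of n] by simp
  qed (simp add: z_def)
  have gz: "norm (g (z n)) \<le> C * norm y * (1 / 2) ^ n" for n
  proof -
    have "norm (g (z n)) \<le> C * norm (z n)" using g(1) zY by blast
    also have "\<dots> \<le> C * (norm y * (1 / 2) ^ n)" using z_norm \<open>C > 0\<close> by (intro mult_left_mono) auto
    finally show ?thesis by (simp add: mult.assoc)
  qed
  have sm: "summable (\<lambda>n. C * norm y * (1 / 2) ^ n)" by (intro summable_mult summable_geometric) auto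
  have sn: "summable (\<lambda>n. norm (g (z n)))"
    by (rule summable_comparison_test'[OF sm, of 0]) (use gz in auto)
  then have sg: "summable (\<lambda>n. g (z n))" by (rule summable_norm_cancel)
  define x where "x = (\<Sum>n. g (z n))"
  have "norm x \<le> (\<Sum>n. norm (g (z n)))" unfolding x_def by (rule summable_norm[OF sn])
  also have "\<dots> \<le> (\<Sum>n. C * norm y * (1 / 2) ^ n)" by (rule suminf_le[OF gz sn sm])
  also have "\<dots> = C * norm y * (\<Sum>n. (1 / 2) ^ n)" by (rule suminf_mult) (auto intro: summable_geometric)
  also have "\<dots> = 2 * C * norm y" by (simp add: suminf_geometric)
  finally have "norm x \<le> 2 * C * norm y" .
  moreover have "U x = y"
  proof (rule LIMSEQ_unique)
    have "(\<lambda>n. \<Sum>i<n. g (z i)) \<longlonglongrightarrow> x" unfolding x_def by (rule summable_LIMSEQ[OF sg])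
    from tendsto_bounded_clinear[OF U this]
    show "(\<lambda>n. U (\<Sum>i<n. g (z i))) \<longlonglongrightarrow> U x" .
    have eq: "U (\<Sum>i<n. g (z i)) = y - z n" for n
    proof (induction n)
      case 0
      then show ?case using bounded_clinear_0[OF U] by (simp add: z_def)
    next
      case (Suc n)
      then show ?case by (simp add: bounded_clinear_add[OF U] z_Suc)
    qed
    have "(\<lambda>n. norm y * (1 / 2) ^ n) \<longlonglongrightarrow> norm y * 0"
      by (intro tendsto_mult tendsto_const LIMSEQ_power_zero) auto
    then have "z \<longlonglongrightarrow> 0"
      using z_norm by (intro Lim_null_comparison[of z]) auto
    then have "(\<lambda>n. y - z n) \<longlonglongrightarrow> y - 0" by (intro tendsto_diff tendsto_const)
    then show "(\<lambda>n. U (\<Sum>i<n. g (z i))) \<longlonglongrightarrow> y" by (simp add: eq)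
  qed
  ultimately show ?thesis by blast
qed

text \<open>By Baire's theorem the closure of the image of some ball has interior points relative to the
  range. Differences of points near such a point fill a neighbourhood of \<open>0\<close>, and scaling gives approximate
  solutions for all right-hand sides.\<close>

lemma open_mapping_closed_range:
  fixes U :: "'a::complex_banach \<Rightarrow> 'b::complex_banach"
  assumes U: "bounded_clinear U" and cl: "closed (range U)"
  obtains C where "C > 0" "\<And>y. y \<in> range U \<Longrightarrow> \<exists>x. U x = y \<and> norm x \<le> C * norm y"
proof -
  define Y where "Y = range U"
  have Ysub: "csubspace Y" unfolding Y_def by (rule csubspace_range[OF U])
  define F where "F n = closure (U ` cball 0 (real n))" for n
  have FY: "F n \<subseteq> Y" for n
    unfolding F_def Y_def by (rule closure_minimal[OF _ cl]) auto
  have "\<exists>n. top_of_set Y interior_of F n \<noteq> {}"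
  proof (rule ccontr)
    assume "\<not> ?thesis"
    then have empty: "\<And>S. S \<in> range F \<Longrightarrow> closedin (top_of_set Y) S \<and> top_of_set Y interior_of S = {}"
      using FY by (auto simp: F_def intro!: closed_subset)
    have "completely_metrizable_space (top_of_set Y)"
      using completely_metrizable_space_closedin[of euclidean Y] completely_metrizable_space_euclidean cl
      by (simp add: Y_def)
    then have "top_of_set Y interior_of \<Union> (range F) = {}"
      by (intro Baire_category_alt) (use empty in auto)
    moreover have "\<Union> (range F) = Y"
    proof
      show "Y \<subseteq> \<Union> (range F)"
      proof
        fix y assume "y \<in> Y"
        then obtain x where x: "y = U x" by (auto simp: Y_def)
        have "x \<in> cball 0 (real (nat \<lceil>norm x\<rceil>))" by simp
        then have "y \<in> F (nat \<lceil>norm x\<rceil>)"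
          unfolding F_def x by (intro subsetD[OF closure_subset] imageI)
        then show "y \<in> \<Union> (range F)" by blast
      qed
    qed (use FY in blast)
    moreover have "top_of_set Y interior_of Y = Y" using interior_of_topspace[of "top_of_set Y"] by simp
    ultimately show False using complex_vector.subspace_0[OF Ysub] by auto
  qed
  then obtain n y0 where "y0 \<in> top_of_set Y interior_of F n" by blast
  then obtain W where W: "openin (top_of_set Y) W" "y0 \<in> W" "W \<subseteq> F n"
    unfolding interior_of_def by blast
  then obtain r where r: "r > 0" "ball y0 r \<inter> Y \<subseteq> F n" and y0: "y0 \<in> Y"
    unfolding openin_contains_ball by blast
  have approx: "\<exists>x. norm x \<le> 2 * real n \<and> norm (y - U x) \<le> e" if y: "y \<in> Y" "norm y < r" and "e > 0" for y e
  proof -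
    have "y0 + y \<in> ball y0 r \<inter> Y" "y0 \<in> ball y0 r \<inter> Y"
      using r(1) y y0 complex_vector.subspace_add[OF Ysub y0 y(1)] by (auto simp: dist_norm)
    then have "y0 + y \<in> F n" "y0 \<in> F n" using r(2) by blast+
    then obtain ya yb where yab: "ya \<in> U ` cball 0 (real n)" "dist ya (y0 + y) < e / 2"
        "yb \<in> U ` cball 0 (real n)" "dist yb y0 < e / 2"
      unfolding F_def closure_approachable using \<open>e > 0\<close> by (meson half_gt_zero)
    then obtain a b where ab: "norm a \<le> real n" "norm (U a - (y0 + y)) < e / 2"
        "norm b \<le> real n" "norm (U b - y0) < e / 2"
      by (auto simp: dist_norm)
    have "y - U (a - b) = (U b - y0) - (U a - (y0 + y))"
      by (simp add: bounded_clinear_diff[OF U])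
    then have "norm (y - U (a - b)) \<le> norm (U b - y0) + norm (U a - (y0 + y))"
      by (metis norm_triangle_ineq4)
    moreover have "norm (a - b) \<le> 2 * real n" using ab(1,3) norm_triangle_ineq4[of a b] by simp
    ultimately show ?thesis using ab(2,4) by (intro exI[of _ "a - b"]) auto
  qed
  define C where "C = (2 * real n + 1) * 2 / r"
  have "C > 0" using r(1) by (simp add: C_def add_nonneg_pos)
  have "\<exists>x. norm x \<le> C * norm y \<and> norm (y - U x) \<le> e" if y: "y \<in> Y" "e > 0" for y e
  proof (cases "y = 0")
    case True
    then show ?thesis using \<open>e > 0\<close> bounded_clinear_0[OF U] by (intro exI[of _ 0]) auto
  next
    case False
    define s where "s = r / (2 * norm y)"
    have s: "s > 0" using False r(1) by (simp add: s_def)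
    let ?c = "complex_of_real s"
    have "norm (?c *\<^sub>C y) = s * norm y" using s by (simp add: norm_scaleC)
    then have "norm (?c *\<^sub>C y) < r" using False r(1) by (simp add: s_def)
    then obtain x where x: "norm x \<le> 2 * real n" "norm (?c *\<^sub>C y - U x) \<le> s * e"
      using approx[of "?c *\<^sub>C y" "s * e"] complex_vector.subspace_scale[OF Ysub y(1)] s y(2) by auto
    let ?x = "inverse ?c *\<^sub>C x"
    have "y - U ?x = inverse ?c *\<^sub>C (?c *\<^sub>C y - U x)"
      using s by (simp only: bounded_clinear_scaleC[OF U] complex_vector.scale_right_diff_distrib scaleC_scaleC)
        (simp add: scaleC_one)
    then have "norm (y - U ?x) = inverse s * norm (?c *\<^sub>C y - U x)"
      using s by (simp add: norm_scaleC norm_inverse)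
    also have "\<dots> \<le> inverse s * (s * e)" using s by (intro mult_left_mono x(2)) auto
    also have "\<dots> = e" using s by (simp add: field_simps)
    finally have "norm (y - U ?x) \<le> e" .
    moreover have "norm ?x \<le> C * norm y"
    proof -
      have "norm ?x = inverse s * norm x" using s by (simp add: norm_scaleC norm_inverse)
      also have "\<dots> \<le> inverse s * (2 * real n + 1)" using s x(1) by (intro mult_left_mono) auto
      also have "\<dots> = C * norm y" by (simp add: s_def C_def)
      finally show ?thesis .
    qed
    ultimately show ?thesis by blast
  qed
  note approx' = this
  have "range U \<subseteq> Y" by (simp add: Y_def)
  then have "\<exists>x. U x = y \<and> norm x \<le> 2 * C * norm y" if "y \<in> Y" for y
    using that by (intro almost_open_imp_open[OF U Ysub _ \<open>C > 0\<close> approx'])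
  then show ?thesis using \<open>C > 0\<close> by (intro that[of "2 * C"]) (simp_all add: Y_def)
qed

lemma inj_closed_range_bounded_below:
  fixes U :: "'a::complex_banach \<Rightarrow> 'b::complex_banach"
  assumes U: "bounded_clinear U" and cl: "closed (range U)" and inj: "kernel U = {0}"
  shows "bounded_below U"
proof -
  obtain C where C: "C > 0" "\<And>y. y \<in> range U \<Longrightarrow> \<exists>x. U x = y \<and> norm x \<le> C * norm y"
    using open_mapping_closed_range[OF U cl] by blast
  have "1 / C * norm x \<le> norm (U x)" for x
  proof -
    obtain x' where x': "U x' = U x" "norm x' \<le> C * norm (U x)" using C(2) by blast
    then have "x' - x \<in> kernel U" by (simp add: bounded_clinear_diff[OF U])
    then have "x' = x" using inj by auto
    then show ?thesis using x'(2) C(1) by (simp add: field_simps)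
  qed
  then show ?thesis unfolding bounded_below_def using C(1) by (intro exI[of _ "1 / C"]) auto
qed

subsection \<open>Dimension and codimension\<close>

lemma edim_le_card:
  fixes S :: "'a::complex_normed_vector set"
  assumes S: "csubspace S" and F: "finite F" "S \<subseteq> cspan F"
  shows "edim S \<le> enat (card F)"
proof -
  obtain D where D: "D \<subseteq> S" "\<not> cdependent D" "S \<subseteq> cspan D" "card D = cdim S"
    by (rule complex_vector.basis_exists[of S])
  have "finite D \<and> card D \<le> card F"
    by (rule complex_vector.independent_span_bound[OF F(1) D(2)]) (use D(1) F(2) in blast)
  moreover have "cspan D = S"
    using D(1,3) S by (intro antisym complex_vector.span_minimal)
  ultimately show ?thesis unfolding edim_def using D(4) by auto
qed

lemma edim_finiteE:
  assumes "edim S < \<infinity>"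
  obtains B where "finite B" "cspan B = S"
  using assms unfolding edim_def by (auto split: if_splits)

lemma edim_eq_0_iff:
  assumes "csubspace S" shows "edim S = 0 \<longleftrightarrow> S = {0}"
proof
  assume zero: "edim S = 0"
  then obtain B where B: "finite B" "cspan B = S" by (metis edim_finiteE enat_ord_simps(4) infinity_ne_i0)
  obtain D where D: "D \<subseteq> S" "\<not> cdependent D" "S \<subseteq> cspan D" "card D = cdim S"
    by (rule complex_vector.basis_exists[of S])
  have "finite D" using complex_vector.independent_span_bound[OF B(1) D(2)] D(1) B(2) by blast
  moreover have "cdim S = 0" using zero B unfolding edim_def by (auto split: if_splits simp: zero_enat_def)
  ultimately have "D = {}" using D(4) by simp
  then show "S = {0}" using D(3) complex_vector.subspace_0[OF assms] by auto
next
  assume "S = {0}"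
  then show "edim S = 0" using edim_le_card[OF assms, of "{}"] by (simp flip: zero_enat_def)
qed

text \<open>A space that is separated from \<open>0\<close> by finitely many functionals is finite-dimensional: split off
  one dimension for each functional that does not vanish on the space.\<close>

lemma edim_finite_if_separated:
  fixes W :: "'a::complex_normed_vector set"
  assumes "finite I" "csubspace W" "\<And>f. f \<in> I \<Longrightarrow> bounded_clinear (f :: 'a \<Rightarrow> complex)"
    and "\<And>w. w \<in> W \<Longrightarrow> (\<And>f. f \<in> I \<Longrightarrow> f w = 0) \<Longrightarrow> w = 0"
  shows "\<exists>F. finite F \<and> W \<subseteq> cspan F"
  using assms
proof (induction I arbitrary: W rule: finite_induct)
  case empty
  then show ?case by (intro exI[of _ "{}"]) auto
next
  case (insert f I)
  have f: "bounded_clinear f" using insert.prems(2) by blast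
  let ?W = "W \<inter> kernel f"
  have "csubspace ?W" by (intro complex_vector.subspace_inter insert.prems(1) csubspace_kernel f)
  moreover have "w = 0" if "w \<in> ?W" "\<And>g. g \<in> I \<Longrightarrow> g w = 0" for w
    by (rule insert.prems(3)) (use that in auto)
  ultimately obtain F where F: "finite F" "?W \<subseteq> cspan F"
    using insert.IH[of ?W] insert.prems(2) by (meson insertI2)
  show ?case
  proof (cases "W \<subseteq> kernel f")
    case True
    then have "?W = W" by blast
    then show ?thesis using F by auto
  next
    case False
    then obtain w where w: "w \<in> W" "f w \<noteq> 0" by blast
    have "x \<in> cspan (insert w F)" if x: "x \<in> W" for x
    proof -
      define k where "k = f x / f w"
      have "x - k *\<^sub>C w \<in> W"
        by (intro complex_vector.subspace_diff complex_vector.subspace_scale insert.prems(1) x w)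
      moreover have "f (x - k *\<^sub>C w) = 0"
        using w(2) by (simp add: bounded_clinear_diff[OF f] bounded_clinear_scaleC[OF f] scaleC_complex_def k_def)
      ultimately have "x - k *\<^sub>C w \<in> cspan F" using F(2) by blast
      then show ?thesis
        unfolding complex_vector.span_insert by (intro CollectI exI[of _ k])
    qed
    then show ?thesis using F(1) by (intro exI[of _ "insert w F"]) auto
  qed
qed

lemma independent_Un_complementary:
  fixes A B :: "'a::complex_normed_vector set"
  assumes A: "\<not> cdependent A" "A \<subseteq> R" "csubspace R" and B: "\<not> cdependent B" "B \<subseteq> N" "csubspace N"
    and RN: "N \<inter> R = {0}"
  shows "\<not> cdependent (A \<union> B)"
proof -
  have zero: "u v = 0" if S: "finite S" "S \<subseteq> A \<union> B" "(\<Sum>v\<in>S. u v *\<^sub>C v) = 0" "v \<in> S" for S u v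
  proof -
    have AB: "A \<inter> B = {}"
    proof -
      have "0 \<notin> A" using A(1) complex_vector.dependent_zero by blast
      moreover have "x = 0" if "x \<in> A" "x \<in> B" for x
        using subsetD[OF A(2) that(1)] subsetD[OF B(2) that(2)] RN by (metis IntI singletonD)
      ultimately show ?thesis by (metis disjoint_iff)
    qed
    let ?r = "\<Sum>v\<in>S \<inter> A. u v *\<^sub>C v" and ?n = "\<Sum>v\<in>S \<inter> B. u v *\<^sub>C v"
    have "S = (S \<inter> A) \<union> (S \<inter> B)" using S(2) by blast
    then have "(\<Sum>v\<in>S. u v *\<^sub>C v) = (\<Sum>v\<in>(S \<inter> A) \<union> (S \<inter> B). u v *\<^sub>C v)" by simp
    also have "\<dots> = ?r + ?n" by (rule sum.union_disjoint) (use S(1) AB in auto)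
    finally have "(\<Sum>v\<in>S. u v *\<^sub>C v) = ?r + ?n" .
    then have sum0: "?r + ?n = 0" using S(3) by simp
    have "?r \<in> R" by (intro complex_vector.subspace_sum A(3) complex_vector.subspace_scale) (use A(2) in auto)
    moreover have "?n \<in> N" by (intro complex_vector.subspace_sum B(3) complex_vector.subspace_scale) (use B(2) in auto)
    moreover have "?n = - ?r" using sum0 by (simp add: add_eq_0_iff)
    ultimately have "?n \<in> N \<inter> R" using complex_vector.subspace_neg[OF A(3)] by auto
    then have n0: "?n = 0" using RN by blast
    then have r0: "?r = 0" using sum0 by simp
    show ?thesis
    proof (cases "v \<in> A")
      case True
      then show ?thesis
        using complex_vector.independentD[OF A(1), of "S \<inter> A" u v] S(1,4) r0 by auto
    next
      case False
      then show ?thesis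
        using complex_vector.independentD[OF B(1), of "S \<inter> B" u v] S n0 by auto
    qed
  qed
  show ?thesis
    unfolding complex_vector.independent_explicit_finite_subsets
    by (intro allI impI ballI zero)
qed

text \<open>A linear projection that kills \<open>R\<close> and fixes \<open>N\<close> maps every set spanning a complement of \<open>R\<close>
  to a set spanning \<open>N\<close>.\<close>

lemma edim_le_ecodim:
  fixes N R :: "'a::complex_normed_vector set"
  assumes N: "csubspace N" and R: "csubspace R" and NR: "N \<inter> R = {0}"
  shows "edim N \<le> ecodim R"
proof -
  interpret vector_space_pair "scaleC :: complex \<Rightarrow> 'a \<Rightarrow> 'a" "scaleC :: complex \<Rightarrow> 'a \<Rightarrow> 'a" ..
  obtain A where A: "A \<subseteq> R" "\<not> cdependent A" "R \<subseteq> cspan A" "card A = cdim R"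
    by (rule complex_vector.basis_exists[of R])
  obtain D where D: "D \<subseteq> N" "\<not> cdependent D" "N \<subseteq> cspan D" "card D = cdim N"
    by (rule complex_vector.basis_exists[of N])
  have "0 \<notin> A" using A(2) complex_vector.dependent_zero by blast
  moreover have "x = 0" if "x \<in> A" "x \<in> D" for x
    using subsetD[OF A(1) that(1)] subsetD[OF D(1) that(2)] NR by (metis IntI singletonD)
  ultimately have disj: "A \<inter> D = {}" by (metis disjoint_iff)
  have "\<not> cdependent (A \<union> D)"
    using A(2,1) R D(2,1) N NR by (rule independent_Un_complementary)
  then obtain p where p: "Vector_Spaces.linear scaleC scaleC p" "\<forall>x\<in>A \<union> D. p x = (if x \<in> D then x else 0)"
    using linear_independent_extend[of "A \<union> D" "\<lambda>x. if x \<in> D then x else 0"]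
    by (auto simp: cdependent_def)
  have pR: "p x = 0" if "x \<in> R" for x
  proof (rule linear_eq_on[OF p(1) linear_zero])
    show "x \<in> module.span scaleC A" using that A(3) unfolding cspan_def by (rule subsetD[rotated])
    show "p y = 0" if "y \<in> A" for y using that p(2) disj by (metis UnI1 disjoint_iff)
  qed
  have pN: "p x = x" if "x \<in> N" for x
  proof (rule linear_eq_on[OF p(1) complex_vector.linear_ident])
    show "x \<in> module.span scaleC D" using that D(3) unfolding cspan_def by (rule subsetD[rotated])
    show "p y = y" if "y \<in> D" for y using that p(2) by simp
  qed
  show ?thesis unfolding ecodim_def
  proof (rule Inf_greatest, clarify)
    fix B assume B: "finite B" "cspan (R \<union> B) = UNIV"
    have "N \<subseteq> cspan (p ` B)"
    proof
      fix x assume x: "x \<in> N"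
      have "p ` cspan (R \<union> B) = cspan (p ` (R \<union> B))"
        using linear_span_image[OF p(1), of "R \<union> B"] unfolding cspan_def by (rule sym)
      then have "x \<in> cspan (p ` (R \<union> B))" using B(2) pN[OF x] by (metis UNIV_I imageI)
      also have "\<dots> \<subseteq> cspan (insert 0 (p ` B))"
        by (intro complex_vector.span_mono) (use pR in auto)
      finally show "x \<in> cspan (p ` B)" by simp
    qed
    then have "edim N \<le> enat (card (p ` B))" using B(1) by (intro edim_le_card N) auto
    also have "\<dots> \<le> enat (card B)" using B(1) by (simp add: card_image_le)
    finally show "edim N \<le> enat (card B)" .
  qed
qed

lemma nullity_le_deficiency:
  assumes "bounded_clinear U" "kernel U \<inter> range U = {0}"
  shows "nullity U \<le> deficiency U"
  unfolding nullity_def deficiency_def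
  using assms by (intro edim_le_ecodim csubspace_kernel csubspace_range)

lemma nullity_eq_0_iff: "bounded_clinear U \<Longrightarrow> nullity U = 0 \<longleftrightarrow> kernel U = {0}"
  unfolding nullity_def by (intro edim_eq_0_iff csubspace_kernel)

section \<open>Group invertible operators\<close>

text \<open>\<open>U\<close> is group invertible if it is zero on one summand of a topological direct decomposition of
  the space and invertible on the other. With the projection \<open>P\<close> onto the first summand, invertibility
  on the second one means that \<open>U + P\<close> is invertible on the whole space.\<close>

definition group_invertible :: "('a::complex_normed_vector \<Rightarrow> 'a) \<Rightarrow> bool" where
  "group_invertible U \<longleftrightarrow> (\<exists>P. bounded_clinear P \<and> (\<forall>x. P (P x) = P x) \<and> (\<forall>x. U (P x) = 0) \<and>
    (\<forall>x. P (U x) = 0) \<and> invertible_operator (\<lambda>x. U x + P x))"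

lemma group_invertibleE:
  assumes "group_invertible U"
  obtains P V where "bounded_clinear P" "\<forall>x. P (P x) = P x" "\<forall>x. U (P x) = 0" "\<forall>x. P (U x) = 0"
    and "bounded_clinear V" "\<forall>x. V (U x + P x) = x" "\<forall>x. U (V x) + P (V x) = x"
proof -
  obtain P where P: "bounded_clinear P" "\<forall>x. P (P x) = P x" "\<forall>x. U (P x) = 0" "\<forall>x. P (U x) = 0"
      "invertible_operator (\<lambda>x. U x + P x)"
    using assms unfolding group_invertible_def by auto
  obtain V where "bounded_clinear V" "\<And>x. V (U x + P x) = x" "\<And>x. U (V x) + P (V x) = x"
    using invertible_operatorE[OF P(5)] by metis
  then show ?thesis using P(1-4) by (intro that[of P V]) simp_all
qed

lemma group_invertible_decomposition:
  assumes U: "bounded_clinear U" and P: "bounded_clinear P" "\<And>x. P (P x) = P x"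
    and UP: "\<And>x. U (P x) = 0" "\<And>x. P (U x) = 0"
    and V: "bounded_clinear V" "\<And>x. V (U x + P x) = x" "\<And>x. U (V x) + P (V x) = x"
  shows "kernel U = range P" "range U = kernel P"
proof -
  have "x = P x" if "U x = 0" for x
  proof -
    have "U x + P x = U (P x) + P (P x)" using that UP P by simp
    then show ?thesis by (metis V(2))
  qed
  then show "kernel U = range P" using UP by (auto intro: range_eqI)
  have "x = U (V x)" if "P x = 0" for x
  proof -
    have "P (V x) = P (U (V x) + P (V x))" by (simp only: bounded_clinear_add[OF P(1)] UP P(2)) simp
    then have "P (V x) = 0" using that V(3)[of x] by simp
    then show ?thesis using V(3)[of x] by simp
  qed
  then show "range U = kernel P" using UP by (auto intro: range_eqI)
qed

text \<open>The kernel is the range of \<open>P\<close> and the range is the kernel of \<open>P\<close>. In particular \<open>U\<close> and \<open>U\<^sup>2\<close> have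
  the same range, as \<open>U x = U (x - P x)\<close> and \<open>x - P x\<close> is in the range of \<open>U\<close>.\<close>

lemma group_invertible_properties:
  fixes U :: "'a::complex_normed_vector \<Rightarrow> 'a"
  assumes U: "bounded_clinear U" and g: "group_invertible U"
  shows "closed (range U)" "closed (range (U \<circ> U))" "kernel U \<inter> range U = {0}"
    and "kernel U = {0} \<Longrightarrow> invertible_operator U"
proof -
  obtain P V where ex: "bounded_clinear P" "\<forall>x. P (P x) = P x" "\<forall>x. U (P x) = 0" "\<forall>x. P (U x) = 0"
      "bounded_clinear V" "\<forall>x. V (U x + P x) = x" "\<forall>x. U (V x) + P (V x) = x"
    by (rule group_invertibleE[OF g])
  note P = ex(1) ex(2)[rule_format] and UP = ex(3)[rule_format] ex(4)[rule_format]
    and V = ex(5) ex(6)[rule_format] ex(7)[rule_format]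
  note dec = group_invertible_decomposition[OF U P UP V]
  show cl: "closed (range U)" unfolding dec(2) by (rule closed_kernel[OF P(1)])
  have "U x \<in> range (U \<circ> U)" for x
  proof -
    have "P (x - P x) = 0" by (simp add: bounded_clinear_diff[OF P(1)] P(2))
    then have "x - P x \<in> range U" unfolding dec(2) by simp
    then obtain y where "x - P x = U y" by auto
    then have "U x = (U \<circ> U) y" using UP(1)[of x] bounded_clinear_diff[OF U, of x "P x"] by simp
    then show ?thesis by (rule range_eqI)
  qed
  then have "range (U \<circ> U) = range U" by auto
  then show "closed (range (U \<circ> U))" using cl by simp
  have "x = 0" if "U x = 0" "x \<in> range U" for x
  proof -
    have "x \<in> range P" using that(1) unfolding dec(1)[symmetric] by simp
    then obtain y where "x = P y" by (rule rangeE)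
    moreover have "P x = 0" using that(2) unfolding dec(2) by simp
    ultimately show ?thesis using P(2) by simp
  qed
  moreover have "0 \<in> range U" using complex_vector.subspace_0[OF csubspace_range[OF U]] .
  ultimately show "kernel U \<inter> range U = {0}" using bounded_clinear_0[OF U] by auto
  show "invertible_operator U" if "kernel U = {0}"
  proof -
    have "P x \<in> kernel U" for x unfolding dec(1) by simp
    then have "P x = 0" for x unfolding that by simp
    then show ?thesis using V by (intro invertible_operatorI[OF V(1)]) auto
  qed
qed

text \<open>On the first summand \<open>U - \<mu>\<close> is the scalar \<open>-\<mu>\<close>, on the second one it is a small perturbation
  of an invertible operator.\<close>

lemma group_invertible_punctured_neighbourhood:
  fixes T :: "'a::complex_normed_vector \<Rightarrow> 'a"
  assumes T: "bounded_clinear T" and g: "group_invertible (shift T \<mu>)"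
  obtains d where "d > 0" "\<And>\<nu>. \<nu> \<noteq> \<mu> \<Longrightarrow> dist \<nu> \<mu> < d \<Longrightarrow> bounded_below (shift T \<nu>)"
proof -
  define U where "U = shift T \<mu>"
  have U: "bounded_clinear U" unfolding U_def by (rule bounded_clinear_shift[OF T])
  obtain P V where ex: "bounded_clinear P" "\<forall>x. P (P x) = P x" "\<forall>x. U (P x) = 0" "\<forall>x. P (U x) = 0"
      "bounded_clinear V" "\<forall>x. V (U x + P x) = x" "\<forall>x. U (V x) + P (V x) = x"
    by (rule group_invertibleE[OF g[folded U_def]])
  note P = ex(1) ex(2)[rule_format] and UP = ex(3)[rule_format] ex(4)[rule_format]
    and V = ex(5) ex(6)[rule_format] ex(7)[rule_format]
  obtain K where K: "K > 0" "\<And>x. norm (V x) \<le> K * norm x" using bounded_clinear_bound[OF V(1)] by metis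
  obtain L where L: "L > 0" "\<And>x. norm (P x) \<le> L * norm x" using bounded_clinear_bound[OF P(1)] by metis
  have bb: "bounded_below (shift T \<nu>)" if nu: "\<nu> \<noteq> \<mu>" "dist \<nu> \<mu> < 1 / (2 * K)" for \<nu>
  proof -
    define z where "z = \<nu> - \<mu>"
    have z: "cmod z > 0" "cmod z * K \<le> 1 / 2"
      using nu K(1) by (auto simp: z_def dist_norm field_simps)
    define M where "M = L / cmod z + 2 * K * (1 + L)"
    have "M > 0" using z(1) K(1) L(1) by (simp add: M_def add_pos_pos)
    have "norm x \<le> M * norm (shift T \<nu> x)" for x
    proof -
      define y where "y = shift T \<nu> x"
      have y: "y = U x - z *\<^sub>C x"
        unfolding y_def U_def shift_def z_def by (simp add: complex_vector.scale_left_diff_distrib)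
      have "P y = - (z *\<^sub>C P x)"
        by (simp add: y bounded_clinear_diff[OF P(1)] bounded_clinear_scaleC[OF P(1)] UP)
      then have "cmod z * norm (P x) \<le> L * norm y" using L(2)[of y] by (simp add: norm_scaleC)
      then have Px: "norm (P x) \<le> L / cmod z * norm y" using z(1) by (simp add: field_simps)
      define w where "w = x - P x"
      have Pw: "P w = 0" by (simp add: w_def bounded_clinear_diff[OF P(1)] P(2))
      have "y - P y = U w - z *\<^sub>C w"
        unfolding \<open>P y = - (z *\<^sub>C P x)\<close>
        by (simp add: y w_def bounded_clinear_diff[OF U] UP complex_vector.scale_right_diff_distrib)
      then have "U w + P w = (y - P y) + z *\<^sub>C w" using Pw by simp
      then have "w = V ((y - P y) + z *\<^sub>C w)" using V(2)[of w] by simp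
      then have "norm w \<le> K * norm ((y - P y) + z *\<^sub>C w)" using K(2) by metis
      also have "\<dots> \<le> K * (norm y + L * norm y + cmod z * norm w)"
      proof (rule mult_left_mono)
        have "norm ((y - P y) + z *\<^sub>C w) \<le> norm (y - P y) + norm (z *\<^sub>C w)" by (rule norm_triangle_ineq)
        also have "norm (y - P y) \<le> norm y + norm (P y)" by (rule norm_triangle_ineq4)
        finally show "norm ((y - P y) + z *\<^sub>C w) \<le> norm y + L * norm y + cmod z * norm w"
          using L(2)[of y] by (simp add: norm_scaleC)
      qed (use K(1) in simp)
      also have "\<dots> = K * (1 + L) * norm y + (cmod z * K) * norm w" by (simp add: algebra_simps)
      also have "\<dots> \<le> K * (1 + L) * norm y + 1 / 2 * norm w"
        using z(2) by (intro add_left_mono mult_right_mono) auto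
      finally have "norm w \<le> 2 * K * (1 + L) * norm y" by simp
      moreover have "norm x \<le> norm (P x) + norm w"
        using norm_triangle_ineq[of "P x" w] by (simp add: w_def)
      ultimately show ?thesis using Px unfolding y_def[symmetric] M_def by (simp add: distrib_right)
    qed
    then have "1 / M * norm x \<le> norm (shift T \<nu> x)" for x using \<open>M > 0\<close> by (simp add: field_simps)
    then show ?thesis unfolding bounded_below_def using \<open>M > 0\<close> by (intro exI[of _ "1 / M"]) simp
  qed
  show ?thesis by (rule that[of "1 / (2 * K)"]) (use K(1) bb in auto)
qed

lemma ascent_le_1:
  assumes "\<And>x. U (U x) = 0 \<Longrightarrow> U x = 0" "bounded_clinear U"
  shows "ascent U \<le> 1"
proof -
  have "kernel (U ^^ 1) = kernel (U ^^ (1 + 1))"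
    using assms(1) bounded_clinear_0[OF assms(2)] by auto
  then have "enat 1 \<in> {enat n | n. kernel (U ^^ n) = kernel (U ^^ (n + 1))}" by blast
  then show ?thesis unfolding ascent_def one_enat_def by (rule Inf_lower)
qed

text \<open>If the kernel is trivial, then \<open>T - \<mu>\<close> is invertible and none of the conditions holds. Otherwise
  \<open>\<mu>\<close> is an eigenvalue; the range is closed and meets the kernel trivially, which yields the Weyl
  condition, and \<open>\<mu>\<close> is isolated in the approximate point spectrum and a left pole of order \<open>1\<close>.\<close>

lemma group_invertible_spectral_characterization:
  fixes T :: "'a::complex_normed_vector \<Rightarrow> 'a"
  assumes T: "bounded_clinear T" and g: "group_invertible (shift T \<mu>)" and fin: "nullity (shift T \<mu>) < \<infinity>"
  shows "\<mu> \<in> spectrum T - upper_semi_Weyl_spectrum T \<longleftrightarrow> kernel (shift T \<mu>) \<noteq> {0}"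
    and "\<mu> \<in> isolated_points (approx_point_spectrum T) \<inter> finite_mult_eigenvalues T \<longleftrightarrow> kernel (shift T \<mu>) \<noteq> {0}"
    and "\<mu> \<in> finite_rank_left_poles T \<longleftrightarrow> kernel (shift T \<mu>) \<noteq> {0}"
proof -
  let ?U = "shift T \<mu>"
  have U: "bounded_clinear ?U" by (rule bounded_clinear_shift[OF T])
  note gp = group_invertible_properties[OF U g]
  have weyl: "upper_semi_Weyl ?U"
  proof -
    have "nullity ?U \<le> deficiency ?U" by (rule nullity_le_deficiency[OF U gp(3)])
    then have "fredholm_index ?U \<le> 0"
      using fin unfolding fredholm_index_def by (cases "nullity ?U"; cases "deficiency ?U") auto
    then show ?thesis unfolding upper_semi_Weyl_def upper_semi_Fredholm_def using gp(1) fin by simp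
  qed
  have inv: "invertible_operator ?U \<longleftrightarrow> kernel ?U = {0}"
  proof
    assume "invertible_operator ?U"
    then obtain V where "\<And>x. V (?U x) = x" using invertible_operatorE by metis
    then show "kernel ?U = {0}" using bounded_clinear_0[OF U] by (auto, metis)
  qed (rule gp(4))
  show "\<mu> \<in> spectrum T - upper_semi_Weyl_spectrum T \<longleftrightarrow> kernel ?U \<noteq> {0}"
    using weyl inv not_in_spectrum_iff[of \<mu> T] by (auto simp: upper_semi_Weyl_spectrum_def)
  have bb: "bounded_below ?U \<longleftrightarrow> kernel ?U = {0}"
  proof
    assume "bounded_below ?U"
    then obtain c where c: "c > 0" "\<And>x. c * norm x \<le> norm (?U x)" unfolding bounded_below_def by auto
    have "x = 0" if "?U x = 0" for x
      using c(2)[of x] c(1) that by (simp add: mult_le_0_iff)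
    then show "kernel ?U = {0}" using bounded_clinear_0[OF U] by auto
  qed (use inv invertible_operator_bounded_below in simp)
  have aps: "\<mu> \<in> approx_point_spectrum T \<longleftrightarrow> kernel ?U \<noteq> {0}"
    using not_in_approx_point_spectrum_iff[OF T, of \<mu>] bb by blast
  obtain d where d: "d > 0" "\<And>\<nu>. \<nu> \<noteq> \<mu> \<Longrightarrow> dist \<nu> \<mu> < d \<Longrightarrow> bounded_below (shift T \<nu>)"
    using group_invertible_punctured_neighbourhood[OF T g] by metis
  have iso: "\<mu> isolated_in approx_point_spectrum T" if "\<mu> \<in> approx_point_spectrum T"
    unfolding isolated_in_dist_Ex_iff
  proof (intro conjI that exI[of _ d] d(1) ballI impI)
    fix \<nu> assume "\<nu> \<in> approx_point_spectrum T" "dist \<mu> \<nu> < d"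
    then show "\<nu> = \<mu>" using d(2)[of \<nu>] not_in_approx_point_spectrum_iff[OF T, of \<nu>] by (auto simp: dist_commute)
  qed
  have pos: "0 < nullity ?U \<longleftrightarrow> kernel ?U \<noteq> {0}"
    using nullity_eq_0_iff[OF U] by (metis i0_less)
  show "\<mu> \<in> isolated_points (approx_point_spectrum T) \<inter> finite_mult_eigenvalues T \<longleftrightarrow> kernel ?U \<noteq> {0}"
    using aps iso pos fin by (auto simp: isolated_points_def finite_mult_eigenvalues_def)
  have UU: "?U x = 0" if "?U (?U x) = 0" for x
  proof -
    have "?U x \<in> kernel ?U \<inter> range ?U" using that by simp
    then show ?thesis unfolding gp(3) by simp
  qed
  have "ascent ?U \<le> 1" by (rule ascent_le_1[OF UU U])
  then obtain p where p: "ascent ?U = enat p" "p \<le> 1" by (cases "ascent ?U") (auto simp: one_enat_def)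
  have "closed (range (?U ^^ (p + 1)))"
  proof (cases p)
    case 0
    then show ?thesis using gp(1) by simp
  next
    case (Suc q)
    then have "?U ^^ (p + 1) = ?U \<circ> ?U" using p(2) by (simp add: o_assoc)
    then show ?thesis using gp(2) by simp
  qed
  then show "\<mu> \<in> finite_rank_left_poles T \<longleftrightarrow> kernel ?U \<noteq> {0}"
    using aps p(1) fin unfolding finite_rank_left_poles_def left_poles_def by blast
qed

text \<open>Both properties state that two sets of scalars are equal. By the previous lemma the sets agree on the
  scalars where \<open>T - \<mu>\<close> is group invertible with finite nullity, and by assumption none of them has other
  elements. The case \<open>n = 0\<close> of the last assumption covers the upper semi-Weyl operators.\<close>

lemma property_z_and_az_if_group_invertible:
  fixes T :: "'a::complex_normed_vector \<Rightarrow> 'a"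
  assumes T: "bounded_clinear T"
    and iso: "\<And>\<mu>. \<mu> isolated_in approx_point_spectrum T \<Longrightarrow> 0 < nullity (shift T \<mu>) \<Longrightarrow>
      nullity (shift T \<mu>) < \<infinity> \<Longrightarrow> group_invertible (shift T \<mu>)"
    and pole: "\<And>\<mu> n. closed (range (shift T \<mu> ^^ Suc n)) \<Longrightarrow> nullity (shift T \<mu>) < \<infinity> \<Longrightarrow>
      group_invertible (shift T \<mu>)"
  shows "property_z T \<and> property_az T"
proof -
  note char = group_invertible_spectral_characterization[OF T]
  let ?A = "spectrum T - upper_semi_Weyl_spectrum T"
  let ?B = "isolated_points (approx_point_spectrum T) \<inter> finite_mult_eigenvalues T"
  let ?C = "finite_rank_left_poles T"
  let ?G = "{\<mu>. group_invertible (shift T \<mu>) \<and> nullity (shift T \<mu>) < \<infinity>}"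
  have A: "?A \<subseteq> ?G"
    using pole[where n = 0]
    by (auto simp: upper_semi_Weyl_spectrum_def upper_semi_Weyl_def upper_semi_Fredholm_def)
  have B: "?B \<subseteq> ?G"
    using iso by (auto simp: isolated_points_def finite_mult_eigenvalues_def)
  have C: "?C \<subseteq> ?G"
    using pole by (auto simp: finite_rank_left_poles_def left_poles_def)
  have eq: "(\<mu> \<in> ?A \<longleftrightarrow> \<mu> \<in> ?B) \<and> (\<mu> \<in> ?A \<longleftrightarrow> \<mu> \<in> ?C)" for \<mu>
  proof (cases "\<mu> \<in> ?G")
    case True
    then have "group_invertible (shift T \<mu>)" "nullity (shift T \<mu>) < \<infinity>" by auto
    then show ?thesis using char[of \<mu>] by (simp only: simp_thms)
  next
    case False
    show ?thesis
      using contra_subsetD[OF A False] contra_subsetD[OF B False] contra_subsetD[OF C False]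
      by (simp only: simp_thms)
  qed
  have "?A = ?B" "?A = ?C" using eq by (intro set_eqI; metis)+
  then show ?thesis unfolding property_z_def property_az_def by (rule conjI)
qed

section \<open>Powers and resolvents in seminormed algebras\<close>

lemma sum_roots_of_unity_power:
  assumes "j < n"
  shows "(\<Sum>k<n. (exp (2 * of_real pi * \<i> * of_nat k / of_nat n) :: complex) ^ j)
    = (if j = 0 then of_nat n else 0)"
proof (cases "j = 0")
  case False
  define w :: complex where "w = exp (2 * of_real pi * \<i> * of_nat j / of_nat n)"
  have n: "n \<noteq> 0" "1 \<le> n" using assms by auto
  have "(exp (2 * of_real pi * \<i> * of_nat k / of_nat n) :: complex) ^ j = w ^ k" for k
    unfolding w_def exp_of_nat_mult[symmetric] by (simp add: field_simps)
  moreover have "w \<noteq> 1"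
    using complex_root_unity_eq_1[OF n(2), of j] False assms unfolding w_def by (auto dest: dvd_imp_le)
  moreover have "w ^ n = 1"
    unfolding w_def exp_of_nat_mult[symmetric] using n exp_two_pi_i
    by (simp add: exp_eq_1 mult.commute) (metis of_int_of_nat_eq)
  ultimately show ?thesis using False by (simp add: sum_gp_strict)
qed simp

lemma root_of_unity_power:
  assumes "n > 0"
  shows "(exp (2 * of_real pi * \<i> * of_nat k / of_nat n) :: complex) ^ n = 1"
  unfolding exp_of_nat_mult[symmetric] using assms
  by (simp add: exp_eq_1 mult.commute) (metis of_int_of_nat_eq)

lemma norm_root_of_unity:
  "cmod (exp (2 * of_real pi * \<i> * of_nat k / of_nat n)) = 1"
  by (simp add: norm_exp_eq_Re)

text \<open>The null space of \<open>q\<close> is an ideal, and \<open>q\<close> is the norm of the quotient algebra. Arguments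
  formulated with \<open>q\<close> apply modulo any ideal, with congruences expressed by \<open>q (x - y) = 0\<close>.\<close>

locale seminormed_algebra =
  fixes q :: "'r::ring_1 \<Rightarrow> real" and emb :: "complex \<Rightarrow> 'r"
  assumes q_nonneg: "0 \<le> q x"
    and q_add: "q (x + y) \<le> q x + q y"
    and q_mult: "q (x * y) \<le> q x * q y"
    and q_emb: "q (emb c * x) = cmod c * q x"
    and q_1: "q 1 \<le> 1"
    and emb_add: "emb (c + d) = emb c + emb d"
    and emb_mult: "emb (c * d) = emb c * emb d"
    and emb_1: "emb 1 = 1"
    and emb_commute: "emb c * x = x * emb c"
begin

lemma emb_0: "emb 0 = 0"
  using emb_add[of 0 0] by simp

lemma emb_diff: "emb (c - d) = emb c - emb d"
  using emb_add[of "c - d" d] by simp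

lemma emb_sum: "emb (sum f A) = (\<Sum>i\<in>A. emb (f i))"
  by (induction A rule: infinite_finite_induct) (simp_all add: emb_0 emb_add)

lemma emb_of_nat: "emb (of_nat n) = of_nat n"
  by (induction n) (simp_all add: emb_0 emb_1 emb_add)

lemma q_minus: "q (- x) = q x"
proof -
  have "emb (- 1) = - 1" using emb_diff[of 0 1] by (simp add: emb_0 emb_1)
  then show ?thesis using q_emb[of "- 1" x] by simp
qed

lemma q_0: "q 0 = 0"
  using q_emb[of 0 0] by simp

lemma q_diff: "q (x - y) \<le> q x + q y"
  using q_add[of x "- y"] by (simp add: q_minus)

lemma q_sum: "q (sum f A) \<le> (\<Sum>i\<in>A. q (f i))"
proof (induction A rule: infinite_finite_induct)
  case (insert x F)
  then show ?case using q_add[of "f x" "sum f F"] by simp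
qed (simp_all add: q_0)

lemma q_add_null: "q d = 0 \<Longrightarrow> q (x + d) \<le> q x"
  using q_add[of x d] by simp

lemma q_null_mult_left: "q d = 0 \<Longrightarrow> q (x * d) = 0"
  using q_mult[of x d] q_nonneg[of "x * d"] by simp

lemma q_null_mult_right: "q d = 0 \<Longrightarrow> q (d * x) = 0"
  using q_mult[of d x] q_nonneg[of "d * x"] by simp

lemma q_null_diff: "q d = 0 \<Longrightarrow> q e = 0 \<Longrightarrow> q (d - e) = 0"
  using q_diff[of d e] q_nonneg[of "d - e"] by simp

lemma q_null_sum: "(\<And>i. i \<in> A \<Longrightarrow> q (f i) = 0) \<Longrightarrow> q (sum f A) = 0"
  using q_sum[of f A] q_nonneg[of "sum f A"] by simp

lemma power_emb_mult: "(emb c * y) ^ n = emb (c ^ n) * y ^ n"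
proof (induction n)
  case (Suc n)
  have "(emb c * y) ^ Suc n = emb c * (y * emb (c ^ n)) * y ^ n"
    by (simp add: Suc mult.assoc)
  also have "y * emb (c ^ n) = emb (c ^ n) * y" by (rule emb_commute[symmetric])
  finally show ?case by (simp add: emb_mult mult.assoc)
qed (simp add: emb_1)

lemma geometric_sum_mult: "(\<Sum>i<n. x ^ i) * (1 - x) = 1 - x ^ n" for x :: 'r
proof (induction n)
  case (Suc n)
  then show ?case
    unfolding sum.lessThan_Suc distrib_right by (simp add: right_diff_distrib power_commutes)
qed simp

end

locale seminormed_resolvent = seminormed_algebra q emb
  for q :: "'r::ring_1 \<Rightarrow> real" and emb :: "complex \<Rightarrow> 'r" +
  fixes y :: 'r and \<rho> :: real and F :: "complex \<Rightarrow> 'r"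
  assumes rho: "\<rho> > 0"
    and inverse_right: "cmod z \<le> \<rho> \<Longrightarrow> q ((1 - emb z * y) * F z - 1) = 0"
    and inverse_left: "cmod z \<le> \<rho> \<Longrightarrow> q (F z * (1 - emb z * y) - 1) = 0"
begin

lemma resolvent_difference:
  assumes z: "cmod z \<le> \<rho>" and w: "cmod w \<le> \<rho>"
  shows "q (F z - F w) \<le> cmod (z - w) * (q (F z) * q y * q (F w))"
proof -
  define a b where "a = 1 - emb z * y" and "b = 1 - emb w * y"
  have ba: "b - a = emb (z - w) * y" by (simp add: a_def b_def emb_diff algebra_simps)
  have "F z - F w = F z * (b - a) * F w + ((F z * a - 1) * F w - F z * (b * F w - 1))"
    by (simp add: algebra_simps)
  also have "q \<dots> \<le> q (F z * (b - a) * F w)"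
    unfolding a_def b_def
    by (intro q_add_null q_null_diff q_null_mult_left q_null_mult_right inverse_left inverse_right z w)
  also have "F z * (b - a) * F w = emb (z - w) * (F z * y * F w)"
    unfolding ba by (metis emb_commute mult.assoc)
  also have "q \<dots> = cmod (z - w) * q (F z * y * F w)" by (rule q_emb)
  also have "\<dots> \<le> cmod (z - w) * (q (F z) * q y * q (F w))"
  proof (intro mult_left_mono)
    have "q (F z * y * F w) \<le> q (F z * y) * q (F w)" by (rule q_mult)
    also have "\<dots> \<le> (q (F z) * q y) * q (F w)" by (intro mult_right_mono q_mult q_nonneg)
    finally show "q (F z * y * F w) \<le> q (F z) * q y * q (F w)" .
  qed simp
  finally show ?thesis .
qed

text \<open>The resolvent equation bounds \<open>F\<close> near each point of the disc, and the disc is compact.\<close>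

lemma resolvent_bounded:
  obtains C where "C \<ge> 1" "\<forall>z. cmod z \<le> \<rho> \<longrightarrow> q (F z) \<le> C"
proof (rule ccontr)
  assume contra: "\<not> thesis"
  have "\<exists>z. cmod z \<le> \<rho> \<and> real n + 1 < q (F z)" for n :: nat
  proof (rule ccontr)
    assume "\<not> ?thesis"
    then have "\<forall>z. cmod z \<le> \<rho> \<longrightarrow> q (F z) \<le> real n + 1" by (auto simp: not_less)
    then show False using contra that[of "real n + 1"] by simp
  qed
  then obtain z where z: "\<And>n. cmod (z n) \<le> \<rho>" "\<And>n :: nat. real n + 1 < q (F (z n))" by metis
  have "compact (cball (0::complex) \<rho>)" by (rule compact_cball)
  moreover have "\<forall>n. z n \<in> cball 0 \<rho>" using z(1) by simp
  ultimately obtain l r where lr: "l \<in> cball 0 \<rho>" "strict_mono r" "(z \<circ> r) \<longlonglongrightarrow> l"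
    unfolding compact_def by blast
  have l: "cmod l \<le> \<rho>" using lr(1) by simp
  \<comment> \<open>Within distance \<open>e\<close> of \<open>l\<close> the resolvent equation yields \<open>q (F w) \<le> q (F l) + q (F w) / 2\<close>.\<close>
  define k where "k = q (F l) * q y + 1"
  define e where "e = 1 / (2 * k)"
  have pos: "k > 0" using q_nonneg[of "F l"] q_nonneg[of y] by (simp add: k_def add_nonneg_pos)
  then have "e > 0" by (simp add: e_def)
  then obtain N where N: "\<And>n. n \<ge> N \<Longrightarrow> dist ((z \<circ> r) n) l < e"
    using lr(3) unfolding lim_sequentially by blast
  define n where "n = max N (nat \<lceil>2 * q (F l)\<rceil>)"
  define w where "w = z (r n)"
  have w: "cmod w \<le> \<rho>" using z(1) by (simp add: w_def)
  have dw: "cmod (l - w) \<le> e" using N[of n] by (simp add: n_def w_def dist_norm norm_minus_commute)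
  have "q (F w) \<le> q (F l) + q (F l - F w)"
    using q_diff[of "F l" "F l - F w"] by simp
  also have "q (F l - F w) \<le> cmod (l - w) * (q (F l) * q y * q (F w))" by (rule resolvent_difference[OF l w])
  also have "\<dots> \<le> e * (q (F l) * q y * q (F w))"
    by (intro mult_right_mono dw mult_nonneg_nonneg q_nonneg)
  also have "\<dots> \<le> e * (k * q (F w))"
    using \<open>e > 0\<close> unfolding k_def by (intro mult_left_mono mult_right_mono q_nonneg) auto
  also have "\<dots> = q (F w) / 2" using pos by (simp add: e_def)
  finally have "q (F w) \<le> 2 * q (F l)" by simp
  also have "\<dots> \<le> real n" unfolding n_def by linarith
  also have "\<dots> \<le> real (r n)" using seq_suble[OF lr(2), of n] by simp
  also have "\<dots> < q (F w)" using z(2)[of "r n"] by (simp add: w_def)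
  finally show False by simp
qed

text \<open>The mean of the resolvent over \<open>n\<close> equidistributed points of a circle: modulo the null
  space of \<open>q\<close> it is the inverse of \<open>1 - (z * y)^n\<close>, so that a bound on the resolvent controls all
  powers of \<open>y\<close> at once.\<close>

definition mean_resolvent :: "nat \<Rightarrow> complex \<Rightarrow> 'r" where
  "mean_resolvent n z = emb (1 / of_nat n) *
    (\<Sum>k<n. F (z * exp (2 * of_real pi * \<i> * of_nat k / of_nat n)))"

lemma mean_resolvent_inverse:
  assumes n: "n > 0" and z: "cmod z \<le> \<rho>"
  shows "q ((1 - emb (z ^ n) * y ^ n) * mean_resolvent n z - 1) = 0"
proof -
  define w where "w k = exp (2 * of_real pi * \<i> * of_nat k / of_nat n)" for k
  define X where "X = 1 - emb (z ^ n) * y ^ n"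
  define S where "S k = (\<Sum>j<n. (emb (z * w k) * y) ^ j)" for k
  have zw: "cmod (z * w k) \<le> \<rho>" for k using z by (simp add: w_def norm_mult norm_root_of_unity)
  have XS: "X = S k * (1 - emb (z * w k) * y)" for k
    using root_of_unity_power[OF n, of k]
    unfolding S_def geometric_sum_mult X_def power_emb_mult w_def by (simp add: power_mult_distrib)
  have null: "q (X * F (z * w k) - S k) = 0" for k
  proof -
    have "X * F (z * w k) - S k = S k * ((1 - emb (z * w k) * y) * F (z * w k) - 1)"
      by (subst XS[of k]) (simp add: algebra_simps)
    then show ?thesis using q_null_mult_left[OF inverse_right[OF zw]] by simp
  qed
  have "(\<Sum>k<n. S k) = (\<Sum>j<n. \<Sum>k<n. emb ((z * w k) ^ j) * y ^ j)"
    unfolding S_def power_emb_mult by (rule sum.swap)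
  also have "\<dots> = (\<Sum>j<n. emb (\<Sum>k<n. (z * w k) ^ j) * y ^ j)"
    by (simp add: emb_sum sum_distrib_right)
  also have "\<dots> = (\<Sum>j<n. if j = 0 then of_nat n else 0)"
  proof (rule sum.cong[OF refl])
    fix j assume "j \<in> {..<n}"
    then have "(\<Sum>k<n. (z * w k) ^ j) = z ^ j * (if j = 0 then of_nat n else 0)"
      unfolding power_mult_distrib sum_distrib_left[symmetric] w_def
      by (subst sum_roots_of_unity_power) auto
    then show "emb (\<Sum>k<n. (z * w k) ^ j) * y ^ j = (if j = 0 then of_nat n else 0)"
      by (simp add: emb_0 emb_of_nat)
  qed
  also have "\<dots> = of_nat n" using n by simp
  finally have sumS: "(\<Sum>k<n. S k) = of_nat n" .
  define c where "c = emb (1 / of_nat n)"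
  have c1: "c * of_nat n = 1"
    using n emb_mult[of "1 / of_nat n" "of_nat n"] by (simp add: c_def emb_of_nat emb_1)
  have "X * mean_resolvent n z - 1 = c * (\<Sum>k<n. X * F (z * w k)) - c * of_nat n"
    unfolding mean_resolvent_def c1 w_def[symmetric] c_def[symmetric]
    by (simp add: sum_distrib_left[symmetric] c_def flip: mult.assoc emb_commute)
  also have "\<dots> = c * (\<Sum>k<n. X * F (z * w k) - S k)"
    by (simp add: sum_subtractf sumS right_diff_distrib)
  finally show ?thesis
    unfolding X_def[symmetric] by (simp add: q_null_mult_left q_null_sum null)
qed

lemma mean_resolvent_bound:
  assumes n: "n > 0" and z: "cmod z \<le> \<rho>" and C: "\<forall>z. cmod z \<le> \<rho> \<longrightarrow> q (F z) \<le> C"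
  shows "q (mean_resolvent n z) \<le> C"
proof -
  have "q (\<Sum>k<n. F (z * exp (2 * of_real pi * \<i> * of_nat k / of_nat n)))
      \<le> (\<Sum>k<n. q (F (z * exp (2 * of_real pi * \<i> * of_nat k / of_nat n))))" by (rule q_sum)
  also have "\<dots> \<le> (\<Sum>k<n. C)"
    using C z by (intro sum_mono) (simp add: norm_mult norm_root_of_unity)
  finally show ?thesis using n unfolding mean_resolvent_def q_emb by (simp add: norm_divide field_simps)
qed

lemma mean_resolvent_lipschitz:
  assumes n: "n > 0" and z: "cmod z \<le> \<rho>" "cmod w \<le> \<rho>" and C: "C \<ge> 1" "\<forall>z. cmod z \<le> \<rho> \<longrightarrow> q (F z) \<le> C"
  shows "q (mean_resolvent n z - mean_resolvent n w) \<le> cmod (z - w) * (C * q y * C)"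
proof -
  define e where "e k = exp (2 * of_real pi * \<i> * of_nat k / of_nat n)" for k
  have e: "cmod (e k) = 1" for k by (simp add: e_def norm_root_of_unity)
  have "mean_resolvent n z - mean_resolvent n w = emb (1 / of_nat n) * (\<Sum>k<n. F (z * e k) - F (w * e k))"
    by (simp add: mean_resolvent_def e_def sum_subtractf right_diff_distrib)
  then have "q (mean_resolvent n z - mean_resolvent n w) = (1 / real n) * q (\<Sum>k<n. F (z * e k) - F (w * e k))"
    by (simp add: q_emb norm_divide)
  also have "\<dots> \<le> (1 / real n) * (\<Sum>k<n. cmod (z - w) * (C * q y * C))"
  proof (rule mult_left_mono)
    have "q (F (z * e k) - F (w * e k)) \<le> cmod (z - w) * (C * q y * C)" for k
    proof -
      have ze: "cmod (z * e k) \<le> \<rho>" "cmod (w * e k) \<le> \<rho>" using z e by (simp_all add: norm_mult)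
      have "q (F (z * e k) - F (w * e k)) \<le> cmod (z * e k - w * e k) * (q (F (z * e k)) * q y * q (F (w * e k)))"
        by (rule resolvent_difference[OF ze])
      also have "cmod (z * e k - w * e k) = cmod (z - w)"
        using e[of k] by (simp add: norm_mult flip: left_diff_distrib)
      also have "cmod (z - w) * (q (F (z * e k)) * q y * q (F (w * e k))) \<le> cmod (z - w) * (C * q y * C)"
        using C ze by (intro mult_left_mono mult_mono mult_nonneg_nonneg q_nonneg) auto
      finally show ?thesis .
    qed
    then show "q (\<Sum>k<n. F (z * e k) - F (w * e k)) \<le> (\<Sum>k<n. cmod (z - w) * (C * q y * C))"
      by (intro order_trans[OF q_sum] sum_mono)
  qed simp
  also have "\<dots> = cmod (z - w) * (C * q y * C)" using n by simp
  finally show ?thesis .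
qed

text \<open>If the powers of \<open>r * y\<close> tend to \<open>0\<close>, then the mean resolvent tends to \<open>1\<close> on the circle of
  radius \<open>r\<close>. By the uniform Lipschitz bound it is still close to \<open>1\<close> on slightly larger circles, and
  this bounds the powers there. The step width does not depend on \<open>r\<close>, so finitely many steps
  reach every radius below \<open>\<rho>\<close>.\<close>

lemma powers_tendsto_0:
  assumes t: "0 \<le> t" "t < \<rho>"
  shows "(\<lambda>n. t ^ n * q (y ^ n)) \<longlonglongrightarrow> 0"
proof -
  obtain C where C: "C \<ge> 1" "\<forall>z. cmod z \<le> \<rho> \<longrightarrow> q (F z) \<le> C" by (rule resolvent_bounded)
  define d where "d = 1 / (4 * (C * q y * C + 1))"
  have CC: "C * q y * C \<ge> 0" using C(1) by (intro mult_nonneg_nonneg q_nonneg) auto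
  then have d: "d > 0" "d * (C * q y * C) \<le> 1 / 4" by (auto simp: d_def field_simps)
  have step: "(\<lambda>n. s ^ n * q (y ^ n)) \<longlonglongrightarrow> 0"
    if r: "0 \<le> r" "r < \<rho>" "(\<lambda>n. r ^ n * q (y ^ n)) \<longlonglongrightarrow> 0" and s: "0 \<le> s" "s < \<rho>" "s < r + d" for r s
  proof -
    \<comment> \<open>A radius slightly larger than \<open>s\<close> that is still reached by the Lipschitz bound: boundedness there
      gives decay at \<open>s\<close>.\<close>
    define u where "u = max s (min ((s + \<rho>) / 2) (r + d))"
    have u: "s < u" "u \<le> \<rho>" "u \<le> r + d" "u > 0" using s by (auto simp: u_def min_def)
    consider "u \<le> r" | "r < u" by linarith
    then have ev: "eventually (\<lambda>n. u ^ n * q (y ^ n) \<le> 1) sequentially"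
    proof cases
      case 1
      have "eventually (\<lambda>n. r ^ n * q (y ^ n) < 1) sequentially"
        using order_tendstoD(2)[OF r(3), of 1] by simp
      then show ?thesis
      proof (rule eventually_mono)
        fix n assume "r ^ n * q (y ^ n) < 1"
        moreover have "u ^ n * q (y ^ n) \<le> r ^ n * q (y ^ n)"
          using 1 u by (intro mult_right_mono power_mono q_nonneg) auto
        ultimately show "u ^ n * q (y ^ n) \<le> 1" by simp
      qed
    next
      case 2
      have "(\<lambda>n. (r ^ n * q (y ^ n)) * C) \<longlonglongrightarrow> 0 * C" by (intro tendsto_mult r(3) tendsto_const)
      then have "eventually (\<lambda>n. (r ^ n * q (y ^ n)) * C < 1 / 4) sequentially"
        by (rule order_tendstoD(2)) simp
      with eventually_gt_at_top[of 0] show ?thesis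
      proof eventually_elim
        case (elim n)
        let ?G = "mean_resolvent n (of_real u)" and ?H = "mean_resolvent n (of_real r)"
        let ?X = "emb (of_real u ^ n) * y ^ n" and ?Y = "emb (of_real r ^ n) * y ^ n"
        have cu: "cmod (of_real u) \<le> \<rho>" and cr: "cmod (of_real r) \<le> \<rho>" using u r by auto
        have qX: "q ?X = u ^ n * q (y ^ n)" using u by (simp add: q_emb norm_power)
        have qY: "q ?Y = r ^ n * q (y ^ n)" using r by (simp add: q_emb norm_power)
        have "?H - 1 = ?Y * ?H + ((1 - ?Y) * ?H - 1)" by (simp add: algebra_simps)
        then have "q (?H - 1) \<le> q (?Y * ?H)"
          using q_add_null[OF mean_resolvent_inverse[OF elim(1) cr]] by metis
        also have "\<dots> \<le> q ?Y * q ?H" by (rule q_mult)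
        also have "\<dots> \<le> (r ^ n * q (y ^ n)) * C"
          unfolding qY[symmetric] by (intro mult_left_mono mean_resolvent_bound[OF elim(1) cr C(2)] q_nonneg)
        finally have H: "q (?H - 1) \<le> 1 / 4" using elim(2) by simp
        have "q (?G - ?H) \<le> cmod (of_real u - of_real r) * (C * q y * C)"
          by (rule mean_resolvent_lipschitz[OF elim(1) cu cr C])
        also have "cmod (of_real u - of_real r) \<le> d" using u 2 by (simp flip: of_real_diff)
        finally have "q (?G - ?H) \<le> d * (C * q y * C)" using CC by (simp add: mult_right_mono)
        then have "q (?G - ?H) \<le> 1 / 4" using d(2) by simp
        then have G: "q (?G - 1) \<le> 1 / 2" using q_add[of "?G - ?H" "?H - 1"] H by simp
        \<comment> \<open>\<open>?X * ?G\<close> is \<open>?G - 1\<close> up to a null element, and \<open>?G\<close> is close to \<open>1\<close>.\<close>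
        have "?X = ((?G - 1) - ?X * (?G - 1)) - ((1 - ?X) * ?G - 1)" by (simp add: algebra_simps)
        then have "q ?X \<le> q ((?G - 1) - ?X * (?G - 1)) + q ((1 - ?X) * ?G - 1)"
          using q_diff by metis
        also have "q ((1 - ?X) * ?G - 1) = 0" by (rule mean_resolvent_inverse[OF elim(1) cu])
        also have "q ((?G - 1) - ?X * (?G - 1)) \<le> q (?G - 1) + q (?X * (?G - 1))" by (rule q_diff)
        also have "q (?X * (?G - 1)) \<le> q ?X * q (?G - 1)" by (rule q_mult)
        also have "q ?X * q (?G - 1) \<le> q ?X * (1 / 2)" by (intro mult_left_mono G q_nonneg)
        finally have "q ?X \<le> 1" using G by simp
        then show ?case by (simp only: qX)
      qed
    qed
    have "eventually (\<lambda>n. norm (s ^ n * q (y ^ n)) \<le> (s / u) ^ n) sequentially"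
      using ev
    proof eventually_elim
      case (elim n)
      have "norm (s ^ n * q (y ^ n)) = (s / u) ^ n * (u ^ n * q (y ^ n))"
        using s u q_nonneg[of "y ^ n"] by (simp add: power_divide)
      also have "\<dots> \<le> (s / u) ^ n * 1" using elim s u by (intro mult_left_mono) auto
      finally show ?case by simp
    qed
    moreover have "(\<lambda>n. (s / u) ^ n) \<longlonglongrightarrow> 0" using s u by (intro LIMSEQ_power_zero) auto
    ultimately show ?thesis by (rule Lim_null_comparison)
  qed
  have "\<forall>t. 0 \<le> t \<longrightarrow> t < \<rho> \<longrightarrow> t \<le> real m * (d / 2) \<longrightarrow> (\<lambda>n. t ^ n * q (y ^ n)) \<longlonglongrightarrow> 0" for m
  proof (induction m)
    case 0
    have "(\<lambda>n. 0 ^ n * q (y ^ n)) \<longlonglongrightarrow> 0"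
      by (rule tendsto_eventually, rule eventually_mono[OF eventually_gt_at_top[of 0]]) simp
    then show ?case by (auto intro: antisym)
  next
    case (Suc m)
    show ?case
    proof (intro allI impI)
      fix t assume t: "0 \<le> t" "t < \<rho>" "t \<le> real (Suc m) * (d / 2)"
      define r where "r = max 0 (t - d / 2)"
      have r: "0 \<le> r" "r < \<rho>" "r \<le> real m * (d / 2)" "t < r + d"
        using t d(1) rho by (auto simp: r_def max_def algebra_simps)
      have "(\<lambda>n. r ^ n * q (y ^ n)) \<longlonglongrightarrow> 0" using Suc.IH[rule_format, OF r(1-3)] .
      then show "(\<lambda>n. t ^ n * q (y ^ n)) \<longlonglongrightarrow> 0" by (rule step[OF r(1,2) _ t(1,2) r(4)])
    qed
  qed
  note radius = this[rule_format, OF t]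
  have "t \<le> real (nat \<lceil>t / (d / 2)\<rceil>) * (d / 2)"
  proof -
    have "t / (d / 2) \<le> real (nat \<lceil>t / (d / 2)\<rceil>)" by linarith
    then show ?thesis using d(1) by (simp add: field_simps)
  qed
  then show ?thesis by (rule radius)
qed

end

section \<open>Gelfand theory without a unit\<close>

subsection \<open>Powers modulo a closed ideal\<close>

text \<open>The unitization supplies the unit in expressions such as \<open>1 - z y\<close>; it carries no norm of its own,
  only the seminorms that measure the distance to an ideal.\<close>

datatype 'a unitization = Unitization (scalar_part: complex) (algebra_part: 'a)

instantiation unitization :: (complex_banach_algebra) ring_1
begin
definition "0 = Unitization 0 0"
definition "1 = Unitization 1 0"
definition "x + y = Unitization (scalar_part x + scalar_part y) (algebra_part x + algebra_part y)"
definition "x - y = Unitization (scalar_part x - scalar_part y) (algebra_part x - algebra_part y)"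
definition "- x = Unitization (- scalar_part x) (- algebra_part x)"
definition "x * y = Unitization (scalar_part x * scalar_part y)
  (scalar_part x *\<^sub>C algebra_part y + scalar_part y *\<^sub>C algebra_part x + algebra_part x * algebra_part y)"
instance
  by standard
    (auto simp: zero_unitization_def one_unitization_def plus_unitization_def minus_unitization_def
      uminus_unitization_def times_unitization_def algebra_simps scaleC_add_right scaleC_add_left
      scaleC_scaleC scaleC_one mult_scaleC_left mult_scaleC_right)
end

lemmas unitization_simps = zero_unitization_def one_unitization_def plus_unitization_def
  minus_unitization_def uminus_unitization_def times_unitization_def

text \<open>The \<open>n + 1\<close>-st power; an algebra without unit has no power of exponent \<open>0\<close>.\<close>

definition spower :: "'a::times \<Rightarrow> nat \<Rightarrow> 'a" where
  "spower a n = ((*) a ^^ n) a"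

lemma spower_0 [simp]: "spower a 0 = a"
  by (simp add: spower_def)

lemma spower_Suc [simp]: "spower a (Suc n) = a * spower a n"
  by (simp add: spower_def)

lemma Unitization_power: "Unitization 0 a ^ Suc n = Unitization 0 (spower a n)"
  by (induction n) (simp_all add: unitization_simps)

definition closed_ideal :: "'a::complex_banach_algebra set \<Rightarrow> bool" where
  "closed_ideal M \<longleftrightarrow> csubspace M \<and> closed M \<and> (\<forall>a. \<forall>x\<in>M. a * x \<in> M \<and> x * a \<in> M)"

lemma le_infdistI: "M \<noteq> {} \<Longrightarrow> (\<And>m. m \<in> M \<Longrightarrow> r \<le> dist b m) \<Longrightarrow> r \<le> infdist b M"
  by (simp add: infdist_notempty cINF_greatest)

lemma infdist_add_le:
  fixes M :: "'a::complex_normed_vector set"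
  assumes M: "csubspace M"
  shows "infdist (a + b) M \<le> infdist a M + infdist b M"
proof -
  have ne: "M \<noteq> {}" using complex_vector.subspace_0[OF M] by auto
  have "infdist (a + b) M \<le> dist a m + dist b n" if "m \<in> M" "n \<in> M" for m n
  proof -
    have "infdist (a + b) M \<le> dist (a + b) (m + n)"
      by (intro infdist_le complex_vector.subspace_add[OF M] that)
    also have "\<dots> \<le> dist a m + dist b n" by (rule dist_triangle_add)
    finally show ?thesis .
  qed
  then have "infdist (a + b) M - dist a m \<le> infdist b M" if "m \<in> M" for m
    using that by (intro le_infdistI ne) (simp add: algebra_simps)
  then have "infdist (a + b) M - infdist b M \<le> infdist a M"
    by (intro le_infdistI ne) (simp add: algebra_simps)
  then show ?thesis by simp
qed

lemma infdist_scaleC: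
  fixes M :: "'a::complex_normed_vector set"
  assumes M: "csubspace M"
  shows "infdist (c *\<^sub>C a) M = cmod c * infdist a M"
proof -
  have ne: "M \<noteq> {}" using complex_vector.subspace_0[OF M] by auto
  have le: "infdist (c *\<^sub>C a) M \<le> cmod c * infdist a M" if "c \<noteq> 0" for c a
  proof -
    have "infdist (c *\<^sub>C a) M / cmod c \<le> dist a m" if "m \<in> M" for m
    proof -
      have "infdist (c *\<^sub>C a) M \<le> dist (c *\<^sub>C a) (c *\<^sub>C m)"
        by (intro infdist_le complex_vector.subspace_scale[OF M] that)
      also have "\<dots> = cmod c * dist a m"
        by (simp add: dist_norm norm_scaleC flip: complex_vector.scale_right_diff_distrib)
      finally show ?thesis using \<open>c \<noteq> 0\<close> by (simp add: field_simps)
    qed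
    then have "infdist (c *\<^sub>C a) M / cmod c \<le> infdist a M" by (intro le_infdistI ne)
    then show ?thesis using that by (simp add: field_simps)
  qed
  show ?thesis
  proof (cases "c = 0")
    case True
    then show ?thesis using complex_vector.subspace_0[OF M] by simp
  next
    case False
    have "infdist a M \<le> inverse (cmod c) * infdist (c *\<^sub>C a) M"
      using le[of "inverse c" "c *\<^sub>C a"] False by (simp add: scaleC_scaleC scaleC_one norm_inverse)
    then have "cmod c * infdist a M \<le> infdist (c *\<^sub>C a) M" using False by (simp add: field_simps)
    then show ?thesis using le[OF False, of a] by simp
  qed
qed

lemma infdist_mult_le:
  fixes M :: "'a::complex_banach_algebra set"
  assumes M: "closed_ideal M"
  shows "infdist (a * b) M \<le> infdist a M * infdist b M"
proof -
  have sub: "csubspace M" and id: "\<And>a x. x \<in> M \<Longrightarrow> a * x \<in> M" "\<And>a x. x \<in> M \<Longrightarrow> x * a \<in> M"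
    using M unfolding closed_ideal_def by auto
  have ne: "M \<noteq> {}" using complex_vector.subspace_0[OF sub] by auto
  have "infdist (a * b) M \<le> dist a m * dist b n" if "m \<in> M" "n \<in> M" for m n
  proof -
    have "a * n + m * b - m * n \<in> M"
      by (intro complex_vector.subspace_add[OF sub] complex_vector.subspace_diff[OF sub] id that)
    then have "infdist (a * b) M \<le> dist (a * b) (a * n + m * b - m * n)" by (rule infdist_le)
    also have "\<dots> = norm ((a - m) * (b - n))" by (simp add: dist_norm algebra_simps)
    also have "\<dots> \<le> norm (a - m) * norm (b - n)" by (rule norm_mult_ineq)
    finally show ?thesis by (simp add: dist_norm)
  qed
  note bound = this
  have left: "infdist (a * b) M \<le> dist a m * infdist b M" if m: "m \<in> M" for m
  proof (cases "dist a m = 0")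
    case True
    then show ?thesis using bound[OF m m] by simp
  next
    case False
    have "infdist (a * b) M / dist a m \<le> infdist b M"
      using bound[OF m] False by (intro le_infdistI ne) (simp add: field_simps)
    then show ?thesis using False by (simp add: field_simps)
  qed
  show ?thesis
  proof (cases "infdist b M = 0")
    case True
    obtain m where "m \<in> M" using ne by blast
    then show ?thesis using left[of m] True by simp
  next
    case False
    then have pos: "infdist b M > 0" using infdist_nonneg[of b M] by simp
    have "infdist (a * b) M / infdist b M \<le> infdist a M"
      using left pos by (intro le_infdistI ne) (simp add: field_simps)
    then show ?thesis using pos by (simp add: field_simps)
  qed
qed

lemma seminormed_algebra_modulo:
  fixes M :: "'a::complex_banach_algebra set"
  assumes M: "closed_ideal M"
  shows "seminormed_algebra (\<lambda>x. cmod (scalar_part x) + infdist (algebra_part x) M) (\<lambda>c. Unitization c 0)"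
proof
  have sub: "csubspace M" using M unfolding closed_ideal_def by auto
  have zero: "infdist 0 M = 0" using complex_vector.subspace_0[OF sub] by simp
  fix x y :: "'a unitization" and c d :: complex
  show "0 \<le> cmod (scalar_part x) + infdist (algebra_part x) M" by (simp add: infdist_nonneg)
  show "cmod (scalar_part (x + y)) + infdist (algebra_part (x + y)) M
      \<le> cmod (scalar_part x) + infdist (algebra_part x) M + (cmod (scalar_part y) + infdist (algebra_part y) M)"
    using infdist_add_le[OF sub, of "algebra_part x" "algebra_part y"]
      norm_triangle_ineq[of "scalar_part x" "scalar_part y"]
    by (simp add: plus_unitization_def)
  show "cmod (scalar_part (x * y)) + infdist (algebra_part (x * y)) M
      \<le> (cmod (scalar_part x) + infdist (algebra_part x) M) * (cmod (scalar_part y) + infdist (algebra_part y) M)"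
  proof -
    let ?c = "scalar_part x" and ?d = "scalar_part y" and ?a = "algebra_part x" and ?b = "algebra_part y"
    have "infdist (?c *\<^sub>C ?b + ?d *\<^sub>C ?a + ?a * ?b) M
        \<le> infdist (?c *\<^sub>C ?b) M + infdist (?d *\<^sub>C ?a) M + infdist (?a * ?b) M"
      using infdist_add_le[OF sub, of "?c *\<^sub>C ?b + ?d *\<^sub>C ?a" "?a * ?b"]
        infdist_add_le[OF sub, of "?c *\<^sub>C ?b" "?d *\<^sub>C ?a"] by linarith
    then show ?thesis
      using infdist_mult_le[OF M, of ?a ?b]
      by (simp add: times_unitization_def infdist_scaleC[OF sub] norm_mult algebra_simps)
  qed
  show "cmod (scalar_part (Unitization c 0 * x)) + infdist (algebra_part (Unitization c 0 * x)) M
      = cmod c * (cmod (scalar_part x) + infdist (algebra_part x) M)"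
    by (simp add: times_unitization_def infdist_scaleC[OF sub] norm_mult algebra_simps)
qed (use complex_vector.subspace_0[of M] M in \<open>auto simp: closed_ideal_def unitization_simps algebra_simps\<close>)

text \<open>\<open>v - z y - z y v \<in> M\<close> says that \<open>1 + v\<close> is the inverse of \<open>1 - z y\<close> modulo \<open>M\<close>.\<close>

lemma quasi_invertible_powers_tendsto_0:
  fixes M :: "'a::complex_banach_algebra set"
  assumes comm: "commutative TYPE('a)" and M: "closed_ideal M" and rho: "\<rho> > 0"
    and v: "\<And>z. cmod z \<le> \<rho> \<Longrightarrow> \<exists>v. v - z *\<^sub>C y - z *\<^sub>C (y * v) \<in> M"
    and t: "0 \<le> t" "t < \<rho>"
  shows "(\<lambda>n. t ^ Suc n * infdist (spower y n) M) \<longlonglongrightarrow> 0"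
proof -
  let ?q = "\<lambda>x :: 'a unitization. cmod (scalar_part x) + infdist (algebra_part x) M"
  let ?emb = "\<lambda>c. Unitization c (0 :: 'a)"
  interpret seminormed_algebra ?q ?emb by (rule seminormed_algebra_modulo[OF M])
  have "\<forall>z. \<exists>v. cmod z \<le> \<rho> \<longrightarrow> v - z *\<^sub>C y - z *\<^sub>C (y * v) \<in> M" using v by blast
  then obtain V where V: "\<forall>z. cmod z \<le> \<rho> \<longrightarrow> V z - z *\<^sub>C y - z *\<^sub>C (y * V z) \<in> M" by metis
  define F where "F z = Unitization 1 (V z)" for z
  have comm': "a * b = b * a" for a b :: 'a using comm unfolding commutative_def by blast
  have eq1: "(1 - ?emb z * Unitization 0 y) * F z - 1 = Unitization 0 (V z - z *\<^sub>C y - z *\<^sub>C (y * V z))" for z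
    by (simp add: unitization_simps F_def scaleC_one mult_scaleC_left)
  have eq2: "F z * (1 - ?emb z * Unitization 0 y) - 1 = Unitization 0 (V z - z *\<^sub>C y - z *\<^sub>C (y * V z))" for z
    by (simp add: unitization_simps F_def scaleC_one mult_scaleC_right comm'[of _ y])
  have "seminormed_resolvent ?q ?emb (Unitization 0 y) \<rho> F"
    by unfold_locales (use rho V in \<open>simp_all add: eq1 eq2\<close>)
  then interpret seminormed_resolvent ?q ?emb "Unitization 0 y" \<rho> F .
  have "(\<lambda>n. t ^ Suc n * ?q (Unitization 0 y ^ Suc n)) \<longlonglongrightarrow> 0"
    by (rule LIMSEQ_Suc[OF powers_tendsto_0[OF t]])
  then show ?thesis unfolding Unitization_power by simp
qed

subsection \<open>Maximal modular ideals and characters\<close>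

lemma left_ideal_modular_unit:
  assumes "left_ideal L" "\<And>a. a - a * u \<in> L" "u \<in> L"
  shows "L = UNIV"
proof -
  have "a \<in> L" for a
  proof -
    have "(a - a * u) + a * u \<in> L"
      using assms unfolding left_ideal_def by (intro complex_vector.subspace_add) auto
    then show ?thesis by simp
  qed
  then show ?thesis by auto
qed

text \<open>A left ideal containing \<open>J\<close> is proper if and only if it does not contain \<open>u\<close>, and this condition is
  stable under unions of chains.\<close>

lemma maximal_modular_left_ideal_exists:
  assumes J: "left_ideal J" "\<And>a. a - a * u \<in> J" "J \<noteq> UNIV"
  obtains L where "maximal_modular_left_ideal L" "J \<subseteq> L"
proof -
  let ?A = "{L. left_ideal L \<and> J \<subseteq> L \<and> u \<notin> L}"
  have uJ: "u \<notin> J" using left_ideal_modular_unit[OF J(1,2)] J(3) by blast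
  have "\<exists>U\<in>?A. \<forall>X\<in>C. X \<subseteq> U" if C: "C \<in> chains ?A" for C
  proof (cases "C = {}")
    case True
    then show ?thesis using J(1) uJ by auto
  next
    case False
    have CA: "C \<subseteq> ?A" and chain: "\<And>X Y. X \<in> C \<Longrightarrow> Y \<in> C \<Longrightarrow> X \<subseteq> Y \<or> Y \<subseteq> X"
      using C unfolding chains_def chain_subset_def by auto
    obtain X0 where X0: "X0 \<in> C" using False by blast
    have sub: "csubspace X" if "X \<in> C" for X using that CA unfolding left_ideal_def by auto
    have "csubspace (\<Union> C)"
    proof (rule complex_vector.subspaceI)
      show "0 \<in> \<Union> C" using X0 complex_vector.subspace_0[OF sub[OF X0]] by blast
      fix x y assume "x \<in> \<Union> C" "y \<in> \<Union> C"
      then obtain X Y where XY: "X \<in> C" "Y \<in> C" "x \<in> X" "y \<in> Y" by blast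
      then have "\<exists>Z\<in>C. x \<in> Z \<and> y \<in> Z" using chain[of X Y] by auto
      then show "x + y \<in> \<Union> C" using complex_vector.subspace_add[OF sub] by (meson UnionI)
    next
      fix c x assume "x \<in> \<Union> C"
      then show "c *\<^sub>C x \<in> \<Union> C" using complex_vector.subspace_scale[OF sub] by (meson UnionE UnionI)
    qed
    moreover have "a * x \<in> \<Union> C" if "x \<in> \<Union> C" for a x
    proof -
      obtain X where X: "X \<in> C" "x \<in> X" using \<open>x \<in> \<Union> C\<close> by (rule UnionE)
      then have "left_ideal X" using CA by auto
      then have "a * x \<in> X" using X(2) unfolding left_ideal_def by simp
      then show ?thesis using X(1) by (rule UnionI[rotated])
    qed
    ultimately have "left_ideal (\<Union> C)" unfolding left_ideal_def by simp
    moreover have "J \<subseteq> \<Union> C" using X0 CA by auto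
    moreover have "u \<notin> \<Union> C" using CA by auto
    ultimately show ?thesis by (intro bexI[of _ "\<Union> C"]) auto
  qed
  then obtain L where L: "L \<in> ?A" "\<forall>X\<in>?A. L \<subseteq> X \<longrightarrow> X = L"
    using Zorn_Lemma2[of ?A] by blast
  have mod: "a - a * u \<in> L" for a using L(1) J(2) by auto
  have "maximal_modular_left_ideal L"
    unfolding maximal_modular_left_ideal_def modular_left_ideal_def
  proof (intro conjI allI impI exI[of _ u])
    show "left_ideal L" "L \<noteq> UNIV" using L(1) by auto
    show "a - a * u \<in> L" for a by (rule mod)
    fix N assume N: "left_ideal N \<and> L \<subseteq> N"
    show "N = L \<or> N = UNIV"
    proof (cases "u \<in> N")
      case True
      then show ?thesis using left_ideal_modular_unit[of N u] N mod by blast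
    next
      case False
      then have "N \<in> ?A" using N L(1) by auto
      then show ?thesis using L(2) N by blast
    qed
  qed
  then show ?thesis using that L(1) by blast
qed

lemma left_ideal_sum:
  assumes I: "csubspace I" "\<And>a x. x \<in> I \<Longrightarrow> a * x \<in> I" and M: "csubspace M" "\<And>a x. x \<in> M \<Longrightarrow> a * x \<in> M"
  shows "left_ideal {x + m | x m. x \<in> I \<and> m \<in> M}"
  unfolding left_ideal_def
proof (intro conjI allI ballI)
  show "csubspace {x + m | x m. x \<in> I \<and> m \<in> M}"
    using complex_vector.subspace_sums[OF I(1) M(1)] .
  fix a z assume "z \<in> {x + m | x m. x \<in> I \<and> m \<in> M}"
  then obtain x m where z: "z = x + m" "x \<in> I" "m \<in> M" by blast
  have "a * z = a * x + a * m" by (simp add: z(1) distrib_left)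
  then show "a * z \<in> {x + m | x m. x \<in> I \<and> m \<in> M}" using I(2)[OF z(2)] M(2)[OF z(3)] by blast
qed

lemma bounded_clinear_mult_left: "bounded_clinear ((*) (a :: 'a::complex_banach_algebra))"
  by (rule bounded_clinearI[where K = "norm a"])
    (simp_all add: distrib_left mult_scaleC_right norm_mult_ineq)

lemma bounded_clinear_mult_right: "bounded_clinear (\<lambda>x. x * (a :: 'a::complex_banach_algebra))"
  by (rule bounded_clinearI[where K = "norm a"])
    (simp_all add: distrib_right mult_scaleC_left norm_mult_ineq mult.commute[of "norm a"])

lemma maximal_modular_left_idealD:
  assumes "maximal_modular_left_ideal L"
  shows "left_ideal L" "L \<noteq> UNIV" "csubspace L" "x \<in> L \<Longrightarrow> a * x \<in> L"
    and "left_ideal M \<Longrightarrow> L \<subseteq> M \<Longrightarrow> M = L \<or> M = UNIV" "\<exists>u. \<forall>a. a - a * u \<in> L"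
  using assms unfolding maximal_modular_left_ideal_def modular_left_ideal_def left_ideal_def by auto

text \<open>The left ideal \<open>A b + L\<close> properly contains \<open>L\<close>, so it is the whole algebra.\<close>

lemma maximal_left_ideal_plus_principal:
  assumes L: "maximal_modular_left_ideal L" and b: "a0 * b \<notin> L"
  obtains a m where "y = a * b + m" "m \<in> L"
proof -
  note D = maximal_modular_left_idealD[OF L]
  let ?J = "{x + m | x m. x \<in> range (\<lambda>a. a * b) \<and> m \<in> L}"
  have "left_ideal ?J"
  proof (rule left_ideal_sum[OF csubspace_range[OF bounded_clinear_mult_right] _ D(3,4)])
    show "c * x \<in> range (\<lambda>a. a * b)" if "x \<in> range (\<lambda>a. a * b)" for c x
      using that by (auto simp flip: mult.assoc)
  qed
  moreover have "L \<subseteq> ?J"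
  proof
    fix m assume "m \<in> L"
    then have "0 * b + m \<in> ?J" by blast
    then show "m \<in> ?J" by simp
  qed
  moreover have "?J \<noteq> L"
  proof
    assume eq: "?J = L"
    have "a0 * b + 0 \<in> ?J" using complex_vector.subspace_0[OF D(3)] by blast
    then show False using eq b by simp
  qed
  ultimately have "?J = UNIV" using D(5) by blast
  then have "y \<in> ?J" by simp
  then show ?thesis using that by blast
qed

lemma csubspace_closure:
  fixes S :: "'a::complex_normed_vector set"
  assumes S: "csubspace S" shows "csubspace (closure S)"
proof (rule complex_vector.subspaceI)
  show "0 \<in> closure S" using complex_vector.subspace_0[OF S] by (rule subsetD[OF closure_subset])
  fix x y assume "x \<in> closure S" "y \<in> closure S"
  then obtain f g where f: "\<forall>n. f n \<in> S" "f \<longlonglongrightarrow> x" and g: "\<forall>n. g n \<in> S" "g \<longlonglongrightarrow> y"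
    unfolding closure_sequential by auto
  have "\<forall>n. f n + g n \<in> S" using f(1) g(1) complex_vector.subspace_add[OF S] by simp
  then show "x + y \<in> closure S"
    unfolding closure_sequential using tendsto_add[OF f(2) g(2)] by (intro exI[of _ "\<lambda>n. f n + g n"]) simp
next
  fix c x assume "x \<in> closure S"
  then obtain f where f: "\<forall>n. f n \<in> S" "f \<longlonglongrightarrow> x" unfolding closure_sequential by auto
  have "\<forall>n. c *\<^sub>C f n \<in> S" using f(1) complex_vector.subspace_scale[OF S] by simp
  moreover have "(\<lambda>n. c *\<^sub>C f n) \<longlonglongrightarrow> c *\<^sub>C x"
    by (rule tendsto_bounded_clinear[OF bounded_clinear_scale[OF bounded_clinear_ident] f(2)])
  ultimately show "c *\<^sub>C x \<in> closure S"
    unfolding closure_sequential by (intro exI[of _ "\<lambda>n. c *\<^sub>C f n"]) simp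
qed

lemma norm_spower_le: "norm (spower a n) \<le> norm (a :: 'a::real_normed_algebra) ^ Suc n"
proof (induction n)
  case (Suc n)
  have "norm (spower a (Suc n)) \<le> norm a * norm (spower a n)" by (simp add: norm_mult_ineq)
  also have "\<dots> \<le> norm a * norm a ^ Suc n" by (intro mult_left_mono Suc) simp
  finally show ?case by simp
qed simp

lemma quasi_inverse_exists:
  fixes w :: "'a::complex_banach_algebra"
  assumes "norm w < 1"
  obtains v where "v - w * v = w"
proof -
  have "summable (\<lambda>n. norm w ^ Suc n)"
    using summable_geometric[of "norm w"] assms by (simp add: summable_Suc_iff)
  then have sm: "summable (spower w)"
    by (rule summable_comparison_test'[of _ 0]) (rule norm_spower_le)
  have "(\<Sum>n. spower w n) = spower w 0 + (\<Sum>n. spower w (Suc n))"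
    using suminf_split_head[OF sm] by simp
  also have "(\<Sum>n. spower w (Suc n)) = w * (\<Sum>n. spower w n)"
    using bounded_linear.suminf[OF bounded_clinear_bounded_linear[OF bounded_clinear_mult_left[of w]] sm]
    by simp
  finally show ?thesis by (intro that[of "\<Sum>n. spower w n"]) (simp add: diff_eq_eq)
qed

text \<open>If an element of \<open>L\<close> had distance less than \<open>1\<close> from the modular unit \<open>u\<close>, a Neumann series would show
  \<open>u \<in> L\<close>. So \<open>L\<close> is not dense, and by maximality it equals its closure.\<close>

lemma maximal_modular_closed_ideal:
  fixes L :: "'a::complex_banach_algebra set"
  assumes comm: "commutative TYPE('a)" and L: "maximal_modular_left_ideal L"
  shows "closed_ideal L"
proof -
  have comm': "a * b = b * a" for a b :: 'a using comm unfolding commutative_def by blast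
  note id = maximal_modular_left_idealD(1,2)[OF L] and sub = maximal_modular_left_idealD(3)[OF L]
    and mult = maximal_modular_left_idealD(4)[OF L] and max = maximal_modular_left_idealD(5)[OF L]
  obtain u where u: "\<And>a. a - a * u \<in> L" using maximal_modular_left_idealD(6)[OF L] by auto
  have "left_ideal (closure L)"
    unfolding left_ideal_def
  proof (intro conjI allI ballI csubspace_closure[OF sub])
    fix a x assume "x \<in> closure L"
    then obtain f where f: "\<forall>n. f n \<in> L" "f \<longlonglongrightarrow> x" unfolding closure_sequential by auto
    have "(\<lambda>n. a * f n) \<longlonglongrightarrow> a * x" by (intro tendsto_mult tendsto_const f(2))
    then show "a * x \<in> closure L"
      unfolding closure_sequential using f(1) mult by (intro exI[of _ "\<lambda>n. a * f n"]) simp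
  qed
  then have "closure L = L \<or> closure L = UNIV" by (rule max[OF _ closure_subset])
  moreover have "closure L \<noteq> UNIV"
  proof
    assume "closure L = UNIV"
    then have "u \<in> closure L" by simp
    then obtain x where x: "x \<in> L" "dist x u < 1" unfolding closure_approachable by (meson zero_less_one)
    define w where "w = u - x"
    have "norm w < 1" using x(2) by (simp add: w_def dist_norm norm_minus_commute)
    then obtain v where v: "v - w * v = w" by (rule quasi_inverse_exists)
    have "w = (v - v * u) + v * x"
      by (subst v[symmetric]) (simp add: w_def algebra_simps comm'[of v])
    then have "w \<in> L" using complex_vector.subspace_add[OF sub u mult[OF x(1)]] by metis
    then have "u \<in> L" using complex_vector.subspace_add[OF sub _ x(1), of w] by (simp add: w_def)
    then show False using left_ideal_modular_unit[OF id(1) u] id(2) by blast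
  qed
  ultimately have "closed L" using closure_eq by auto
  then show ?thesis unfolding closed_ideal_def using sub mult comm' by metis
qed

text \<open>The Gelfand--Mazur theorem: if \<open>a - \<lambda> u\<close> were invertible modulo \<open>L\<close> for all \<open>\<lambda>\<close>, then all
  multiples of the powers of \<open>a\<close> would tend to \<open>0\<close> modulo \<open>L\<close>, which is impossible as \<open>a\<close> itself is
  invertible.\<close>

lemma Gelfand_Mazur_modulo:
  fixes L :: "'a::complex_banach_algebra set"
  assumes comm: "commutative TYPE('a)" and L: "maximal_modular_left_ideal L"
    and u: "\<And>a. a - a * u \<in> L"
  obtains l where "a - l *\<^sub>C u \<in> L"
proof (rule ccontr)
  assume contra: "\<not> thesis"
  have comm': "x * y = y * x" for x y :: 'a using comm unfolding commutative_def by blast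
  have ci: "closed_ideal L" by (rule maximal_modular_closed_ideal[OF comm L])
  have closed: "closed L" using ci unfolding closed_ideal_def by auto
  note id = maximal_modular_left_idealD(1,2)[OF L] and sub = maximal_modular_left_idealD(3)[OF L]
    and mult = maximal_modular_left_idealD(4)[OF L]
  have uL: "u \<notin> L" using left_ideal_modular_unit[OF id(1) u] id(2) by blast
  have not_in: "b \<notin> L" if "b = a - l *\<^sub>C u" for b l using contra \<open>b = a - l *\<^sub>C u\<close> \<open>\<And>l. a - l *\<^sub>C u \<in> L \<Longrightarrow> thesis\<close> by blast
  have inv: "\<exists>r. u - b * r \<in> L" if "b \<notin> L" for b
  proof -
    have "u * b \<notin> L"
    proof
      assume "u * b \<in> L"
      then have "b * u \<in> L" by (simp only: comm'[of b u])
      then have "(b - b * u) + b * u \<in> L" by (rule complex_vector.subspace_add[OF sub u])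
      then show False using that by simp
    qed
    then obtain x m where "u = x * b + m" "m \<in> L" by (rule maximal_left_ideal_plus_principal[OF L])
    then have "u - b * x \<in> L" by (simp add: comm'[of b x])
    then show ?thesis by blast
  qed
  have quasi: "\<exists>v. v - z *\<^sub>C a - z *\<^sub>C (a * v) \<in> L" for z
  proof (cases "z = 0")
    case True
    then show ?thesis using complex_vector.subspace_0[OF sub] by (intro exI[of _ 0]) simp
  next
    case False
    have "a - inverse z *\<^sub>C u \<notin> L" by (rule not_in[OF refl])
    from inv[OF this] obtain r where r: "u - (a - inverse z *\<^sub>C u) * r \<in> L" by blast
    define s where "s = - (inverse z *\<^sub>C r)"
    define v where "v = s - u"
    have s: "r = - (z *\<^sub>C s)" using False by (simp add: s_def scaleC_scaleC scaleC_one)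
    have "u - (a - inverse z *\<^sub>C u) * r = u + z *\<^sub>C (a * s) - u * s"
      using False
      by (simp add: s mult_scaleC_right left_diff_distrib complex_vector.scale_right_diff_distrib
          mult_scaleC_left scaleC_scaleC scaleC_one)
    from r[unfolded this] have r': "u + z *\<^sub>C (a * s) - u * s \<in> L" .
    have "v - z *\<^sub>C a - z *\<^sub>C (a * v) = (s - s * u) - (u + z *\<^sub>C (a * s) - u * s) - z *\<^sub>C (a - a * u)"
      by (simp add: v_def algebra_simps complex_vector.scale_right_diff_distrib comm'[of s u])
    also have "\<dots> \<in> L"
      by (intro complex_vector.subspace_diff[OF sub] complex_vector.subspace_scale[OF sub] u r')
    finally show ?thesis by blast
  qed
  have "a - 0 *\<^sub>C u \<notin> L" by (rule not_in[OF refl])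
  then obtain b where b: "u - a * b \<in> L" using inv[of a] by auto
  have iL: "infdist x L = 0" if "x \<in> L" for x using that by simp
  have qu: "infdist u L > 0" using uL closed infdist_pos_not_in_closed[OF closed _ uL] complex_vector.subspace_0[OF sub] by blast
  have powers: "u - spower a n * spower b n \<in> L" for n
  proof (induction n)
    case 0
    then show ?case using b by simp
  next
    case (Suc n)
    have "u - spower a (Suc n) * spower b (Suc n)
        = (u - a * b) + (a * b - (a * b) * u) + (a * b) * (u - spower a n * spower b n)"
      by (simp add: right_diff_distrib mult.assoc) (metis comm' mult.assoc)
    also have "\<dots> \<in> L" by (intro complex_vector.subspace_add[OF sub] mult Suc b u)
    finally show ?case .
  qed
  define t where "t = norm b + 1"
  have t: "t > 0" by (simp add: t_def add_nonneg_pos)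
  have lim: "(\<lambda>n. t ^ Suc n * infdist (spower a n) L) \<longlonglongrightarrow> 0"
    by (rule quasi_invertible_powers_tendsto_0[OF comm ci, of "t + 1"]) (use t quasi in auto)
  have "infdist u L \<le> t ^ Suc n * infdist (spower a n) L" for n
  proof -
    have "infdist u L \<le> infdist (u - spower a n * spower b n) L + infdist (spower a n * spower b n) L"
      using infdist_add_le[OF sub, of "u - spower a n * spower b n" "spower a n * spower b n"] by simp
    also have "\<dots> \<le> infdist (spower a n) L * infdist (spower b n) L"
      using infdist_mult_le[OF ci] iL[OF powers] by simp
    also have "\<dots> \<le> infdist (spower a n) L * t ^ Suc n"
    proof (rule mult_left_mono[OF _ infdist_nonneg])
      have "infdist (spower b n) L \<le> dist (spower b n) 0" by (rule infdist_le[OF complex_vector.subspace_0[OF sub]])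
      also have "\<dots> \<le> norm b ^ Suc n" using norm_spower_le[of b n] by simp
      also have "\<dots> \<le> t ^ Suc n" by (intro power_mono) (simp_all add: t_def)
      finally show "infdist (spower b n) L \<le> t ^ Suc n" .
    qed
    finally show ?thesis by (simp add: mult.commute)
  qed
  then have "infdist u L \<le> 0" by (intro tendsto_lowerbound[OF lim]) auto
  then show False using qu by simp
qed

lemma charactersD:
  assumes "\<phi> \<in> characters"
  shows "bounded_clinear \<phi>" "\<phi> (a * b) = \<phi> a * \<phi> b" "\<phi> (a + b) = \<phi> a + \<phi> b" "\<phi> (a - b) = \<phi> a - \<phi> b"
    "\<phi> (c *\<^sub>C a) = c * \<phi> a" "\<phi> 0 = 0"
proof -
  show \<phi>: "bounded_clinear \<phi>" "\<phi> (a * b) = \<phi> a * \<phi> b" using assms unfolding characters_def by auto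
  show "\<phi> (a + b) = \<phi> a + \<phi> b" "\<phi> (a - b) = \<phi> a - \<phi> b" "\<phi> 0 = 0"
    by (rule bounded_clinear_add[OF \<phi>(1)] bounded_clinear_diff[OF \<phi>(1)] bounded_clinear_0[OF \<phi>(1)])+
  show "\<phi> (c *\<^sub>C a) = c * \<phi> a" using bounded_clinear_scaleC[OF \<phi>(1)] by (simp add: scaleC_complex_def)
qed

lemma character_spower: "\<phi> \<in> characters \<Longrightarrow> \<phi> (spower a n) = \<phi> a ^ Suc n"
  by (induction n) (simp_all add: charactersD(2))

text \<open>The scalar \<open>\<phi> a\<close> with \<open>a - \<phi> a u \<in> L\<close> is unique because \<open>u \<notin> L\<close>. Uniqueness makes \<open>\<phi>\<close> multiplicative and
  linear, and \<open>\<phi>\<close> is bounded because \<open>u\<close> has positive distance to the closed ideal \<open>L\<close>.\<close>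

lemma character_of_maximal_modular_ideal:
  fixes L :: "'a::complex_banach_algebra set"
  assumes comm: "commutative TYPE('a)" and L: "maximal_modular_left_ideal L"
  obtains \<phi> where "\<phi> \<in> characters" "kernel \<phi> = L"
proof -
  have comm': "x * y = y * x" for x y :: 'a using comm unfolding commutative_def by blast
  have ci: "closed_ideal L" by (rule maximal_modular_closed_ideal[OF comm L])
  have closed: "closed L" using ci unfolding closed_ideal_def by auto
  note id = maximal_modular_left_idealD(1,2)[OF L] and sub = maximal_modular_left_idealD(3)[OF L]
    and mult = maximal_modular_left_idealD(4)[OF L]
  obtain u where u: "\<And>a. a - a * u \<in> L" using maximal_modular_left_idealD(6)[OF L] by auto
  have uL: "u \<notin> L" using left_ideal_modular_unit[OF id(1) u] id(2) by blast
  have "\<exists>l. a - l *\<^sub>C u \<in> L" for a using Gelfand_Mazur_modulo[OF comm L u, of a] by blast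
  then obtain \<phi> where \<phi>: "\<And>a. a - \<phi> a *\<^sub>C u \<in> L" by metis
  have unique: "\<phi> a = l" if "a - l *\<^sub>C u \<in> L" for a l
  proof (rule ccontr)
    assume "\<phi> a \<noteq> l"
    have "(a - l *\<^sub>C u) - (a - \<phi> a *\<^sub>C u) \<in> L" by (intro complex_vector.subspace_diff[OF sub] that \<phi>)
    then have "(\<phi> a - l) *\<^sub>C u \<in> L" by (simp add: complex_vector.scale_left_diff_distrib)
    then have "inverse (\<phi> a - l) *\<^sub>C (\<phi> a - l) *\<^sub>C u \<in> L" by (rule complex_vector.subspace_scale[OF sub])
    then show False using uL \<open>\<phi> a \<noteq> l\<close> by (simp add: scaleC_scaleC scaleC_one)
  qed
  have add: "\<phi> (a + b) = \<phi> a + \<phi> b" for a b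
  proof (rule unique)
    have "(a - \<phi> a *\<^sub>C u) + (b - \<phi> b *\<^sub>C u) \<in> L" by (intro complex_vector.subspace_add[OF sub] \<phi>)
    then show "a + b - (\<phi> a + \<phi> b) *\<^sub>C u \<in> L" by (simp add: scaleC_add_left algebra_simps)
  qed
  have scale: "\<phi> (c *\<^sub>C a) = c * \<phi> a" for c a
  proof (rule unique)
    have "c *\<^sub>C (a - \<phi> a *\<^sub>C u) \<in> L" by (intro complex_vector.subspace_scale[OF sub] \<phi>)
    then show "c *\<^sub>C a - (c * \<phi> a) *\<^sub>C u \<in> L"
      by (simp add: complex_vector.scale_right_diff_distrib scaleC_scaleC)
  qed
  have prod: "\<phi> (a * b) = \<phi> a * \<phi> b" for a b
  proof (rule unique)
    have "a * (b - \<phi> b *\<^sub>C u) - \<phi> b *\<^sub>C (a - a * u) + \<phi> b *\<^sub>C (a - \<phi> a *\<^sub>C u) \<in> L"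
      by (intro complex_vector.subspace_add[OF sub] complex_vector.subspace_diff[OF sub]
          complex_vector.subspace_scale[OF sub] mult u \<phi>)
    then show "a * b - (\<phi> a * \<phi> b) *\<^sub>C u \<in> L"
      by (simp add: complex_vector.scale_right_diff_distrib scaleC_scaleC right_diff_distrib
          mult_scaleC_right mult.commute)
  qed
  have qu: "infdist u L > 0"
    using infdist_pos_not_in_closed[OF closed _ uL] complex_vector.subspace_0[OF sub] by blast
  have bound: "cmod (\<phi> a) \<le> (1 / infdist u L) * norm a" for a
  proof -
    have "cmod (\<phi> a) * infdist u L = infdist (\<phi> a *\<^sub>C u) L" by (simp add: infdist_scaleC[OF sub])
    also have "\<dots> = infdist (a + - 1 *\<^sub>C (a - \<phi> a *\<^sub>C u)) L"
      by (simp add: complex_vector.scale_right_diff_distrib scaleC_one)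
    also have "\<dots> \<le> infdist a L + infdist (- 1 *\<^sub>C (a - \<phi> a *\<^sub>C u)) L" by (rule infdist_add_le[OF sub])
    also have "infdist (- 1 *\<^sub>C (a - \<phi> a *\<^sub>C u)) L = 0"
      by (intro infdist_zero complex_vector.subspace_scale[OF sub] \<phi>)
    also have "infdist a L \<le> norm a" using infdist_le[OF complex_vector.subspace_0[OF sub], of a] by simp
    finally show ?thesis using qu by (simp add: field_simps)
  qed
  have "bounded_clinear \<phi>"
    by (rule bounded_clinearI[OF add _ bound]) (simp add: scale scaleC_complex_def)
  moreover have "\<phi> u = 1"
    by (rule unique) (simp add: scaleC_one complex_vector.subspace_0[OF sub])
  ultimately have "\<phi> \<in> characters" using prod unfolding characters_def by (auto intro!: exI[of _ u])
  moreover have "kernel \<phi> = L"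
  proof (intro equalityI subsetI)
    show "x \<in> L" if "x \<in> kernel \<phi>" for x using \<phi>[of x] that by simp
    show "x \<in> kernel \<phi>" if "x \<in> L" for x using unique[of x 0] that by simp
  qed
  ultimately show ?thesis by (rule that)
qed

lemma characters_separate:
  fixes x :: "'a::complex_banach_algebra"
  assumes "semisimple TYPE('a)" and comm: "commutative TYPE('a)" and "\<And>\<phi>. \<phi> \<in> characters \<Longrightarrow> \<phi> x = 0"
  shows "x = 0"
proof -
  have "x \<in> L" if L: "maximal_modular_left_ideal L" for L
  proof -
    obtain \<phi> where "\<phi> \<in> characters" "kernel \<phi> = L" by (rule character_of_maximal_modular_ideal[OF comm L])
    then show ?thesis using assms(3)[of \<phi>] by auto
  qed
  then have "x \<in> (jacobson_radical :: 'a set)" unfolding jacobson_radical_def by (intro InterI) simp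
  also have "(jacobson_radical :: 'a set) = {0}" using assms(1) unfolding semisimple_def .
  finally show ?thesis by (rule singletonD)
qed

subsection \<open>Local units in regular algebras\<close>

definition vanishing_ideal :: "('a::complex_banach_algebra \<Rightarrow> complex) set \<Rightarrow> 'a set" where
  "vanishing_ideal V = {a. \<forall>\<psi>\<in>V. \<psi> a = 0}"

lemma closed_ideal_vanishing_ideal:
  assumes V: "V \<subseteq> characters" shows "closed_ideal (vanishing_ideal V)"
proof -
  have eq: "vanishing_ideal V = (\<Inter>\<psi>\<in>V. kernel \<psi>)" unfolding vanishing_ideal_def by auto
  have "closed (vanishing_ideal V)"
    unfolding eq by (intro closed_INT ballI closed_kernel charactersD(1)) (use V in auto)
  moreover have "csubspace (vanishing_ideal V)"
    by (rule complex_vector.subspaceI) (auto simp: vanishing_ideal_def charactersD[OF subsetD[OF V]])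
  ultimately show ?thesis
    unfolding closed_ideal_def by (auto simp: vanishing_ideal_def charactersD[OF subsetD[OF V]])
qed

text \<open>This is the spectral radius formula modulo the ideal of all elements vanishing on \<open>V\<close>. If \<open>1 - z y\<close> were
  not invertible modulo that ideal, then some character annihilating it would take the value \<open>1/z\<close> at \<open>y\<close>.\<close>

lemma spower_decay_modulo_vanishing_ideal:
  fixes y :: "'a::complex_banach_algebra"
  assumes comm: "commutative TYPE('a)" and V: "V \<subseteq> characters"
    and hull: "\<And>\<psi>. \<psi> \<in> characters \<Longrightarrow> (\<And>a. a \<in> vanishing_ideal V \<Longrightarrow> \<psi> a = 0) \<Longrightarrow> cmod (\<psi> y) \<le> s"
    and st: "0 \<le> s" "s < t"
  obtains C where "C > 0" "\<forall>n. infdist (spower y n) (vanishing_ideal V) \<le> C * t ^ Suc n"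
proof -
  define M where "M = vanishing_ideal V"
  have ci: "closed_ideal M" unfolding M_def by (rule closed_ideal_vanishing_ideal[OF V])
  then have sub: "csubspace M" and mult: "\<And>a x. x \<in> M \<Longrightarrow> a * x \<in> M" unfolding closed_ideal_def by auto
  \<comment> \<open>any number between \<open>1/t\<close> and \<open>1/s\<close>\<close>
  define \<rho> where "\<rho> = 2 / (s + t)"
  have rho: "\<rho> > 0" "1 / t < \<rho>" "\<rho> * s < 1" using st by (auto simp: \<rho>_def field_simps)
  have "\<exists>v. v - z *\<^sub>C y - z *\<^sub>C (y * v) \<in> M" if z: "cmod z \<le> \<rho>" for z
  proof (cases "z = 0")
    case True
    then show ?thesis using complex_vector.subspace_0[OF sub] by (intro exI[of _ 0]) simp
  next
    case False
    define D where "D x = x - x * (z *\<^sub>C y)" for x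
    have D: "bounded_clinear D"
      unfolding D_def by (intro bounded_clinear_minus bounded_clinear_ident bounded_clinear_mult_right)
    have Dmult: "a * D x = D (a * x)" for a x by (simp add: D_def right_diff_distrib mult.assoc)
    let ?J = "{x + m | x m. x \<in> range D \<and> m \<in> M}"
    have J: "left_ideal ?J"
      by (rule left_ideal_sum[OF csubspace_range[OF D] _ sub mult]) (auto simp: Dmult)
    have DJ: "D x \<in> ?J" for x
    proof -
      have "D x + 0 \<in> ?J" using complex_vector.subspace_0[OF sub] by blast
      then show ?thesis by simp
    qed
    have DJ': "x - x * (z *\<^sub>C y) \<in> ?J" for x
    proof -
      have "x - x * (z *\<^sub>C y) = D x" by (simp add: D_def)
      then show ?thesis using DJ[of x] by (simp only:)
    qed
    have MJ: "m \<in> ?J" if "m \<in> M" for m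
    proof -
      have "D 0 + m \<in> ?J" using that by blast
      then show ?thesis by (simp add: bounded_clinear_0[OF D])
    qed
    have "?J = UNIV"
    proof (rule ccontr)
      assume "?J \<noteq> UNIV"
      then obtain L where L: "maximal_modular_left_ideal L" "?J \<subseteq> L"
        by (rule maximal_modular_left_ideal_exists[OF J DJ'])
      obtain \<psi> where psi: "\<psi> \<in> characters" "kernel \<psi> = L"
        by (rule character_of_maximal_modular_ideal[OF comm L(1)])
      have zero: "\<psi> a = 0" if "a \<in> ?J" for a using that L(2) psi(2) by auto
      have "cmod (\<psi> y) \<le> s" by (rule hull[OF psi(1)]) (use zero MJ in \<open>simp add: M_def\<close>)
      obtain a where a: "\<psi> a \<noteq> 0" using psi(1) unfolding characters_def by blast
      have "\<psi> (D a) = 0" by (rule zero[OF DJ])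
      then have "z * \<psi> y = 1"
        using a by (simp add: D_def charactersD[OF psi(1)] field_simps)
      then have "1 = cmod z * cmod (\<psi> y)" by (metis norm_mult norm_one)
      also have "\<dots> \<le> \<rho> * s" using z \<open>cmod (\<psi> y) \<le> s\<close> rho(1) by (intro mult_mono) auto
      finally show False using rho(3) by simp
    qed
    then have "z *\<^sub>C y \<in> ?J" by simp
    then obtain v m where v: "z *\<^sub>C y = D v + m" "m \<in> M" by blast
    have "v - z *\<^sub>C y - z *\<^sub>C (y * v) = - m"
      using v(1) comm unfolding commutative_def by (simp add: D_def mult_scaleC_right)
    then show ?thesis using complex_vector.subspace_neg[OF sub v(2)] by metis
  qed
  then have "(\<lambda>n. (1 / t) ^ Suc n * infdist (spower y n) M) \<longlonglongrightarrow> 0"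
    using st by (intro quasi_invertible_powers_tendsto_0[OF comm ci rho(1) _ _ rho(2)]) auto
  then have "Bseq (\<lambda>n. (1 / t) ^ Suc n * infdist (spower y n) M)"
    by (intro convergent_imp_Bseq convergentI)
  then obtain C where C: "C > 0" "\<forall>n. norm ((1 / t) ^ Suc n * infdist (spower y n) M) \<le> C"
    unfolding Bseq_def by blast
  have "infdist (spower y n) M \<le> C * t ^ Suc n" for n
  proof -
    have "infdist (spower y n) M / t ^ Suc n \<le> C"
      using C(2)[rule_format, of n] st infdist_nonneg[of "spower y n" M]
      by (simp add: power_divide abs_mult del: power_Suc)
    then show ?thesis using st by (simp add: field_simps)
  qed
  then show ?thesis using C(1) unfolding M_def by (intro that[of C]) auto
qed

lemma continuous_on_evaluation: "continuous_on A (\<lambda>\<phi>. \<phi> (a :: 'a) :: complex)"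
  by (rule continuous_on_subset[OF continuous_on_product_coordinates]) simp

text \<open>By regularity the characters that annihilate all elements vanishing on \<open>V\<close> lie in the closure of \<open>V\<close>,
  where a continuous bound persists.\<close>

lemma regular_hull_bound:
  fixes y :: "'a::complex_banach_algebra"
  assumes reg: "regular_algebra TYPE('a)" and V: "\<And>\<phi>. \<phi> \<in> V \<Longrightarrow> \<phi> \<in> characters \<and> cmod (\<phi> y) \<le> s"
    and psi: "\<psi> \<in> characters" "\<And>a. a \<in> vanishing_ideal V \<Longrightarrow> \<psi> a = 0"
  shows "cmod (\<psi> y) \<le> s"
proof (rule ccontr)
  assume contra: "\<not> ?thesis"
  define E where "E = characters \<inter> {\<phi>. cmod (\<phi> y) \<le> s}"
  have "closed {\<phi> :: 'a \<Rightarrow> complex. cmod (\<phi> y) \<le> s}"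
    by (intro closed_Collect_le continuous_on_norm continuous_on_evaluation continuous_on_const)
  then have "closedin gelfand_topology E"
    unfolding E_def gelfand_topology_def by (rule closedin_closed_Int)
  moreover have "\<psi> \<in> characters - E" using psi(1) contra by (simp add: E_def)
  ultimately obtain a where a: "\<forall>\<phi>\<in>E. gelfand_transform a \<phi> = 0" "gelfand_transform a \<psi> \<noteq> 0"
    using reg unfolding regular_algebra_def by meson
  have "a \<in> vanishing_ideal V"
    using a(1) V unfolding vanishing_ideal_def E_def gelfand_transform_def by simp
  then show False using psi(2) a(2) unfolding gelfand_transform_def by simp
qed

lemma near_infdist:
  assumes "M \<noteq> {}" "infdist x M < r"
  obtains m where "m \<in> M" "dist x m < r"
proof (rule ccontr)
  assume contra: "\<not> thesis"
  have "r \<le> dist x m" if "m \<in> M" for m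
    using contra \<open>\<And>m. m \<in> M \<Longrightarrow> dist x m < r \<Longrightarrow> thesis\<close>[OF that] by (meson not_less)
  then have "r \<le> infdist x M" by (rule le_infdistI[OF assms(1)])
  then show False using assms(2) by simp
qed

text \<open>The coefficients of \<open>(1 - 4 \<tau>)\<^bsup>-1/2\<^esup>\<close>, that is, the central binomial coefficients, in the form in which
  the binomial series produces them.\<close>

definition idempotent_coeff :: "nat \<Rightarrow> complex" where
  "idempotent_coeff k = ((- 1 / 2) gchoose k) * (- 4) ^ k"

lemma idempotent_series:
  assumes "cmod (\<zeta> - 1) < 1 / 5"
  shows "(\<lambda>k. idempotent_coeff k * (\<zeta> - \<zeta> * \<zeta>) ^ k) sums (1 / (2 * \<zeta> - 1))"
proof -
  define \<tau> where "\<tau> = \<zeta> - \<zeta> * \<zeta>"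
  have "cmod \<zeta> \<le> cmod (\<zeta> - 1) + 1" using norm_triangle_ineq[of "\<zeta> - 1" 1] by simp
  then have z: "cmod \<zeta> \<le> 6 / 5" using assms by simp
  have "cmod \<tau> = cmod \<zeta> * cmod (\<zeta> - 1)"
    unfolding \<tau>_def by (simp add: norm_minus_commute[of \<zeta> 1] right_diff_distrib flip: norm_mult)
  also have "\<dots> \<le> (6 / 5) * (1 / 5)" using z assms by (intro mult_mono) auto
  finally have tau: "cmod (- 4 * \<tau>) < 1" by (simp add: norm_mult)
  have "\<bar>Re (\<zeta> - 1)\<bar> < 1 / 5" using abs_Re_le_cmod[of "\<zeta> - 1"] assms by linarith
  then have "- (1 / 5) < Re (\<zeta> - 1)" by linarith
  then have Re: "0 < Re (2 * \<zeta> - 1)" by simp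
  have "1 + - 4 * \<tau> = (2 * \<zeta> - 1)\<^sup>2" by (simp add: \<tau>_def power2_eq_square algebra_simps)
  then have "csqrt (1 + - 4 * \<tau>) = 2 * \<zeta> - 1" using Re by (intro csqrt_unique) auto
  then have "(1 + - 4 * \<tau>) powr (1 / 2) = 2 * \<zeta> - 1" by (simp add: csqrt_conv_powr)
  then have "(1 + - 4 * \<tau>) powr (- 1 / 2) = 1 / (2 * \<zeta> - 1)"
    using powr_minus[of "1 + - 4 * \<tau>" "1 / 2"] by (simp add: inverse_eq_divide)
  moreover have "idempotent_coeff k * \<tau> ^ k = ((- 1 / 2) gchoose k) * (- 4 * \<tau>) ^ k" for k
    by (simp only: idempotent_coeff_def power_mult_distrib mult.assoc)
  ultimately show ?thesis
    using gen_binomial_complex[OF tau, of "- 1 / 2"] unfolding \<tau>_def[symmetric] by (simp only:)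
qed

lemma summable_idempotent_coeff: "summable (\<lambda>k. cmod (idempotent_coeff k) * (49 / 200) ^ k)"
proof -
  have "(- 1 / 2 :: complex) \<notin> \<nat>"
  proof
    assume "(- 1 / 2 :: complex) \<in> \<nat>"
    then obtain n where "(- 1 / 2 :: complex) = of_nat n" by (rule Nats_cases)
    then have "Re (- 1 / 2) = real n" by (metis complex_Re_of_nat)
    then show False by simp
  qed
  then have "conv_radius (\<lambda>n. (- 1 / 2 :: complex) gchoose n) = 1" by (simp add: conv_radius_gchoose)
  then have "summable (\<lambda>n. norm (((- 1 / 2 :: complex) gchoose n) * (of_real (49 / 50)) ^ n))"
    by (intro abs_summable_in_conv_radius) simp
  moreover have "norm (((- 1 / 2 :: complex) gchoose n) * (of_real (49 / 50)) ^ n)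
      = cmod (idempotent_coeff n) * (49 / 200) ^ n" for n
  proof -
    have "(49 / 50 :: real) = 4 * (49 / 200)" by simp
    then have "(49 / 50 :: real) ^ n = 4 ^ n * (49 / 200) ^ n" by (metis power_mult_distrib)
    then show ?thesis by (simp add: idempotent_coeff_def norm_mult norm_power norm_divide)
  qed
  ultimately show ?thesis by simp
qed

text \<open>Where \<open>\<psi> g\<close> is close to \<open>1\<close>, the element \<open>y = g - g\<^sup>2\<close> is so small that the series for
  \<open>1/2 + (g - 1/2) (1 - 4 y)\<^bsup>-1/2\<^esup>\<close>, the idempotent near \<open>g\<close>, converges modulo the elements
  vanishing there. As it has no constant term, its sum makes sense in \<open>A\<close> and belongs to every ideal containing \<open>g\<close>.\<close>

lemma local_unit_near_point:
  fixes g :: "'a::complex_banach_algebra"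
  assumes comm: "commutative TYPE('a)" and reg: "regular_algebra TYPE('a)"
    and I: "csubspace I" "\<And>a x. x \<in> I \<Longrightarrow> a * x \<in> I" and g: "g \<in> I"
  obtains e where "e \<in> I" "\<forall>\<psi>\<in>characters. cmod (\<psi> g - 1) < 1 / 5 \<longrightarrow> \<psi> e = 1"
proof -
  have comm': "x * y = y * x" for x y :: 'a using comm unfolding commutative_def by blast
  define V where "V = {\<psi> \<in> (characters :: ('a \<Rightarrow> complex) set). cmod (\<psi> g - 1) < 1 / 5}"
  define y where "y = g - g * g"
  define M where "M = vanishing_ideal V"
  have V: "V \<subseteq> characters" by (auto simp: V_def)
  have ci: "closed_ideal M" unfolding M_def by (rule closed_ideal_vanishing_ideal[OF V])
  have ne: "M \<noteq> {}" using ci complex_vector.subspace_0 unfolding closed_ideal_def by blast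
  have "\<psi> \<in> characters \<and> cmod (\<psi> y) \<le> 6 / 25" if "\<psi> \<in> V" for \<psi>
  proof -
    have psi: "\<psi> \<in> characters" "cmod (\<psi> g - 1) < 1 / 5" using that by (auto simp: V_def)
    have "cmod (\<psi> g) \<le> cmod (\<psi> g - 1) + 1" using norm_triangle_ineq[of "\<psi> g - 1" 1] by simp
    then have z: "cmod (\<psi> g) \<le> 6 / 5" using psi(2) by simp
    have "\<psi> y = - (\<psi> g * (\<psi> g - 1))"
      by (simp add: y_def charactersD[OF psi(1)] right_diff_distrib)
    then have "cmod (\<psi> y) = cmod (\<psi> g) * cmod (\<psi> g - 1)" by (simp add: norm_mult)
    also have "\<dots> \<le> (6 / 5) * (1 / 5)" using z psi(2) by (intro mult_mono) auto
    finally show ?thesis using psi(1) by simp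
  qed
  note small = this
  \<comment> \<open>On \<open>V\<close> the transform of \<open>y\<close> is at most \<open>6/5 * 1/5 = 6/25\<close>. The number \<open>49/200\<close> lies between \<open>6/25\<close> and
    the radius of convergence \<open>1/4\<close> of the series.\<close>
  obtain C where C: "C > 0" "\<forall>n. infdist (spower y n) (vanishing_ideal V) \<le> C * (49 / 200) ^ Suc n"
    by (rule spower_decay_modulo_vanishing_ideal[OF comm V, where s = "6 / 25" and t = "49 / 200"])
      (use regular_hull_bound[OF reg small] in auto)
  have "\<exists>m. m \<in> M \<and> dist (spower y n) m < (C + 1) * (49 / 200) ^ Suc n" for n
  proof -
    have "C * (49 / 200) ^ Suc n < (C + 1) * (49 / 200) ^ Suc n"
      by (intro mult_strict_right_mono) auto
    then have "infdist (spower y n) M < (C + 1) * (49 / 200) ^ Suc n"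
      using C(2)[rule_format, of n] unfolding M_def by linarith
    then show ?thesis using near_infdist[OF ne] by metis
  qed
  then obtain m where m: "\<And>n. m n \<in> M" "\<And>n. dist (spower y n) (m n) < (C + 1) * (49 / 200) ^ Suc n"
    by metis
  \<comment> \<open>The powers of \<open>y\<close> are corrected by elements of \<open>M\<close>, so that the series converges in norm and its sum
    has the intended values on \<open>V\<close>. The terms of order \<open>0\<close> and \<open>1\<close> are split off: the remaining ones are
    multiples of \<open>y\<close>, which keeps \<open>e\<close> in the ideal.\<close>
  define f where "f j = idempotent_coeff (j + 2) *\<^sub>C (spower y j - m j)" for j
  have "summable (\<lambda>k. (C + 1) * (200 / 49) * (cmod (idempotent_coeff (k + 2)) * (49 / 200) ^ (k + 2)))"
    by (intro summable_mult summable_ignore_initial_segment summable_idempotent_coeff)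
  then have sf: "summable f"
  proof (rule summable_comparison_test'[of _ 0])
    fix n
    have "norm (f n) = cmod (idempotent_coeff (n + 2)) * dist (spower y n) (m n)"
      by (simp add: f_def norm_scaleC dist_norm)
    also have "\<dots> \<le> cmod (idempotent_coeff (n + 2)) * ((C + 1) * (49 / 200) ^ Suc n)"
      by (intro mult_left_mono less_imp_le[OF m(2)]) simp
    also have "\<dots> = (C + 1) * (200 / 49) * (cmod (idempotent_coeff (n + 2)) * (49 / 200) ^ (n + 2))"
      by simp
    finally show "norm (f n) \<le> (C + 1) * (200 / 49) * (cmod (idempotent_coeff (n + 2)) * (49 / 200) ^ (n + 2))" .
  qed
  define w where "w = (\<Sum>j. f j)"
  define h where "h = 2 *\<^sub>C y + y * w"
  define e where "e = g + g * h - (1 / 2) *\<^sub>C h"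
  have yI: "y \<in> I" unfolding y_def by (intro complex_vector.subspace_diff I g)
  have "h \<in> I" unfolding h_def comm'[of y w]
    by (intro complex_vector.subspace_add complex_vector.subspace_scale I yI)
  then have eI: "e \<in> I" unfolding e_def
    by (intro complex_vector.subspace_add complex_vector.subspace_diff complex_vector.subspace_scale I g)
  have "\<psi> e = 1" if psi: "\<psi> \<in> characters" "cmod (\<psi> g - 1) < 1 / 5" for \<psi>
  proof -
    note ch = charactersD[OF psi(1)]
    define \<zeta> where "\<zeta> = \<psi> g"
    define \<tau> where "\<tau> = \<zeta> - \<zeta> * \<zeta>"
    have tau: "\<psi> y = \<tau>" by (simp add: y_def \<tau>_def \<zeta>_def ch)
    have "\<psi> \<in> V" using psi by (simp add: V_def)
    then have m0: "\<psi> (m j) = 0" for j using m(1)[of j] by (simp add: M_def vanishing_ideal_def)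
    have "(\<lambda>j. \<psi> (f j)) sums \<psi> w"
      unfolding w_def by (rule bounded_linear.sums[OF bounded_clinear_bounded_linear[OF ch(1)] summable_sums[OF sf]])
    moreover have "\<psi> (f j) = idempotent_coeff (j + 2) * \<tau> ^ Suc j" for j
      by (simp add: f_def ch m0 character_spower[OF psi(1)] tau)
    ultimately have "(\<lambda>j. \<tau> * (idempotent_coeff (j + 2) * \<tau> ^ Suc j)) sums (\<tau> * \<psi> w)"
      by (intro sums_mult) simp
    then have 1: "(\<lambda>j. idempotent_coeff (j + 2) * \<tau> ^ (j + 2)) sums (\<tau> * \<psi> w)"
      by (simp add: mult_ac)
    have 2: "(\<lambda>k. idempotent_coeff k * \<tau> ^ k) sums (1 / (2 * \<zeta> - 1))"
      unfolding \<tau>_def by (rule idempotent_series) (use psi(2) in \<open>simp add: \<zeta>_def\<close>)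
    have "(\<Sum>k<2. idempotent_coeff k * \<tau> ^ k) = 1 + 2 * \<tau>"
      by (simp add: idempotent_coeff_def numeral_2_eq_2)
    with sums_split_initial_segment[OF 2, of 2]
    have "(\<lambda>j. idempotent_coeff (j + 2) * \<tau> ^ (j + 2)) sums (1 / (2 * \<zeta> - 1) - (1 + 2 * \<tau>))" by simp
    with 1 have eq: "\<tau> * \<psi> w = 1 / (2 * \<zeta> - 1) - (1 + 2 * \<tau>)" by (rule sums_unique2)
    have nz: "2 * \<zeta> - 1 \<noteq> 0"
    proof
      assume "2 * \<zeta> - 1 = 0"
      then have half: "\<psi> g = 1 / 2" by (simp add: \<zeta>_def field_simps)
      have "cmod (1 / 2 - 1) < 1 / 5" using psi(2) unfolding half .
      moreover have "(1 / 2 - 1 :: complex) = - (1 / 2)" by simp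
      ultimately show False by (simp add: norm_divide)
    qed
    have h: "\<psi> h = 1 / (2 * \<zeta> - 1) - 1" by (simp add: h_def ch tau eq)
    have "\<psi> e = \<zeta> + (\<zeta> - 1 / 2) * \<psi> h"
      by (simp add: e_def ch left_diff_distrib flip: \<zeta>_def)
    also have "(\<zeta> - 1 / 2) * \<psi> h = 1 / 2 * ((2 * \<zeta> - 1) * (1 / (2 * \<zeta> - 1))) - (\<zeta> - 1 / 2)"
      unfolding h by (simp add: algebra_simps)
    also have "(2 * \<zeta> - 1) * (1 / (2 * \<zeta> - 1)) = 1" using nz by simp
    finally show ?thesis by simp
  qed
  then show ?thesis using eI by (intro that[of e]) auto
qed

text \<open>Units for finitely many neighbourhoods covering \<open>K\<close> are combined by \<open>e + d - e d\<close>, which takes the value \<open>1\<close>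
  wherever \<open>e\<close> or \<open>d\<close> does.\<close>

lemma local_unit:
  assumes comm: "commutative TYPE('a::complex_banach_algebra)" and reg: "regular_algebra TYPE('a)"
    and I: "csubspace I" "\<And>a x. x \<in> I \<Longrightarrow> (a :: 'a) * x \<in> I"
    and K: "compactin gelfand_topology K" and nz: "\<And>\<phi>. \<phi> \<in> K \<Longrightarrow> \<exists>a\<in>I. \<phi> a \<noteq> 0"
  obtains e where "e \<in> I" "\<forall>\<psi>\<in>K. \<psi> e = 1"
proof -
  have Kch: "K \<subseteq> characters" using compactin_subset_topspace[OF K] by (simp add: gelfand_topology_def)
  have "\<exists>g\<in>I. \<phi> g = 1" if phi: "\<phi> \<in> K" for \<phi>
  proof -
    obtain a where a: "a \<in> I" "\<phi> a \<noteq> 0" using nz[OF phi] by blast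
    have "\<phi> (inverse (\<phi> a) *\<^sub>C a) = 1" using a(2) charactersD(5) Kch phi by (metis left_inverse subsetD)
    then show ?thesis using complex_vector.subspace_scale[OF I(1) a(1)] by blast
  qed
  then obtain g where g: "\<And>\<phi>. \<phi> \<in> K \<Longrightarrow> g \<phi> \<in> I" "\<And>\<phi>. \<phi> \<in> K \<Longrightarrow> \<phi> (g \<phi>) = 1" by metis
  define W where "W \<phi> = characters \<inter> {\<psi>. cmod (\<psi> (g \<phi>) - 1) < 1 / 5}" for \<phi>
  have "open {\<psi> :: 'a \<Rightarrow> complex. cmod (\<psi> (g \<phi>) - 1) < 1 / 5}" for \<phi>
    by (intro open_Collect_less continuous_on_norm continuous_on_diff continuous_on_evaluation continuous_on_const)
  then have oW: "openin gelfand_topology (W \<phi>)" for \<phi>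
    unfolding W_def gelfand_topology_def by (rule openin_open_Int)
  have "\<phi> \<in> W \<phi>" if "\<phi> \<in> K" for \<phi> using g(2)[OF that] subsetD[OF Kch that] by (simp add: W_def)
  then have "K \<subseteq> \<Union> (W ` K)" by (intro subsetI UN_I)
  then obtain \<F> where F: "finite \<F>" "\<F> \<subseteq> W ` K" "K \<subseteq> \<Union> \<F>"
    using K oW unfolding compactin_def by (metis (no_types, lifting) image_iff)
  then obtain G where G: "finite G" "G \<subseteq> K" "\<F> = W ` G" using finite_subset_image by metis
  have "\<exists>e\<in>I. \<forall>\<psi>\<in>\<Union> (W ` G). \<psi> e = 1"
    using G(1,2)
  proof (induction G rule: finite_induct)
    case empty
    then show ?case using complex_vector.subspace_0[OF I(1)] by auto
  next
    case (insert \<phi> G)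
    then obtain e where e: "e \<in> I" "\<forall>\<psi>\<in>\<Union> (W ` G). \<psi> e = 1" by auto
    obtain d where d: "d \<in> I" "\<forall>\<psi>\<in>characters. cmod (\<psi> (g \<phi>) - 1) < 1 / 5 \<longrightarrow> \<psi> d = 1"
      by (rule local_unit_near_point[OF comm reg I g(1)]) (use insert.prems in auto)
    have "e + d - e * d \<in> I"
      by (intro complex_vector.subspace_diff complex_vector.subspace_add I e(1) d(1))
    moreover have "\<psi> (e + d - e * d) = 1" if psi: "\<psi> \<in> \<Union> (W ` insert \<phi> G)" for \<psi>
    proof -
      have "\<psi> \<in> characters" using psi by (auto simp: W_def)
      moreover have "\<psi> e = 1 \<or> \<psi> d = 1" using psi e(2) d(2) by (auto simp: W_def)
      ultimately show ?thesis by (auto simp: charactersD)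
    qed
    ultimately show ?case by blast
  qed
  then show ?thesis using that F(3) G(3) by blast
qed

section \<open>Multipliers of semisimple Banach algebras\<close>

text \<open>If \<open>x\<close> were outside a maximal modular left ideal \<open>L\<close>, then \<open>A x + L\<close> would contain a modular unit
  \<open>u\<close>, and \<open>x u\<close> would be in \<open>L\<close> because of \<open>x A x = 0\<close>.\<close>

lemma semisimple_imp_semiprime:
  fixes x :: "'a::complex_banach_algebra"
  assumes ss: "semisimple TYPE('a)" and xax: "\<And>a. x * a * x = 0"
  shows "x = 0"
proof -
  have "x \<in> L" if L: "maximal_modular_left_ideal L" for L :: "'a set"
  proof (rule ccontr)
    assume xL: "x \<notin> L"
    note id = maximal_modular_left_idealD(1,2)[OF L] and sub = maximal_modular_left_idealD(3)[OF L]
      and mult = maximal_modular_left_idealD(4)[OF L] and max = maximal_modular_left_idealD(5)[OF L]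
    obtain u where u: "\<And>a. a - a * u \<in> L" using maximal_modular_left_idealD(6)[OF L] by auto
    show False
    proof (cases "\<forall>a. a * x \<in> L")
      case True
      let ?M = "{y. \<forall>a. a * y \<in> L}"
      have "left_ideal ?M"
        unfolding left_ideal_def
      proof (intro conjI allI ballI complex_vector.subspaceI)
        show "0 \<in> ?M" by (simp add: complex_vector.subspace_0[OF sub])
        show "y + z \<in> ?M" if "y \<in> ?M" "z \<in> ?M" for y z
          using that by (simp add: distrib_left complex_vector.subspace_add[OF sub])
        show "c *\<^sub>C y \<in> ?M" if "y \<in> ?M" for c y
          using that by (simp add: mult_scaleC_right complex_vector.subspace_scale[OF sub])
        show "a * y \<in> ?M" if "y \<in> ?M" for a y using that by (simp flip: mult.assoc)
      qed
      moreover have "L \<subseteq> ?M" using mult by auto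
      moreover have "?M \<noteq> L" using True xL by auto
      ultimately have "?M = UNIV" using max by blast
      then have "a * u \<in> L" for a by auto
      then have "(a - a * u) + a * u \<in> L" for a by (intro complex_vector.subspace_add[OF sub] u)
      then show False using id(2) by auto
    next
      case False
      then obtain a0 where "a0 * x \<notin> L" by auto
      then obtain a m where am: "u = a * x + m" "m \<in> L" by (rule maximal_left_ideal_plus_principal[OF L])
      have "x * u = x * m" using xax[of a] by (simp add: am(1) distrib_left mult.assoc)
      then have "x * u \<in> L" using mult[OF am(2)] by simp
      then have "(x - x * u) + x * u \<in> L" by (intro complex_vector.subspace_add[OF sub] u)
      then show False using xL by simp
    qed
  qed
  then have "x \<in> (jacobson_radical :: 'a set)" unfolding jacobson_radical_def by (intro InterI) simp
  also have "(jacobson_radical :: 'a set) = {0}" using ss unfolding semisimple_def .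
  finally show ?thesis by (rule singletonD)
qed

lemma multiplier_bounded_clinear: "multiplier S \<Longrightarrow> bounded_clinear S"
  by (simp add: multiplier_def)

text \<open>For \<open>x = S (a b) - (S a) b\<close> one has \<open>c x = 0\<close> for all \<open>c\<close>, since \<open>c S (a b) = (S c) a b = c (S a) b\<close>.\<close>

lemma multiplier_mult_left:
  fixes S :: "'a::complex_banach_algebra \<Rightarrow> 'a"
  assumes ss: "semisimple TYPE('a)" and S: "multiplier S"
  shows "S (a * b) = S a * b"
proof -
  have m: "c * S d = S c * d" for c d using S unfolding multiplier_def by auto
  define x where "x = S (a * b) - S a * b"
  have cx: "c * x = 0" for c
    using m[of c "a * b"] m[of c a] by (simp add: x_def right_diff_distrib flip: mult.assoc)
  have "x * c * x = 0" for c by (simp add: cx)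
  then have "x = 0" by (rule semisimple_imp_semiprime[OF ss])
  then show ?thesis by (simp add: x_def)
qed

lemma multiplier_mult_right:
  fixes S :: "'a::complex_banach_algebra \<Rightarrow> 'a"
  assumes ss: "semisimple TYPE('a)" and S: "multiplier S"
  shows "S (a * b) = a * S b"
  using multiplier_mult_left[OF ss S] S unfolding multiplier_def by metis

lemma multiplier_shift: "multiplier S \<Longrightarrow> multiplier (shift S \<mu>)"
  using bounded_clinear_shift[of S \<mu>]
  by (auto simp: multiplier_def shift_def algebra_simps mult_scaleC_left mult_scaleC_right)

lemma multiplier_plus: "multiplier S \<Longrightarrow> multiplier R \<Longrightarrow> multiplier (\<lambda>x. S x + R x)"
  by (auto simp: multiplier_def algebra_simps intro: bounded_clinear_plus)

text \<open>If \<open>x\<close> is the limit of \<open>S a\<^sub>n\<close>, then \<open>x b x\<close> is the limit of \<open>(S a\<^sub>n) b x = a\<^sub>n b (S x) = 0\<close>.\<close>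

lemma multiplier_kernel_closure_range:
  fixes S :: "'a::complex_banach_algebra \<Rightarrow> 'a"
  assumes ss: "semisimple TYPE('a)" and S: "multiplier S" and x: "S x = 0" "x \<in> closure (range S)"
  shows "x = 0"
proof (rule semisimple_imp_semiprime[OF ss])
  fix b
  obtain f where f: "\<forall>n. f n \<in> range S" "f \<longlonglongrightarrow> x" using x(2) unfolding closure_sequential by auto
  have zero: "S a * b * x = 0" for a
  proof -
    have "S a * b * x = S (a * b * x)" by (simp only: multiplier_mult_left[OF ss S])
    also have "\<dots> = a * b * S x" by (rule multiplier_mult_right[OF ss S])
    finally show ?thesis by (simp add: x(1))
  qed
  have "f n * b * x = 0" for n
  proof -
    obtain a where "f n = S a" using f(1) by auto
    then show ?thesis using zero by simp
  qed
  moreover have "(\<lambda>n. f n * b * x) \<longlonglongrightarrow> x * b * x" by (intro tendsto_mult f(2) tendsto_const)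
  ultimately show "x * b * x = 0" by (simp add: LIMSEQ_const_iff)
qed

lemma multiplier_kernel_funpow:
  fixes S :: "'a::complex_banach_algebra \<Rightarrow> 'a"
  assumes ss: "semisimple TYPE('a)" and S: "multiplier S"
  shows "(S ^^ Suc n) x = 0 \<longleftrightarrow> S x = 0"
proof (induction n)
  case (Suc n)
  have "S y = 0" if "S (S y) = 0" for y
    by (rule multiplier_kernel_closure_range[OF ss S that]) (rule subsetD[OF closure_subset], simp)
  then have "(S ^^ Suc (Suc n)) x = 0 \<longleftrightarrow> (S ^^ Suc n) x = 0"
    using bounded_clinear_0[OF multiplier_bounded_clinear[OF S]] by auto
  then show ?case using Suc by simp
qed simp

text \<open>An analytic family of eigenvectors of \<open>T\<close> at \<open>z\<close> lies in the kernel of \<open>T - z\<close>, and also in the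
  closure of its range, since the neighbouring eigenvectors are in the range.\<close>

lemma multiplier_SVEP:
  fixes T :: "'a::complex_banach_algebra \<Rightarrow> 'a"
  assumes ss: "semisimple TYPE('a)" and T: "multiplier T"
  shows "SVEP T"
  unfolding SVEP_def SVEP_at_def
proof (intro allI impI ballI)
  fix z0 U f z
  assume H: "open U \<and> z0 \<in> U \<and> analytic_into f U \<and> (\<forall>\<mu>\<in>U. shift T \<mu> (f \<mu>) = 0)" and z: "z \<in> U"
  have S: "multiplier (shift T z)" by (rule multiplier_shift[OF T])
  show "f z = 0"
  proof (rule multiplier_kernel_closure_range[OF ss S])
    show "shift T z (f z) = 0" using H z by simp
    obtain D where "(f has_derivative (\<lambda>h. h *\<^sub>C D)) (at z)" using H z unfolding analytic_into_def by auto
    then have cont: "(f \<longlongrightarrow> f z) (at z)" using has_derivative_continuous isContD by blast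
    have "eventually (\<lambda>w. w \<in> U) (at z)" using H z eventually_at_in_open' by blast
    moreover have "eventually (\<lambda>w. w \<noteq> z) (at z)" by (simp add: eventually_at_filter)
    ultimately have "eventually (\<lambda>w. f w \<in> closure (range (shift T z))) (at z)"
    proof eventually_elim
      case (elim w)
      have "shift T z (f w) = (w - z) *\<^sub>C f w"
        using H elim(1) by (auto simp: shift_def complex_vector.scale_left_diff_distrib)
      then have "shift T z (inverse (w - z) *\<^sub>C f w) = f w"
        using elim(2) bounded_clinear_scaleC[OF multiplier_bounded_clinear[OF S]]
        by (simp add: scaleC_scaleC scaleC_one)
      then have "f w \<in> range (shift T z)" by (metis rangeI)
      then show ?case by (rule subsetD[OF closure_subset])
    qed
    then show "f z \<in> closure (range (shift T z))"
      by (rule Lim_in_closed_set[OF closed_closure _ _ cont]) simp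
  qed
qed

lemma multiplier_ascent_nullity:
  fixes S :: "'a::complex_banach_algebra \<Rightarrow> 'a"
  assumes ss: "semisimple TYPE('a)" and S: "multiplier S"
  shows "ascent S \<le> 1" "nullity S \<le> deficiency S"
proof -
  have bS: "bounded_clinear S" by (rule multiplier_bounded_clinear[OF S])
  show "ascent S \<le> 1"
    using multiplier_kernel_funpow[OF ss S, of 1] by (intro ascent_le_1 bS) simp
  have "x = 0" if "S x = 0" "x \<in> range S" for x
    by (rule multiplier_kernel_closure_range[OF ss S that(1) subsetD[OF closure_subset that(2)]])
  then have "kernel S \<inter> range S = {0}"
    using complex_vector.subspace_0[OF csubspace_range[OF bS]] bounded_clinear_0[OF bS] by auto
  then show "nullity S \<le> deficiency S" by (rule nullity_le_deficiency[OF bS])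
qed

subsection \<open>Multipliers that are bounded below\<close>

text \<open>Hence \<open>\<phi> (S b) / \<phi> b\<close> does not depend on \<open>b\<close>; as a function of \<open>\<phi>\<close> it is called the symbol of \<open>S\<close>. Keeping
  the denominators multiplied out avoids choosing \<open>b\<close> for each \<open>\<phi>\<close>.\<close>

lemma character_multiplier_cross:
  fixes S :: "'a::complex_banach_algebra \<Rightarrow> 'a"
  assumes ss: "semisimple TYPE('a)" and S: "multiplier S" and \<phi>: "\<phi> \<in> characters"
  shows "\<phi> (S a) * \<phi> b = \<phi> a * \<phi> (S b)"
  using S charactersD(2)[OF \<phi>] unfolding multiplier_def by metis

lemma norm_character_le:
  assumes phi: "\<phi> \<in> characters" shows "cmod (\<phi> a) \<le> norm a"
proof (rule ccontr)
  assume "\<not> ?thesis"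
  then have gt: "norm a < cmod (\<phi> a)" by simp
  obtain K where K: "K > 0" "\<And>x. norm (\<phi> x) \<le> K * norm x"
    using bounded_clinear_bound[OF charactersD(1)[OF phi]] by metis
  have le: "cmod (\<phi> a) ^ Suc n \<le> K * norm a ^ Suc n" for n
  proof -
    have "cmod (\<phi> a) ^ Suc n = cmod (\<phi> (spower a n))" by (simp add: character_spower[OF phi] norm_mult norm_power)
    also have "\<dots> \<le> K * norm (spower a n)" by (rule K(2))
    also have "\<dots> \<le> K * norm a ^ Suc n" using K(1) by (intro mult_left_mono norm_spower_le) simp
    finally show ?thesis .
  qed
  have pos: "norm a > 0" using le[of 0] gt K(1) by (cases "a = 0") auto
  have "1 < cmod (\<phi> a) / norm a" using gt pos by simp
  then obtain n where n: "K < (cmod (\<phi> a) / norm a) ^ n" using real_arch_pow by blast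
  also have "\<dots> \<le> (cmod (\<phi> a) / norm a) ^ Suc n" using gt pos by (intro power_increasing) auto
  also have "\<dots> \<le> K" using le[of n] pos by (simp add: power_divide field_simps del: power_Suc)
  finally show False by simp
qed

lemma spower_multiplier:
  fixes S :: "'a::complex_banach_algebra \<Rightarrow> 'a"
  assumes ss: "semisimple TYPE('a)" and S: "multiplier S"
  shows "spower (S a) n = (S ^^ Suc n) (spower a n)"
proof -
  have right: "(S ^^ k) (a * p) = a * (S ^^ k) p" for k p
    by (induction k) (simp_all add: multiplier_mult_right[OF ss S])
  show ?thesis
    by (induction n) (simp_all add: right multiplier_mult_left[OF ss S] flip: multiplier_mult_right[OF ss S])
qed

text \<open>Where a character annihilates the range of \<open>S\<close>, the symbol of \<open>S\<close> vanishes; by continuity it is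
  small in a neighbourhood, and regularity provides an element whose transform is concentrated there.\<close>

lemma regular_concentrated_element:
  fixes S :: "'a::complex_banach_algebra \<Rightarrow> 'a"
  assumes ss: "semisimple TYPE('a)" and reg: "regular_algebra TYPE('a)" and S: "multiplier S"
    and phi0: "\<phi>0 \<in> characters" "\<And>a. \<phi>0 (S a) = 0" and d: "d > 0"
  obtains a where "\<phi>0 a \<noteq> 0" "\<forall>\<phi>\<in>characters. cmod (\<phi> (S a)) \<le> d * cmod (\<phi> a)"
proof -
  obtain b where b: "\<phi>0 b \<noteq> 0" using phi0(1) unfolding characters_def by auto
  define W where "W = {\<phi> :: 'a \<Rightarrow> complex. cmod (\<phi> (S b)) < d * cmod (\<phi> b)}"
  have "open W" unfolding W_def
    by (intro open_Collect_less continuous_on_norm continuous_on_mult continuous_on_const continuous_on_evaluation)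
  then have "closedin gelfand_topology (characters \<inter> - W)"
    unfolding gelfand_topology_def by (intro closedin_closed_Int) auto
  moreover have "\<phi>0 \<in> characters - (characters \<inter> - W)" using phi0 b d by (simp add: W_def)
  ultimately obtain a where "\<forall>\<psi>\<in>characters \<inter> - W. gelfand_transform a \<psi> = 0" "gelfand_transform a \<phi>0 \<noteq> 0"
    using reg unfolding regular_algebra_def by meson
  then have a: "\<And>\<psi>. \<psi> \<in> characters \<Longrightarrow> \<psi> \<notin> W \<Longrightarrow> \<psi> a = 0" "\<phi>0 a \<noteq> 0"
    unfolding gelfand_transform_def by auto
  have "cmod (\<phi> (S a)) \<le> d * cmod (\<phi> a)" if phi: "\<phi> \<in> characters" for \<phi>
  proof (cases "\<phi> \<in> W")
    case True
    then have *: "cmod (\<phi> (S b)) < d * cmod (\<phi> b)" by (simp add: W_def)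
    then have pos: "cmod (\<phi> b) > 0" using d by (cases "\<phi> b = 0") auto
    have "cmod (\<phi> (S a)) * cmod (\<phi> b) = cmod (\<phi> a) * cmod (\<phi> (S b))"
      using character_multiplier_cross[OF ss S phi, of a b] by (metis norm_mult)
    also have "\<dots> \<le> cmod (\<phi> a) * (d * cmod (\<phi> b))" using * by (intro mult_left_mono) auto
    also have "\<dots> = (d * cmod (\<phi> a)) * cmod (\<phi> b)" by simp
    finally show ?thesis using pos by (simp only: mult_le_cancel_right_pos)
  next
    case False
    obtain e where e: "\<phi> e \<noteq> 0" using phi unfolding characters_def by auto
    have "\<phi> (S a) * \<phi> e = 0" using character_multiplier_cross[OF ss S phi, of a e] a(1)[OF phi False] by simp
    then show ?thesis using e d by simp
  qed
  then show ?thesis using a(2) that by auto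
qed

text \<open>If a character annihilates the range of a multiplier with lower bound \<open>c\<close>, regularity provides an
  element \<open>a\<close> whose transform is concentrated where the symbol of \<open>S\<close> is below \<open>c/2\<close>. Comparing the norms
  of \<open>(S a)^n = S^n (a^n)\<close> and \<open>a^n\<close> by means of the spectral radius formula contradicts the lower
  bound.\<close>

lemma bounded_below_multiplier_nonvanishing:
  fixes S :: "'a::complex_banach_algebra \<Rightarrow> 'a"
  assumes ss: "semisimple TYPE('a)" and comm: "commutative TYPE('a)" and reg: "regular_algebra TYPE('a)"
    and S: "multiplier S" and bb: "bounded_below S" and phi0: "\<phi>0 \<in> characters"
  shows "\<exists>a. \<phi>0 (S a) \<noteq> 0"
proof (rule ccontr)
  assume "\<not> ?thesis"
  then have zero: "\<phi>0 (S a) = 0" for a by simp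
  obtain c where c: "c > 0" "\<And>x. c * norm x \<le> norm (S x)" using bb unfolding bounded_below_def by auto
  have "c / 2 > 0" using c(1) by simp
  then obtain a where a: "\<phi>0 a \<noteq> 0" "\<forall>\<phi>\<in>characters. cmod (\<phi> (S a)) \<le> c / 2 * cmod (\<phi> a)"
    by (rule regular_concentrated_element[OF ss reg S phi0 zero])
  define \<sigma> where "\<sigma> = (SUP \<phi>\<in>(characters :: ('a \<Rightarrow> complex) set). cmod (\<phi> a))"
  have bdd: "bdd_above ((\<lambda>\<phi>. cmod (\<phi> a)) ` characters)"
    by (intro bdd_aboveI2[where M = "norm a"] norm_character_le)
  have le_sup: "cmod (\<phi> a) \<le> \<sigma>" if "\<phi> \<in> characters" for \<phi>
    unfolding \<sigma>_def by (rule cSUP_upper[OF that bdd])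
  have sigma: "\<sigma> > 0" using le_sup[OF phi0] a(1) by (metis less_le_trans zero_less_norm_iff)
  \<comment> \<open>The transform of \<open>S a\<close> is bounded by \<open>c \<sigma> / 2\<close>, so its powers grow at most like \<open>(5/8 c \<sigma>)^n\<close>. Those
    of \<open>a\<close> grow at least like \<open>(3/4 \<sigma>)^n\<close>, hence those of \<open>S a\<close> at least like \<open>(3/4 c \<sigma>)^n\<close>; the quotient of the
    two bases is \<open>6/5\<close>.\<close>
  have "3 / 4 * \<sigma> < \<sigma>" using sigma by simp
  then have "\<exists>\<phi>\<in>characters. 3 / 4 * \<sigma> < cmod (\<phi> a)"
    unfolding \<sigma>_def using phi0 bdd by (subst (asm) less_cSUP_iff) auto
  then obtain \<phi>1 where phi1: "\<phi>1 \<in> characters" "3 / 4 * \<sigma> < cmod (\<phi>1 a)" by auto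
  have van: "vanishing_ideal (characters :: ('a \<Rightarrow> complex) set) = {0}"
    using characters_separate[OF ss comm] by (auto simp: vanishing_ideal_def charactersD(6))
  have "cmod (\<phi> (S a)) \<le> c / 2 * \<sigma>" if "\<phi> \<in> characters" for \<phi>
    using order_trans[OF a(2)[rule_format, OF that] mult_left_mono[OF le_sup[OF that], of "c / 2"]] c(1) by simp
  then obtain C where C: "C > 0" "\<forall>n. infdist (spower (S a) n) (vanishing_ideal characters) \<le> C * (5 / 8 * (c * \<sigma>)) ^ Suc n"
    using spower_decay_modulo_vanishing_ideal[OF comm subset_refl, of "S a" "c / 2 * \<sigma>" "5 / 8 * (c * \<sigma>)"]
      c(1) sigma by auto
  have iter: "c ^ k * norm x \<le> norm ((S ^^ k) x)" for k x
  proof (induction k)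
    case (Suc k)
    have "c ^ Suc k * norm x \<le> c * norm ((S ^^ k) x)" using Suc c(1) by (simp add: mult.assoc)
    also have "\<dots> \<le> norm ((S ^^ Suc k) x)" using c(2) by simp
    finally show ?case .
  qed simp
  have le: "(6 / 5) ^ Suc n \<le> C" for n
  proof -
    have "(3 / 4 * (c * \<sigma>)) ^ Suc n = c ^ Suc n * (3 / 4 * \<sigma>) ^ Suc n"
      by (simp only: power_mult_distrib[symmetric]) (simp add: mult_ac)
    also have "\<dots> \<le> c ^ Suc n * cmod (\<phi>1 a) ^ Suc n"
      using phi1(2) sigma c(1) by (intro mult_left_mono power_mono) auto
    also have "cmod (\<phi>1 a) ^ Suc n = cmod (\<phi>1 (spower a n))"
      by (simp add: character_spower[OF phi1(1)] norm_mult norm_power)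
    also have "c ^ Suc n * \<dots> \<le> c ^ Suc n * norm (spower a n)"
      using c(1) by (intro mult_left_mono norm_character_le[OF phi1(1)]) auto
    also have "\<dots> \<le> norm ((S ^^ Suc n) (spower a n))" by (rule iter)
    also have "\<dots> = norm (spower (S a) n)" by (simp only: spower_multiplier[OF ss S])
    also have "\<dots> \<le> C * (5 / 8 * (c * \<sigma>)) ^ Suc n" using C(2) unfolding van by simp
    finally have "(3 / 4 * (c * \<sigma>)) ^ Suc n \<le> C * (5 / 8 * (c * \<sigma>)) ^ Suc n" .
    moreover have "(3 / 4 * (c * \<sigma>)) = (6 / 5) * (5 / 8 * (c * \<sigma>))" by simp
    ultimately have "(6 / 5) ^ Suc n * (5 / 8 * (c * \<sigma>)) ^ Suc n \<le> C * (5 / 8 * (c * \<sigma>)) ^ Suc n"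
      by (simp only: power_mult_distrib)
    moreover have "(5 / 8 * (c * \<sigma>)) ^ Suc n > 0" using c(1) sigma by (intro zero_less_power) simp
    ultimately show ?thesis by (simp only: mult_le_cancel_right_pos)
  qed
  obtain n where "C < (6 / 5) ^ n" using real_arch_pow[of "6 / 5" C] by auto
  also have "\<dots> \<le> (6 / 5 :: real) ^ Suc n" by (intro power_increasing) auto
  finally show False using le[of n] by simp
qed

lemma in_gelfand_supportI:
  assumes "\<phi> \<in> characters" "\<phi> x \<noteq> 0" shows "\<phi> \<in> gelfand_support x"
proof -
  have "\<phi> \<in> {\<phi> \<in> characters. gelfand_transform x \<phi> \<noteq> 0}" using assms by (simp add: gelfand_transform_def)
  also have "\<dots> \<subseteq> gelfand_support x"
    unfolding gelfand_support_def by (rule closure_of_subset) (auto simp: gelfand_topology_def)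
  finally show ?thesis .
qed

text \<open>A local unit for the support of \<open>x\<close> in the ideal \<open>S A\<close>: it acts on \<open>x\<close> as a unit, since the characters
  separate the points.\<close>

lemma compact_support_local_unit:
  fixes S :: "'a::complex_banach_algebra \<Rightarrow> 'a"
  assumes ss: "semisimple TYPE('a)" and comm: "commutative TYPE('a)" and reg: "regular_algebra TYPE('a)"
    and S: "multiplier S" and nz: "\<And>\<phi>. \<phi> \<in> characters \<Longrightarrow> \<exists>a. \<phi> (S a) \<noteq> 0"
    and K: "compactin gelfand_topology (gelfand_support x)"
  obtains f where "S f * x = x" "\<forall>\<psi>\<in>gelfand_support x. \<psi> (S f) = 1"
proof -
  have Kch: "gelfand_support x \<subseteq> characters"
    using compactin_subset_topspace[OF K] by (simp add: gelfand_topology_def)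
  obtain e where e: "e \<in> range S" "\<forall>\<psi>\<in>gelfand_support x. \<psi> e = 1"
  proof (rule local_unit[OF comm reg csubspace_range[OF multiplier_bounded_clinear[OF S]] _ K])
    show "a * y \<in> range S" if "y \<in> range S" for a y
      using that by (auto simp flip: multiplier_mult_right[OF ss S])
    show "\<exists>a\<in>range S. \<phi> a \<noteq> 0" if "\<phi> \<in> gelfand_support x" for \<phi>
      using nz[of \<phi>] that Kch by auto
  qed
  have "e * x - x = 0"
  proof (rule characters_separate[OF ss comm])
    fix \<phi> :: "'a \<Rightarrow> complex" assume phi: "\<phi> \<in> characters"
    have "\<phi> x = 0 \<or> \<phi> e = 1" using e(2) in_gelfand_supportI[OF phi, of x] by auto
    then show "\<phi> (e * x - x) = 0" by (auto simp: charactersD[OF phi])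
  qed
  moreover obtain f where "e = S f" using e(1) by auto
  ultimately show ?thesis using that e(2) by simp
qed

text \<open>The range is closed and contains every \<open>x\<close> of compact support, as \<open>x = (S f) x = S (f x)\<close> for some \<open>f\<close>.\<close>

lemma bounded_below_multiplier_invertible:
  fixes S :: "'a::complex_banach_algebra \<Rightarrow> 'a"
  assumes ss: "semisimple TYPE('a)" and comm: "commutative TYPE('a)" and reg: "regular_algebra TYPE('a)"
    and taub: "tauberian TYPE('a)" and S: "multiplier S" and bb: "bounded_below S"
  shows "invertible_operator S"
proof -
  have bS: "bounded_clinear S" by (rule multiplier_bounded_clinear[OF S])
  have "x \<in> range S" if x: "compactin gelfand_topology (gelfand_support x)" for x
  proof -
    obtain f where "S f * x = x" "\<forall>\<psi>\<in>gelfand_support x. \<psi> (S f) = 1"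
      by (rule compact_support_local_unit[OF ss comm reg S bounded_below_multiplier_nonvanishing[OF ss comm reg S bb] x])
    then have "x = S (f * x)" by (simp add: multiplier_mult_left[OF ss S])
    then show ?thesis by (rule range_eqI)
  qed
  then have "closure {a. compactin gelfand_topology (gelfand_support a)} \<subseteq> range S"
    by (intro closure_minimal bounded_below_closed_range[OF bS bb]) auto
  then have "range S = UNIV" using taub unfolding tauberian_def by auto
  then show ?thesis by (rule bounded_below_surj_imp_invertible[OF bS bb])
qed

subsection \<open>Isolated points of the spectrum\<close>

text \<open>The range of \<open>S - \<lambda>\<close> is annihilated by the characters at which the symbol of \<open>S\<close> has the value \<open>\<lambda>\<close>.\<close>

lemma character_not_value:
  fixes S :: "'a::complex_banach_algebra \<Rightarrow> 'a"
  assumes ss: "semisimple TYPE('a)" and S: "multiplier S" and phi: "\<phi> \<in> characters" and b: "\<phi> b \<noteq> 0"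
    and inv: "invertible_operator (shift S (\<phi> (S b) / \<phi> b))"
  shows False
proof -
  obtain a where a: "\<phi> a \<noteq> 0" using phi unfolding characters_def by auto
  obtain V where "\<And>x. shift S (\<phi> (S b) / \<phi> b) (V x) = x" using invertible_operatorE[OF inv] by metis
  then have "\<phi> (S (V a)) - \<phi> (S b) / \<phi> b * \<phi> (V a) = \<phi> a"
    unfolding shift_def by (metis charactersD(4,5)[OF phi])
  moreover have "\<phi> (S (V a)) = \<phi> (S b) / \<phi> b * \<phi> (V a)"
    using character_multiplier_cross[OF ss S phi, of "V a" b] b by (simp add: field_simps)
  ultimately show False using a by simp
qed

text \<open>The symbol takes no small values other than \<open>0\<close>. So an element \<open>a\<close> concentrated where the symbol is below
  \<open>d\<close> is concentrated where it vanishes, and \<open>S a = 0\<close>.\<close>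

lemma isolated_multiplier_nonvanishing:
  fixes S :: "'a::complex_banach_algebra \<Rightarrow> 'a"
  assumes ss: "semisimple TYPE('a)" and comm: "commutative TYPE('a)" and reg: "regular_algebra TYPE('a)"
    and S: "multiplier S" and inj: "kernel S = {0}"
    and d: "d > 0" "\<forall>\<mu>. 0 < cmod \<mu> \<longrightarrow> cmod \<mu> < d \<longrightarrow> invertible_operator (shift S \<mu>)"
    and phi0: "\<phi>0 \<in> characters"
  shows "\<exists>a. \<phi>0 (S a) \<noteq> 0"
proof (rule ccontr)
  assume "\<not> ?thesis"
  then have zero: "\<phi>0 (S a) = 0" for a by simp
  have "d / 2 > 0" using d(1) by simp
  then obtain a where a: "\<phi>0 a \<noteq> 0" "\<forall>\<phi>\<in>characters. cmod (\<phi> (S a)) \<le> d / 2 * cmod (\<phi> a)"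
    by (rule regular_concentrated_element[OF ss reg S phi0 zero])
  have "S a = 0"
  proof (rule characters_separate[OF ss comm], rule ccontr)
    fix \<phi> :: "'a \<Rightarrow> complex" assume phi: "\<phi> \<in> characters" and nz: "\<phi> (S a) \<noteq> 0"
    have le: "cmod (\<phi> (S a)) \<le> d / 2 * cmod (\<phi> a)" using a(2) phi by blast
    then have nza: "\<phi> a \<noteq> 0" using nz by auto
    have "cmod (\<phi> (S a)) < d * cmod (\<phi> a)" by (rule le_less_trans[OF le]) (use nza d(1) in simp)
    then have "invertible_operator (shift S (\<phi> (S a) / \<phi> a))"
      using nz nza by (intro d(2)[rule_format]) (simp_all add: norm_divide field_simps)
    then show False by (rule character_not_value[OF ss S phi nza])
  qed
  then have "a = 0" using inj by auto
  then show False using a(1) charactersD(6)[OF phi0] by simp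
qed

text \<open>With \<open>R = (S - \<nu>)\<^sup>-\<^sup>1\<close>, this is \<open>S\<^sup>n - \<nu>\<^sup>n = (S - \<nu>) (S\<^bsup>n-1\<^esup> + \<nu> S\<^bsup>n-2\<^esup> + \<dots> + \<nu>\<^bsup>n-1\<^esup>)\<close>.\<close>

lemma resolvent_power_expansion:
  assumes S: "bounded_clinear S" and R: "bounded_clinear R" "\<And>x. R (shift S \<nu> x) = x"
  shows "R ((S ^^ n) p) = \<nu> ^ n *\<^sub>C R p + (\<Sum>j<n. \<nu> ^ (n - Suc j) *\<^sub>C (S ^^ j) p)"
proof (induction n)
  case 0
  then show ?case by (simp add: scaleC_one)
next
  case (Suc n)
  let ?q = "(S ^^ n) p"
  have "S ?q = shift S \<nu> ?q + \<nu> *\<^sub>C ?q" by (simp add: shift_def)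
  then have "R (S ?q) = ?q + \<nu> *\<^sub>C R ?q"
    by (simp add: bounded_clinear_add[OF R(1)] R(2) bounded_clinear_scaleC[OF R(1)])
  also have "\<nu> *\<^sub>C R ?q = \<nu> ^ Suc n *\<^sub>C R p + (\<Sum>j<n. \<nu> ^ (Suc n - Suc j) *\<^sub>C (S ^^ j) p)"
    unfolding Suc scaleC_add_right complex_vector.scale_sum_right
    by (auto simp: scaleC_scaleC Suc_diff_Suc simp flip: power_Suc intro!: sum.cong)
  finally show ?case by (simp add: scaleC_one add_ac)
qed

text \<open>The contour integral of the resolvent around the isolated point \<open>0\<close> is replaced by means over
  roots of unity. As the symbol of \<open>S\<close> is bounded away from \<open>0\<close>, an element \<open>x\<close> with compact support
  equals \<open>S\<^sup>n (f\<^sup>n x)\<close>, where \<open>f\<close> has spectral radius at most \<open>1/d\<close> on the support; so the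
  means of \<open>\<nu> (S - \<nu>)\<^sup>-\<^sup>1 x\<close> over \<open>|\<nu>| = d/2\<close> tend to \<open>0\<close>. This gives a lower bound for \<open>S\<close>
  that does not depend on \<open>x\<close>.\<close>

lemma isolated_multiplier_lower_bound:
  fixes S :: "'a::complex_banach_algebra \<Rightarrow> 'a"
  assumes ss: "semisimple TYPE('a)" and comm: "commutative TYPE('a)" and reg: "regular_algebra TYPE('a)"
    and S: "multiplier S" and inj: "kernel S = {0}"
    and d: "d > 0" "\<forall>\<mu>. 0 < cmod \<mu> \<longrightarrow> cmod \<mu> < d \<longrightarrow> invertible_operator (shift S \<mu>)"
    and x: "compactin gelfand_topology (gelfand_support x)"
    and c: "c > 0" "\<And>\<nu> y. cmod \<nu> = d / 2 \<Longrightarrow> c * norm y \<le> norm (shift S \<nu> y)"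
  shows "c * norm x \<le> norm (S x)"
proof -
  have bS: "bounded_clinear S" by (rule multiplier_bounded_clinear[OF S])
  note nonvan = isolated_multiplier_nonvanishing[OF ss comm reg S inj d]
  define K where "K = gelfand_support x"
  have Kch: "K \<subseteq> characters"
    using compactin_subset_topspace[OF x] by (simp add: K_def gelfand_topology_def)
  obtain f where f: "S f * x = x" "\<forall>\<psi>\<in>gelfand_support x. \<psi> (S f) = 1"
    by (rule compact_support_local_unit[OF ss comm reg S nonvan x])
  have lower: "d * cmod (\<phi> y) \<le> cmod (\<phi> (S y))" if phi: "\<phi> \<in> characters" for \<phi> y
  proof (rule ccontr)
    assume "\<not> ?thesis"
    then have lt: "cmod (\<phi> (S y)) < d * cmod (\<phi> y)" by simp
    then have nz: "\<phi> y \<noteq> 0" by auto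
    obtain a where a: "\<phi> (S a) \<noteq> 0" using nonvan[OF phi] by auto
    then have "\<phi> (S y) \<noteq> 0" using character_multiplier_cross[OF ss S phi, of a y] nz by auto
    then have "invertible_operator (shift S (\<phi> (S y) / \<phi> y))"
      using lt nz by (intro d(2)[rule_format]) (simp_all add: norm_divide field_simps)
    then show False by (rule character_not_value[OF ss S phi nz])
  qed
  have small: "\<psi> \<in> characters \<and> cmod (\<psi> f) \<le> 1 / d" if "\<psi> \<in> K" for \<psi>
  proof -
    have ch: "\<psi> \<in> characters" using that Kch by auto
    have "\<psi> (S f) = 1" using f(2) that by (simp add: K_def)
    then have "d * cmod (\<psi> f) \<le> 1" using lower[OF ch, of f] by simp
    then show ?thesis using ch d(1) by (simp add: field_simps)
  qed
  \<comment> \<open>The number \<open>3 / (2 d)\<close> exceeds the bound \<open>1/d\<close> for \<open>f\<close> on the support, and its product with the radius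
    \<open>d/2\<close> is \<open>3/4 < 1\<close>.\<close>
  obtain C where C: "C > 0" "\<forall>n. infdist (spower f n) (vanishing_ideal K) \<le> C * (3 / (2 * d)) ^ Suc n"
    by (rule spower_decay_modulo_vanishing_ideal[OF comm Kch, where s = "1 / d" and t = "3 / (2 * d)"])
      (use regular_hull_bound[OF reg small] d(1) in \<open>auto simp: field_simps\<close>)
  have vK: "m * x = 0" if m: "m \<in> vanishing_ideal K" for m
  proof -
    show ?thesis
    proof (rule characters_separate[OF ss comm])
      fix \<phi> :: "'a \<Rightarrow> complex" assume phi: "\<phi> \<in> characters"
      have "\<phi> \<in> K" if "\<phi> x \<noteq> 0" using in_gelfand_supportI[OF phi that] by (simp add: K_def)
      then show "\<phi> (m * x) = 0" using m by (auto simp: charactersD[OF phi] vanishing_ideal_def)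
    qed
  qed
  have fx: "norm (spower f n * x) \<le> C * (3 / (2 * d)) ^ Suc n * norm x" for n
  proof (cases "x = 0")
    case False
    have "norm (spower f n * x) / norm x \<le> infdist (spower f n) (vanishing_ideal K)"
    proof (rule le_infdistI)
      have "0 \<in> vanishing_ideal K" using Kch charactersD(6) by (auto simp: vanishing_ideal_def)
      then show "vanishing_ideal K \<noteq> {}" by auto
      fix m assume "m \<in> vanishing_ideal K"
      then have "spower f n * x = (spower f n - m) * x" by (simp add: left_diff_distrib vK)
      then have "norm (spower f n * x) \<le> dist (spower f n) m * norm x"
        by (metis norm_mult_ineq dist_norm)
      then show "norm (spower f n * x) / norm x \<le> dist (spower f n) m" using False by (simp add: field_simps)
    qed
    also have "\<dots> \<le> C * (3 / (2 * d)) ^ Suc n" using C(2) by simp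
    finally show ?thesis using False by (simp add: field_simps)
  qed simp
  define r where "r = d / 2"
  have r: "r > 0" using d(1) by (simp add: r_def)
  have Spow: "(S ^^ Suc n) (spower f n * x) = x" for n
  proof (induction n)
    case 0
    then show ?case using f(1) by (simp add: multiplier_mult_left[OF ss S])
  next
    case (Suc n)
    have right: "(S ^^ k) (a * p) = a * (S ^^ k) p" for k a p
      by (induction k) (simp_all add: multiplier_mult_right[OF ss S])
    have "(S ^^ Suc (Suc n)) (spower f (Suc n) * x) = S (f * (S ^^ Suc n) (spower f n * x))"
      by (simp add: right mult.assoc multiplier_mult_right[OF ss S])
    also have "\<dots> = S (f * x)" by (simp only: Suc)
    finally show ?case using f(1) by (simp add: multiplier_mult_left[OF ss S])
  qed
  have main: "c * norm x \<le> norm (S x) + (c + r) * C * norm x * (3 / 4) ^ n" if n: "n > 0" for n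
  proof -
    obtain k where k: "n = Suc k" using n by (cases n) auto
    define p where "p = spower f k * x"
    have Sp: "(S ^^ n) p = x" using Spow[of k] by (simp only: p_def k)
    define e where "e k = exp (2 * of_real pi * \<i> * of_nat k / of_nat n)" for k
    define \<nu> where "\<nu> k = of_real r * e k" for k
    have nu: "cmod (\<nu> k) = r" for k using r by (simp add: \<nu>_def e_def norm_mult norm_root_of_unity)
    have nun: "\<nu> k ^ n = of_real (r ^ n)" for k
      using root_of_unity_power[OF n, of k] by (simp add: \<nu>_def e_def power_mult_distrib)
    have "\<exists>R. bounded_clinear R \<and> (\<forall>y. R (shift S (\<nu> k) y) = y) \<and> (\<forall>y. shift S (\<nu> k) (R y) = y)" for k
    proof -
      have "invertible_operator (shift S (\<nu> k))" 
        using d(2)[rule_format, of "\<nu> k"] d(1) unfolding nu r_def by simp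
      then show ?thesis unfolding invertible_operator_def by (metis comp_apply id_apply)
    qed
    then obtain R where R: "\<And>k. bounded_clinear (R k)" "\<And>k y. R k (shift S (\<nu> k) y) = y"
        "\<And>k y. shift S (\<nu> k) (R k y) = y" by metis
    have Rb: "norm (R k y) \<le> norm y / c" for k y
      using c(2)[of "\<nu> k" "R k y"] c(1) nu[of k] R(3)[of k y] by (simp add: r_def field_simps)
    have Rx: "R k x = of_real (r ^ n) *\<^sub>C R k p + (\<Sum>j<n. \<nu> k ^ (n - Suc j) *\<^sub>C (S ^^ j) p)" for k
      using resolvent_power_expansion[OF bS R(1,2), of k n p] by (simp only: Sp nun)
    have "(\<Sum>k<n. \<nu> k *\<^sub>C R k x) = (\<Sum>k<n. of_real (r ^ n) *\<^sub>C \<nu> k *\<^sub>C R k p)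
        + (\<Sum>k<n. \<Sum>j<n. \<nu> k ^ (n - j) *\<^sub>C (S ^^ j) p)"
      unfolding sum.distrib[symmetric]
    proof (rule sum.cong[OF refl])
      fix k
      have "(\<Sum>j<n. \<nu> k *\<^sub>C \<nu> k ^ (n - Suc j) *\<^sub>C (S ^^ j) p) = (\<Sum>j<n. \<nu> k ^ (n - j) *\<^sub>C (S ^^ j) p)"
        by (rule sum.cong) (auto simp: scaleC_scaleC Suc_diff_Suc simp flip: power_Suc)
      then show "\<nu> k *\<^sub>C R k x = of_real (r ^ n) *\<^sub>C \<nu> k *\<^sub>C R k p + (\<Sum>j<n. \<nu> k ^ (n - j) *\<^sub>C (S ^^ j) p)"
        unfolding Rx scaleC_add_right complex_vector.scale_sum_right by (simp add: scaleC_scaleC mult.commute)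
    qed
    also have "(\<Sum>k<n. \<Sum>j<n. \<nu> k ^ (n - j) *\<^sub>C (S ^^ j) p) = (\<Sum>j<n. (\<Sum>k<n. \<nu> k ^ (n - j)) *\<^sub>C (S ^^ j) p)"
      by (subst sum.swap) (simp add: complex_vector.scale_sum_left)
    \<comment> \<open>Only the exponent \<open>n\<close> survives the summation over the roots of unity.\<close>
    also have "\<dots> = (\<Sum>j<n. if j = 0 then of_real (real n * r ^ n) *\<^sub>C p else 0)"
    proof (rule sum.cong[OF refl])
      fix j assume j: "j \<in> {..<n}"
      show "(\<Sum>k<n. \<nu> k ^ (n - j)) *\<^sub>C (S ^^ j) p = (if j = 0 then of_real (real n * r ^ n) *\<^sub>C p else 0)"
      proof (cases "j = 0")
        case True
        then show ?thesis by (simp add: nun)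
      next
        case False
        then have "n - j < n" "n - j \<noteq> 0" using j by auto
        then have "(\<Sum>k<n. e k ^ (n - j)) = 0" unfolding e_def by (subst sum_roots_of_unity_power) auto
        then have "(\<Sum>k<n. \<nu> k ^ (n - j)) = 0"
          by (simp add: \<nu>_def power_mult_distrib flip: sum_distrib_left)
        then show ?thesis using False by simp
      qed
    qed
    also have "\<dots> = of_real (real n * r ^ n) *\<^sub>C p" using n by simp
    finally have means: "(\<Sum>k<n. \<nu> k *\<^sub>C R k x)
      = (\<Sum>k<n. of_real (r ^ n) *\<^sub>C \<nu> k *\<^sub>C R k p) + of_real (real n * r ^ n) *\<^sub>C p" .
    have "norm (of_real (r ^ n) *\<^sub>C \<nu> k *\<^sub>C R k p) \<le> r ^ n * (r * (norm p / c))" for k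
    proof -
      have "norm (of_real (r ^ n) *\<^sub>C \<nu> k *\<^sub>C R k p) = r ^ n * (r * norm (R k p))"
        using r by (simp only: norm_scaleC nu norm_of_real) simp
      also have "\<dots> \<le> r ^ n * (r * (norm p / c))" using r by (intro mult_left_mono Rb) auto
      finally show ?thesis .
    qed
    then have "norm (\<Sum>k<n. of_real (r ^ n) *\<^sub>C \<nu> k *\<^sub>C R k p) \<le> (\<Sum>k<n. r ^ n * (r * (norm p / c)))"
      by (rule sum_norm_le)
    then have sum1: "norm (\<Sum>k<n. \<nu> k *\<^sub>C R k x) \<le> real n * (r ^ n * (r * (norm p / c))) + real n * r ^ n * norm p"
      unfolding means using r
      by (intro order_trans[OF norm_triangle_ineq] add_mono) (simp_all add: norm_scaleC norm_mult norm_power)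
    have RS: "R k (S x) = x + \<nu> k *\<^sub>C R k x" for k
    proof -
      have "S x = shift S (\<nu> k) x + \<nu> k *\<^sub>C x" by (simp add: shift_def)
      then show ?thesis by (simp add: bounded_clinear_add[OF R(1)] R(2) bounded_clinear_scaleC[OF R(1)])
    qed
    have "(\<Sum>k<n. R k (S x)) = (\<Sum>k<n. x) + (\<Sum>k<n. \<nu> k *\<^sub>C R k x)"
      unfolding RS sum.distrib ..
    then have "of_nat n *\<^sub>R x = (\<Sum>k<n. R k (S x)) - (\<Sum>k<n. \<nu> k *\<^sub>C R k x)"
      by (simp add: sum_constant_scaleR)
    then have "real n * norm x = norm ((\<Sum>k<n. R k (S x)) - (\<Sum>k<n. \<nu> k *\<^sub>C R k x))"
      by (metis norm_scaleR abs_of_nat)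
    also have "\<dots> \<le> norm (\<Sum>k<n. R k (S x)) + norm (\<Sum>k<n. \<nu> k *\<^sub>C R k x)" by (rule norm_triangle_ineq4)
    also have "norm (\<Sum>k<n. R k (S x)) \<le> (\<Sum>k<n. norm (S x) / c)"
      by (rule sum_norm_le) (rule Rb)
    finally have "real n * norm x \<le> real n * (norm (S x) / c + r ^ n * (r * (norm p / c)) + r ^ n * norm p)"
      using sum1 by (simp add: algebra_simps)
    then have "norm x \<le> norm (S x) / c + r ^ n * (r * (norm p / c)) + r ^ n * norm p"
      using n by simp
    then have "c * norm x \<le> c * (norm (S x) / c + r ^ n * (r * (norm p / c)) + r ^ n * norm p)"
      using c(1) by (intro mult_left_mono) auto
    also have "\<dots> = norm (S x) + (c + r) * (r ^ n * norm p)" using c(1) by (simp add: field_simps)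
    also have "r ^ n * norm p \<le> r ^ n * (C * (3 / (2 * d)) ^ n * norm x)"
      using fx[of k] r by (intro mult_left_mono) (simp_all add: p_def k)
    also have "r ^ n * (C * (3 / (2 * d)) ^ n * norm x) = C * norm x * (r * (3 / (2 * d))) ^ n"
      by (simp only: power_mult_distrib mult_ac)
    also have "r * (3 / (2 * d)) = 3 / 4" using d(1) by (simp add: r_def)
    finally show ?thesis using c(1) r by (simp add: mult.assoc)
  qed
  have "(\<lambda>n. norm (S x) + (c + r) * C * norm x * (3 / 4) ^ n) \<longlonglongrightarrow> norm (S x) + (c + r) * C * norm x * 0"
    by (intro tendsto_add tendsto_mult tendsto_const LIMSEQ_power_zero) simp
  then have lim: "(\<lambda>n. norm (S x) + (c + r) * C * norm x * (3 / 4) ^ n) \<longlonglongrightarrow> norm (S x)" by simp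
  have "eventually (\<lambda>n. c * norm x \<le> norm (S x) + (c + r) * C * norm x * (3 / 4) ^ n) sequentially"
    using eventually_gt_at_top[of 0] by eventually_elim (rule main)
  then show ?thesis by (rule tendsto_lowerbound[OF lim]) simp
qed

text \<open>On the circle \<open>|\<nu>| = d/2\<close> the operators \<open>S - \<nu>\<close> have a common lower bound, which is a lower bound for \<open>S\<close> on the
  dense set of elements of compact support.\<close>

lemma isolated_multiplier_invertible:
  fixes S :: "'a::complex_banach_algebra \<Rightarrow> 'a"
  assumes ss: "semisimple TYPE('a)" and comm: "commutative TYPE('a)" and reg: "regular_algebra TYPE('a)"
    and taub: "tauberian TYPE('a)" and S: "multiplier S" and inj: "kernel S = {0}"
    and d: "d > 0" "\<forall>\<mu>. 0 < cmod \<mu> \<longrightarrow> cmod \<mu> < d \<longrightarrow> invertible_operator (shift S \<mu>)"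
  shows "invertible_operator S"
proof -
  have bS: "bounded_clinear S" by (rule multiplier_bounded_clinear[OF S])
  have "\<nu> \<notin> approx_point_spectrum S" if "cmod \<nu> = d / 2" for \<nu>
    using invertible_operator_bounded_below[OF d(2)[rule_format, of \<nu>]] that d(1)
    by (simp add: not_in_approx_point_spectrum_iff[OF bS])
  then have disj: "sphere 0 (d / 2) \<inter> approx_point_spectrum S = {}" by auto
  obtain c where c: "c > 0" "\<And>\<nu> y. \<nu> \<in> sphere 0 (d / 2) \<Longrightarrow> c * norm y \<le> norm (shift S \<nu> y)"
    using uniformly_bounded_below[OF bS compact_sphere disj] by blast
  let ?D = "{a :: 'a. compactin gelfand_topology (gelfand_support a)}"
  have "c * norm x \<le> norm (S x)" if "x \<in> ?D" for x
    by (rule isolated_multiplier_lower_bound[OF ss comm reg S inj d _ c(1)]) (use that c(2) in auto)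
  moreover have "closed {x. c * norm x \<le> norm (S x)}"
    using linear_continuous_on[OF bounded_clinear_bounded_linear[OF bS]]
    by (intro closed_Collect_le continuous_on_mult continuous_on_const continuous_on_norm continuous_on_id) auto
  ultimately have "closure ?D \<subseteq> {x. c * norm x \<le> norm (S x)}" by (intro closure_minimal) auto
  then have "\<forall>x. c * norm x \<le> norm (S x)" using taub unfolding tauberian_def by auto
  then have "bounded_below S" unfolding bounded_below_def using c(1) by auto
  then show ?thesis by (rule bounded_below_multiplier_invertible[OF ss comm reg taub S])
qed

subsection \<open>Multipliers with finite-dimensional kernel\<close>

text \<open>The image of a basis is independent and has as many elements as the basis, so it spans the space.\<close>

lemma finite_dim_inj_imp_surj:
  fixes W :: "'a::complex_normed_vector set"
  assumes W: "csubspace W" and F: "finite F" "W \<subseteq> cspan F" and L: "bounded_clinear L"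
    and into: "\<And>w. w \<in> W \<Longrightarrow> L w \<in> W" and inj: "\<And>w. w \<in> W \<Longrightarrow> L w = 0 \<Longrightarrow> w = 0"
  shows "L ` W = W"
proof -
  interpret vector_space_pair "scaleC :: complex \<Rightarrow> 'a \<Rightarrow> 'a" "scaleC :: complex \<Rightarrow> 'a \<Rightarrow> 'a" ..
  obtain D where D: "D \<subseteq> W" "\<not> cdependent D" "W \<subseteq> cspan D" "card D = cdim W"
    by (rule complex_vector.basis_exists[of W])
  have finD: "finite D"
    using complex_vector.independent_span_bound[OF F(1) D(2)] D(1) F(2) by (meson subset_trans)
  have lin: "Vector_Spaces.linear scaleC scaleC L"
    by (rule Vector_Spaces.linear_iff[THEN iffD2])
      (simp add: bounded_clinear_add[OF L] bounded_clinear_scaleC[OF L] complex_vector.vector_space_axioms)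
  have injW: "inj_on L W"
  proof (rule inj_onI)
    fix x y assume xy: "x \<in> W" "y \<in> W" "L x = L y"
    have "x - y = 0"
      by (rule inj) (use xy in \<open>simp_all add: complex_vector.subspace_diff[OF W] bounded_clinear_diff[OF L]\<close>)
    then show "x = y" by simp
  qed
  have spanD: "cspan D = W" using D(1,3) W by (intro antisym complex_vector.span_minimal)
  have ind: "\<not> cdependent (L ` D)"
    using linear_independent_injective_image[OF lin, of D] D(2) injW spanD
    unfolding cdependent_def cspan_def by simp
  have LD: "L ` D \<subseteq> W" using into D(1) by auto
  have spanned: "w \<in> cspan (L ` D)" if w: "w \<in> W" for w
  proof (rule ccontr)
    assume nin: "w \<notin> cspan (L ` D)"
    then have "\<not> cdependent (insert w (L ` D))" using ind by (rule complex_vector.independent_insertI)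
    moreover have "insert w (L ` D) \<subseteq> cspan D" using w LD spanD by simp
    ultimately have "card (insert w (L ` D)) \<le> card D"
      using complex_vector.independent_span_bound[OF finD] by blast
    moreover have "w \<notin> L ` D" using nin by (rule contrapos_nn) (rule complex_vector.span_base)
    moreover have "card (L ` D) = card D" by (intro card_image inj_on_subset[OF injW] D(1))
    ultimately show False using finD by simp
  qed
  have "cspan (L ` D) \<subseteq> L ` W"
  proof (rule complex_vector.span_minimal)
    show "L ` D \<subseteq> L ` W" by (rule image_mono[OF D(1)])
    show "csubspace (L ` W)"
    proof (rule complex_vector.subspaceI)
      show "0 \<in> L ` W" using complex_vector.subspace_0[OF W] bounded_clinear_0[OF L] by (metis imageI)
      show "x + y \<in> L ` W" if "x \<in> L ` W" "y \<in> L ` W" for x y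
        using that complex_vector.subspace_add[OF W] by (auto simp flip: bounded_clinear_add[OF L])
      show "c *\<^sub>C x \<in> L ` W" if "x \<in> L ` W" for c x
        using that complex_vector.subspace_scale[OF W] by (auto simp flip: bounded_clinear_scaleC[OF L])
    qed
  qed
  then have "W \<subseteq> L ` W" using spanned by (meson subsetD subsetI)
  moreover have "L ` W \<subseteq> W" using into by (intro image_subsetI)
  ultimately show ?thesis by (rule equalityI[rotated])
qed

text \<open>Multiplication by \<open>x\<close> is injective on \<open>x N\<close>, hence onto \<open>x N\<close>, so that \<open>x\<^sup>2 = x (x n)\<close> for
  some \<open>n \<in> N\<close>; then \<open>x = x n\<close>, as the algebra is semiprime.\<close>

lemma finite_dim_ideal_relative_unit:
  fixes N :: "'a::complex_banach_algebra set"
  assumes ss: "semisimple TYPE('a)" and comm: "commutative TYPE('a)"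
    and N: "csubspace N" "\<And>a x. x \<in> N \<Longrightarrow> a * x \<in> N" and F: "finite F" "N \<subseteq> cspan F" and x: "x \<in> N"
  shows "\<exists>z\<in>N. z * x = x"
proof -
  have comm': "a * b = b * a" for a b :: 'a using comm unfolding commutative_def by blast
  have sp: "y = 0" if "\<And>a. y * a * y = 0" for y :: 'a using that by (rule semisimple_imp_semiprime[OF ss])
  define W where "W = (*) x ` N"
  have WN: "W \<subseteq> N" unfolding W_def using N(2) by auto
  have "csubspace W"
  proof (rule complex_vector.subspaceI)
    show "0 \<in> W" unfolding W_def using complex_vector.subspace_0[OF N(1)] by (metis imageI mult_zero_right)
    show "y + z \<in> W" if "y \<in> W" "z \<in> W" for y z
      using that complex_vector.subspace_add[OF N(1)] unfolding W_def by (auto simp flip: distrib_left)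
    show "c *\<^sub>C y \<in> W" if "y \<in> W" for c y
      using that complex_vector.subspace_scale[OF N(1)] unfolding W_def by (auto simp flip: mult_scaleC_right)
  qed
  moreover have "W \<subseteq> cspan F" using WN F(2) by blast
  moreover have "x * w \<in> W" if "w \<in> W" for w using that WN unfolding W_def by auto
  moreover have "w = 0" if "w \<in> W" "x * w = 0" for w
  proof (rule sp)
    fix a
    obtain n where "w = x * n" using \<open>w \<in> W\<close> unfolding W_def by auto
    then have "w * w = n * (x * w)" by (simp add: comm'[of x n] mult.assoc)
    then have "w * w = 0" using that(2) by simp
    then show "w * a * w = 0" by (simp add: comm'[of w a] mult.assoc)
  qed
  ultimately have "(*) x ` W = W"
    by (intro finite_dim_inj_imp_surj[OF _ F(1) _ bounded_clinear_mult_left])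
  moreover have "x * x \<in> W" unfolding W_def using x by simp
  ultimately obtain w where w: "w \<in> W" "x * x = x * w" by (metis imageE)
  obtain n where n: "n \<in> N" "w = x * n" using w(1) unfolding W_def by auto
  define y where "y = x - x * n"
  have xy: "x * y = 0" using w(2) by (simp add: y_def n(2) right_diff_distrib)
  have "x * n * y = n * (x * y)" by (simp add: comm'[of x n] mult.assoc)
  then have "(x - x * n) * y = 0" by (simp add: left_diff_distrib xy)
  then have "y * y = 0" by (simp flip: y_def)
  then have "y * a * y = 0" for a by (simp add: comm'[of y a] mult.assoc)
  then have "y = 0" by (rule sp)
  then have "n * x = x" by (simp add: y_def comm'[of n x])
  then show ?thesis using n(1) by auto
qed

text \<open>Relative units of the elements of a finite spanning set are combined by \<open>e + z - z e\<close>.\<close>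

lemma finite_dim_ideal_unit:
  fixes N :: "'a::complex_banach_algebra set"
  assumes ss: "semisimple TYPE('a)" and comm: "commutative TYPE('a)"
    and N: "csubspace N" "\<And>a x. x \<in> N \<Longrightarrow> a * x \<in> N" and fin: "edim N < \<infinity>"
  obtains e where "e \<in> N" "\<forall>x\<in>N. e * x = x"
proof -
  have comm': "a * b = b * a" for a b :: 'a using comm unfolding commutative_def by blast
  obtain B where B: "finite B" "cspan B = N" by (rule edim_finiteE[OF fin])
  have BN: "B \<subseteq> N" using complex_vector.span_superset[of B] B(2) by simp
  have "\<exists>e\<in>N. \<forall>x\<in>B. e * x = x"
    using B(1) BN
  proof (induction B rule: finite_induct)
    case empty
    then show ?case using complex_vector.subspace_0[OF N(1)] by auto
  next
    case (insert b D)
    then obtain e where e: "e \<in> N" "\<forall>x\<in>D. e * x = x" by auto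
    have "b \<in> N" using insert.prems by simp
    then have "\<exists>z\<in>N. z * b = b"
      using finite_dim_ideal_relative_unit[OF ss comm N B(1)] B(2) by simp
    then obtain z where z: "z \<in> N" "z * b = b" by auto
    have "e + z - z * e \<in> N"
      by (intro complex_vector.subspace_add complex_vector.subspace_diff N e(1) z(1))
    moreover have "(e + z - z * e) * b = b"
      by (simp add: left_diff_distrib distrib_right z(2) comm'[of z e] mult.assoc)
    moreover have "(e + z - z * e) * x = x" if "x \<in> D" for x
      using e(2) that by (simp add: left_diff_distrib distrib_right mult.assoc)
    ultimately show ?case by auto
  qed
  then obtain e where e: "e \<in> N" "\<forall>x\<in>B. e * x = x" by auto
  have "csubspace {x. e * x = x}"
    by (rule complex_vector.subspaceI) (simp_all add: distrib_left mult_scaleC_right)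
  then have "cspan B \<subseteq> {x. e * x = x}" using e(2) by (intro complex_vector.span_minimal) auto
  then show ?thesis using B(2) e(1) that by auto
qed

text \<open>Lower bounds on the summands \<open>e A\<close> and \<open>(1 - e) A\<close> combine, since the projections onto them are
  continuous.\<close>

lemma bounded_below_Peirce:
  fixes U :: "'a::complex_banach_algebra \<Rightarrow> 'a"
  assumes U: "bounded_clinear U" "\<And>x. U (e * x) = e * U x" and e: "e * e = e"
    and k: "k \<noteq> 0" "\<And>x. U (e * x) = k *\<^sub>C (e * x)"
    and c: "c > 0" "\<And>w. e * w = 0 \<Longrightarrow> c * norm w \<le> norm (U w)"
  shows "bounded_below U"
proof -
  define M where "M = norm e / cmod k + (1 + norm e) / c"
  have "norm x \<le> M * norm (U x)" for x
  proof -
    have "cmod k * norm (e * x) = norm (e * U x)" by (simp only: U(2)[symmetric] k(2) norm_scaleC)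
    also have "\<dots> \<le> norm e * norm (U x)" by (rule norm_mult_ineq)
    finally have 1: "norm (e * x) \<le> norm e / cmod k * norm (U x)" using k(1) by (simp add: field_simps)
    have "c * norm (x - e * x) \<le> norm (U (x - e * x))"
      by (rule c(2)) (simp add: right_diff_distrib e flip: mult.assoc)
    also have "U (x - e * x) = U x - e * U x" by (simp only: bounded_clinear_diff[OF U(1)] U(2))
    also have "norm \<dots> \<le> norm (U x) + norm e * norm (U x)"
      by (rule order_trans[OF norm_triangle_ineq4]) (simp add: norm_mult_ineq)
    finally have 2: "norm (x - e * x) \<le> (1 + norm e) / c * norm (U x)" using c(1) by (simp add: field_simps)
    have "norm x \<le> norm (e * x) + norm (x - e * x)" using norm_triangle_ineq[of "e * x" "x - e * x"] by simp
    then show ?thesis using 1 2 by (simp add: M_def distrib_right)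
  qed
  note le = this
  have "M \<ge> 0" using c(1) by (simp add: M_def)
  then have "1 / (M + 1) * norm x \<le> norm (U x)" for x
    using order_trans[OF le[of x] mult_right_mono[of M "M + 1" "norm (U x)"]] by (simp add: field_simps)
  then show ?thesis unfolding bounded_below_def using \<open>M \<ge> 0\<close> by (intro exI[of _ "1 / (M + 1)"]) auto
qed

text \<open>Multiplication by the unit \<open>e\<close> of the kernel is the projection onto the kernel that group invertibility
  asks for, and it is a multiplier itself.\<close>

lemma multiplier_kernel_unit:
  fixes S :: "'a::complex_banach_algebra \<Rightarrow> 'a"
  assumes ss: "semisimple TYPE('a)" and comm: "commutative TYPE('a)" and S: "multiplier S"
    and fin: "nullity S < \<infinity>"
  obtains e where "\<forall>x. S (e * x) = 0" "\<forall>x. S x = 0 \<longrightarrow> e * x = x" "e * e = e"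
    and "multiplier (\<lambda>x. S x + e * x)"
    and "invertible_operator (\<lambda>x. S x + e * x) \<longrightarrow> group_invertible S"
proof -
  have comm': "a * b = b * a" for a b :: 'a using comm unfolding commutative_def by blast
  have bS: "bounded_clinear S" by (rule multiplier_bounded_clinear[OF S])
  obtain e where e: "e \<in> kernel S" "\<forall>x\<in>kernel S. e * x = x"
    by (rule finite_dim_ideal_unit[OF ss comm csubspace_kernel[OF bS] _ fin[unfolded nullity_def]])
      (simp add: multiplier_mult_right[OF ss S])
  have Se: "S (e * x) = 0" for x using e(1) by (simp add: multiplier_mult_left[OF ss S])
  have eS: "e * S x = 0" for x using Se by (simp add: multiplier_mult_right[OF ss S])
  have ee: "e * e = e" using e by simp
  have "multiplier ((*) e)"
    unfolding multiplier_def by (intro conjI bounded_clinear_mult_left allI) (metis comm' mult.assoc)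
  then have "multiplier (\<lambda>x. S x + e * x)" by (rule multiplier_plus[OF S])
  moreover have "group_invertible S" if "invertible_operator (\<lambda>x. S x + e * x)"
    unfolding group_invertible_def
    by (intro exI[of _ "(*) e"] conjI bounded_clinear_mult_left that)
      (simp_all add: Se eS ee flip: mult.assoc)
  ultimately show ?thesis using that[of e] Se e(2) ee by simp
qed

text \<open>By the open mapping theorem \<open>S\<^bsup>n+1\<^esup>\<close> is bounded below modulo its kernel, which is the kernel of \<open>S\<close>;
  then so is \<open>S\<close>. Adding \<open>e\<close> takes care of the kernel.\<close>

lemma multiplier_group_invertible_if_closed_range:
  fixes S :: "'a::complex_banach_algebra \<Rightarrow> 'a"
  assumes ss: "semisimple TYPE('a)" and comm: "commutative TYPE('a)" and reg: "regular_algebra TYPE('a)"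
    and taub: "tauberian TYPE('a)" and S: "multiplier S"
    and cl: "closed (range (S ^^ Suc n))" and fin: "nullity S < \<infinity>"
  shows "group_invertible S"
proof -
  have bS: "bounded_clinear S" by (rule multiplier_bounded_clinear[OF S])
  obtain e where e: "\<forall>x. S (e * x) = 0" "\<forall>x. S x = 0 \<longrightarrow> e * x = x" "e * e = e"
      "multiplier (\<lambda>x. S x + e * x)" "invertible_operator (\<lambda>x. S x + e * x) \<longrightarrow> group_invertible S"
    by (rule multiplier_kernel_unit[OF ss comm S fin])
  obtain C where C: "C > 0" "\<And>y. y \<in> range (S ^^ Suc n) \<Longrightarrow> \<exists>x. (S ^^ Suc n) x = y \<and> norm x \<le> C * norm y"
    using open_mapping_closed_range[OF bounded_clinear_funpow[OF bS] cl] by blast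
  obtain K where K: "K > 0" "\<And>x. norm ((S ^^ n) x) \<le> K * norm x"
    using bounded_clinear_bound[OF bounded_clinear_funpow[OF bS]] by blast
  define c where "c = 1 / ((1 + norm e) * C * K)"
  have M: "(1 + norm e) * C * K > 0" using C(1) K(1) by (simp add: add_pos_nonneg)
  have "bounded_below (\<lambda>x. S x + e * x)"
  proof (rule bounded_below_Peirce[of _ e 1 c])
    show "bounded_clinear (\<lambda>x. S x + e * x)" by (rule multiplier_bounded_clinear[OF e(4)])
    show "S (e * x) + e * (e * x) = e * (S x + e * x)" for x
      by (simp add: distrib_left multiplier_mult_right[OF ss S])
    show "S (e * x) + e * (e * x) = 1 *\<^sub>C (e * x)" for x
      using e(1,3) by (simp add: scaleC_one flip: mult.assoc)
    show "c > 0" using M by (simp add: c_def)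
    fix w assume w: "e * w = 0"
    obtain x where x: "(S ^^ Suc n) x = (S ^^ Suc n) w" "norm x \<le> C * norm ((S ^^ Suc n) w)"
      using C(2)[of "(S ^^ Suc n) w"] by blast
    have "(S ^^ Suc n) (w - x) = 0"
      by (simp only: bounded_clinear_diff[OF bounded_clinear_funpow[OF bS]] x(1)) simp
    then have "S (w - x) = 0" using multiplier_kernel_funpow[OF ss S] by blast
    then have "e * (w - x) = w - x" using e(2) by blast
    then have "w = x - e * x" by (simp add: right_diff_distrib w algebra_simps)
    then have "norm w \<le> norm x + norm e * norm x"
      using norm_triangle_ineq4[of x "e * x"] norm_mult_ineq[of e x] by simp
    also have "\<dots> = (1 + norm e) * norm x" by (simp add: distrib_right)
    also have "\<dots> \<le> (1 + norm e) * (C * (K * norm (S w)))"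
    proof (intro mult_left_mono order_trans[OF x(2)])
      have "(S ^^ Suc n) w = (S ^^ n) (S w)" by (simp add: funpow_swap1)
      then show "norm ((S ^^ Suc n) w) \<le> K * norm (S w)" using K(2) by metis
    qed (use C(1) in auto)
    finally show "c * norm w \<le> norm (S w + e * w)"
      using M by (simp add: w c_def field_simps)
  qed (use e(3) in simp_all)
  then show ?thesis
    using bounded_below_multiplier_invertible[OF ss comm reg taub e(4)] e(5) by blast
qed

text \<open>Since \<open>S + e - \<mu>\<close> is \<open>1 - \<mu>\<close> on the kernel of \<open>S\<close> and \<open>S - \<mu>\<close> on the complement, it is bounded below, hence
  invertible, for small \<open>\<mu> \<noteq> 0\<close>.\<close>

lemma multiplier_group_invertible_if_punctured:
  fixes S :: "'a::complex_banach_algebra \<Rightarrow> 'a"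
  assumes ss: "semisimple TYPE('a)" and comm: "commutative TYPE('a)" and reg: "regular_algebra TYPE('a)"
    and taub: "tauberian TYPE('a)" and S: "multiplier S" and fin: "nullity S < \<infinity>"
    and d: "d > 0" "\<And>\<mu>. 0 < cmod \<mu> \<Longrightarrow> cmod \<mu> < d \<Longrightarrow> bounded_below (shift S \<mu>)"
  shows "group_invertible S"
proof -
  obtain e where e: "\<forall>x. S (e * x) = 0" "\<forall>x. S x = 0 \<longrightarrow> e * x = x" "e * e = e"
      "multiplier (\<lambda>x. S x + e * x)" "invertible_operator (\<lambda>x. S x + e * x) \<longrightarrow> group_invertible S"
    by (rule multiplier_kernel_unit[OF ss comm S fin])
  let ?S = "\<lambda>x. S x + e * x"
  have zero: "x = 0" if "?S x = 0" for x
  proof -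
    have "e * ?S x = e * x" using e(1,3) by (simp add: distrib_left flip: multiplier_mult_right[OF ss S] mult.assoc)
    then have "e * x = 0" using that by simp
    then show ?thesis using that e(2) by auto
  qed
  have inj: "kernel ?S = {0}"
  proof (intro equalityI subsetI)
    show "x \<in> {0}" if "x \<in> kernel ?S" for x using zero[of x] that by simp
    show "x \<in> kernel ?S" if "x \<in> {0}" for x
      using bounded_clinear_0[OF multiplier_bounded_clinear[OF e(4)]] that by simp
  qed
  have inv: "invertible_operator (shift ?S \<mu>)" if mu: "0 < cmod \<mu>" "cmod \<mu> < min d 1" for \<mu>
  proof (rule bounded_below_multiplier_invertible[OF ss comm reg taub multiplier_shift[OF e(4)]])
    obtain c where c: "c > 0" "\<And>x. c * norm x \<le> norm (shift S \<mu> x)"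
      using d(2)[of \<mu>] mu unfolding bounded_below_def by auto
    show "bounded_below (shift ?S \<mu>)"
    proof (rule bounded_below_Peirce[of _ e "1 - \<mu>" c])
      show "bounded_clinear (shift ?S \<mu>)"
        by (rule bounded_clinear_shift[OF multiplier_bounded_clinear[OF e(4)]])
      show "shift ?S \<mu> (e * x) = e * shift ?S \<mu> x" for x
        by (rule multiplier_mult_right[OF ss multiplier_shift[OF e(4)]])
      show "1 - \<mu> \<noteq> 0" using mu by auto
      show "shift ?S \<mu> (e * x) = (1 - \<mu>) *\<^sub>C (e * x)" for x
        using e(1,3) by (simp add: shift_def complex_vector.scale_left_diff_distrib scaleC_one flip: mult.assoc)
      show "c * norm w \<le> norm (shift ?S \<mu> w)" if "e * w = 0" for w
        using c(2)[of w] that by (simp add: shift_def)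
    qed (use e(3) c(1) in simp_all)
  qed
  have "invertible_operator ?S"
    by (rule isolated_multiplier_invertible[OF ss comm reg taub e(4) inj, of "min d 1"]) (use d(1) inv in auto)
  then show ?thesis using e(5) by blast
qed

lemma shift_shift: "shift (shift T \<mu>) \<nu> = shift T (\<mu> + \<nu>)"
  by (auto simp: shift_def scaleC_add_left)

lemma isolated_in_punctured:
  assumes T: "bounded_clinear T" and iso: "\<mu> isolated_in approx_point_spectrum T"
  obtains d where "d > 0" "\<forall>\<nu>. 0 < cmod \<nu> \<longrightarrow> cmod \<nu> < d \<longrightarrow> bounded_below (shift (shift T \<mu>) \<nu>)"
proof -
  obtain d where d: "d > 0" "\<And>\<nu>. \<nu> \<in> approx_point_spectrum T \<Longrightarrow> dist \<mu> \<nu> < d \<Longrightarrow> \<nu> = \<mu>"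
    using isolated_inE_dist[OF iso] by metis
  have "bounded_below (shift (shift T \<mu>) \<nu>)" if "0 < cmod \<nu>" "cmod \<nu> < d" for \<nu>
    unfolding shift_shift not_in_approx_point_spectrum_iff[OF T, symmetric]
    using d(2)[of "\<mu> + \<nu>"] that by (auto simp: dist_norm)
  then show ?thesis using d(1) by (intro that[of d]) auto
qed

theorem multiplier_properties_z_az:
  fixes T :: "'a::complex_banach_algebra \<Rightarrow> 'a"
  assumes ss: "semisimple TYPE('a)" and comm: "commutative TYPE('a)" and reg: "regular_algebra TYPE('a)"
    and taub: "tauberian TYPE('a)" and T: "multiplier T"
  shows "property_z T \<and> property_az T"
proof (rule property_z_and_az_if_group_invertible[OF multiplier_bounded_clinear[OF T]])
  fix \<mu>
  note cr = multiplier_group_invertible_if_closed_range[OF ss comm reg taub multiplier_shift[OF T]]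
  assume fin: "nullity (shift T \<mu>) < \<infinity>"
  show "group_invertible (shift T \<mu>)" if "closed (range (shift T \<mu> ^^ Suc n))" for n
    by (rule cr[OF that fin])
  show "group_invertible (shift T \<mu>)" if iso: "\<mu> isolated_in approx_point_spectrum T"
  proof -
    obtain d where "d > 0" "\<forall>\<nu>. 0 < cmod \<nu> \<longrightarrow> cmod \<nu> < d \<longrightarrow> bounded_below (shift (shift T \<mu>) \<nu>)"
      by (rule isolated_in_punctured[OF multiplier_bounded_clinear[OF T] iso])
    then show ?thesis
      by (intro multiplier_group_invertible_if_punctured[OF ss comm reg taub multiplier_shift[OF T] fin, of d]) auto
  qed
qed

section \<open>The Hahn--Banach theorem\<close>

definition sublinear :: "('a::real_vector \<Rightarrow> real) \<Rightarrow> bool" where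
  "sublinear p \<longleftrightarrow> p 0 = 0 \<and> (\<forall>x y. p (x + y) \<le> p x + p y) \<and> (\<forall>r x. 0 < r \<longrightarrow> p (r *\<^sub>R x) \<le> r * p x)"

lemma sublinearD:
  assumes "sublinear p"
  shows "p 0 = 0" "p (x + y) \<le> p x + p y" "0 < r \<Longrightarrow> p (r *\<^sub>R x) \<le> r * p x"
  using assms unfolding sublinear_def by auto

lemma sublinear_scaleR:
  assumes p: "sublinear p" and r: "0 \<le> r" shows "p (r *\<^sub>R x) = r * p x"
proof (cases "r = 0")
  case False
  then have r: "r > 0" using r by simp
  have "p (inverse r *\<^sub>R r *\<^sub>R x) \<le> inverse r * p (r *\<^sub>R x)" using r by (intro sublinearD[OF p]) simp
  then have "r * p x \<le> p (r *\<^sub>R x)" using r by (simp add: field_simps)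
  then show ?thesis using sublinearD(3)[OF p r, of x] by simp
qed (simp add: sublinearD[OF p])

lemma sublinear_lower: "sublinear p \<Longrightarrow> - p (- x) \<le> p x"
  using sublinearD(2)[of p x "- x"] sublinearD(1)[of p] by simp

text \<open>The largest functional below \<open>p\<close> that increases with slope \<open>p y\<close> along every ray in direction \<open>y\<close>.\<close>

definition flatten :: "('a::real_vector \<Rightarrow> real) \<Rightarrow> 'a \<Rightarrow> 'a \<Rightarrow> real" where
  "flatten p y x = (INF t\<in>{0..}. p (x + t *\<^sub>R y) - t * p y)"

lemma flatten_le:
  assumes p: "sublinear p" and t: "0 \<le> t"
  shows "flatten p y x \<le> p (x + t *\<^sub>R y) - t * p y"
  unfolding flatten_def
proof (rule cINF_lower)
  show "bdd_below ((\<lambda>t. p (x + t *\<^sub>R y) - t * p y) ` {0..})"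
  proof (rule bdd_belowI2[where m = "- p (- x)"])
    fix t :: real assume "t \<in> {0..}"
    then have "t * p y = p (t *\<^sub>R y)" by (simp add: sublinear_scaleR[OF p])
    also have "\<dots> \<le> p (x + t *\<^sub>R y) + p (- x)" using sublinearD(2)[OF p, of "x + t *\<^sub>R y" "- x"] by simp
    finally show "- p (- x) \<le> p (x + t *\<^sub>R y) - t * p y" by simp
  qed
qed (use t in simp)

lemma le_flatten:
  "(\<And>t. 0 \<le> t \<Longrightarrow> c \<le> p (x + t *\<^sub>R y) - t * p y) \<Longrightarrow> c \<le> flatten p y x"
  unfolding flatten_def by (rule cINF_greatest) auto

lemma sublinear_flatten:
  assumes p: "sublinear p" shows "sublinear (flatten p y)"
  unfolding sublinear_def
proof (intro conjI allI impI)
  show "flatten p y 0 = 0"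
  proof (rule antisym)
    show "flatten p y 0 \<le> 0" using flatten_le[OF p order_refl, of y 0] by (simp add: sublinearD(1)[OF p])
    show "0 \<le> flatten p y 0" by (rule le_flatten) (simp add: sublinear_scaleR[OF p])
  qed
  fix x z
  have "flatten p y (x + z) \<le> (p (x + t *\<^sub>R y) - t * p y) + (p (z + s *\<^sub>R y) - s * p y)"
    if "0 \<le> t" "0 \<le> s" for t s
  proof -
    have "flatten p y (x + z) \<le> p (x + z + (t + s) *\<^sub>R y) - (t + s) * p y" using that by (intro flatten_le p) simp
    also have "x + z + (t + s) *\<^sub>R y = (x + t *\<^sub>R y) + (z + s *\<^sub>R y)" by (simp add: scaleR_add_left)
    also have "p \<dots> \<le> p (x + t *\<^sub>R y) + p (z + s *\<^sub>R y)" by (rule sublinearD(2)[OF p])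
    finally show ?thesis by (simp add: algebra_simps)
  qed
  note both = this
  have one: "flatten p y (x + z) - (p (x + t *\<^sub>R y) - t * p y) \<le> flatten p y z" if t: "0 \<le> t" for t
  proof (rule le_flatten)
    fix s :: real assume "0 \<le> s"
    then show "flatten p y (x + z) - (p (x + t *\<^sub>R y) - t * p y) \<le> p (z + s *\<^sub>R y) - s * p y"
      using both[OF t, of s] by linarith
  qed
  have "flatten p y (x + z) - flatten p y z \<le> flatten p y x"
  proof (rule le_flatten)
    fix t :: real assume "0 \<le> t"
    then show "flatten p y (x + z) - flatten p y z \<le> p (x + t *\<^sub>R y) - t * p y"
      using one[of t] by linarith
  qed
  then show "flatten p y (x + z) \<le> flatten p y x + flatten p y z" by simp
next
  fix r :: real and x assume r: "0 < r"
  have "inverse r * flatten p y (r *\<^sub>R x) \<le> flatten p y x"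
  proof (rule le_flatten)
    fix t :: real assume "0 \<le> t"
    then have "flatten p y (r *\<^sub>R x) \<le> p (r *\<^sub>R x + (r * t) *\<^sub>R y) - r * t * p y" using r by (intro flatten_le p) simp
    also have "r *\<^sub>R x + (r * t) *\<^sub>R y = r *\<^sub>R (x + t *\<^sub>R y)" by (simp add: scaleR_add_right)
    also have "p \<dots> = r * p (x + t *\<^sub>R y)" using r by (intro sublinear_scaleR[OF p]) simp
    finally show "inverse r * flatten p y (r *\<^sub>R x) \<le> p (x + t *\<^sub>R y) - t * p y"
      using r by (simp add: field_simps)
  qed
  then show "flatten p y (r *\<^sub>R x) \<le> r * flatten p y x" using r by (simp add: field_simps)
qed

text \<open>The pointwise infimum of a chain of sublinear functionals below \<open>p\<close> is sublinear; it is finite because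
  \<open>- p (- x)\<close> is a common lower bound at \<open>x\<close>.\<close>

lemma minimal_sublinear_exists:
  assumes p: "sublinear p"
  obtains m where "sublinear m" "m \<le> p" "\<forall>q. sublinear q \<longrightarrow> q \<le> m \<longrightarrow> q = m"
proof -
  let ?A = "{q. sublinear q \<and> q \<le> p}" and ?P = "\<lambda>q r :: 'a \<Rightarrow> real. r \<le> q"
  have "\<exists>m\<in>?A. \<forall>q\<in>?A. ?P m q \<longrightarrow> q = m"
  proof (rule predicate_Zorn)
    show "partial_order_on ?A (relation_of ?P ?A)"
      by (rule partial_order_on_relation_ofI) auto
    fix C assume C: "C \<in> Chains (relation_of ?P ?A)"
    have CA: "C \<subseteq> ?A" using C unfolding Chains_def relation_of_def by auto
    have chain: "q \<le> r \<or> r \<le> q" if "q \<in> C" "r \<in> C" for q r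
      using C that unfolding Chains_def relation_of_def by auto
    have sub: "sublinear q" and le: "q \<le> p" if "q \<in> C" for q using CA that by auto
    show "\<exists>u\<in>?A. \<forall>q\<in>C. u \<le> q"
    proof (cases "C = {}")
      case True
      then show ?thesis using p by auto
    next
      case False
      then obtain q0 where q0: "q0 \<in> C" by auto
      define u where "u x = (INF q\<in>C. q x)" for x
      have bdd: "bdd_below ((\<lambda>q. q x) ` C)" for x
      proof (rule bdd_belowI2[where m = "- p (- x)"])
        fix q assume q: "q \<in> C"
        have "q (- x) \<le> p (- x)" using le[OF q] by (rule le_funD)
        then show "- p (- x) \<le> q x" using sublinear_lower[OF sub[OF q], of x] by simp
      qed
      have u_le: "u x \<le> q x" if "q \<in> C" for q x unfolding u_def by (rule cINF_lower[OF bdd that])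
      have le_u: "c \<le> u x" if "\<And>q. q \<in> C \<Longrightarrow> c \<le> q x" for c x
        unfolding u_def by (rule cINF_greatest[OF False that])
      have "sublinear u"
        unfolding sublinear_def
      proof (intro conjI allI impI)
        show "u 0 = 0"
        proof (rule antisym)
          show "u 0 \<le> 0" using u_le[OF q0, of 0] sublinearD(1)[OF sub[OF q0]] by simp
          show "0 \<le> u 0" by (rule le_u) (simp add: sublinearD(1)[OF sub])
        qed
        fix x y
        have "u (x + y) \<le> q x + r y" if q: "q \<in> C" and r: "r \<in> C" for q r
        proof -
          have *: "u (x + y) \<le> s x + s y" if "s \<in> C" for s
            using order_trans[OF u_le[OF that] sublinearD(2)[OF sub[OF that]]] .
          show ?thesis
            using chain[OF q r]
          proof
            assume "q \<le> r"
            then show ?thesis using *[OF q] le_funD[of q r y] by simp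
          next
            assume "r \<le> q"
            then show ?thesis using *[OF r] le_funD[of r q x] by simp
          qed
        qed
        note both = this
        have one: "u (x + y) - q x \<le> u y" if q: "q \<in> C" for q
        proof (rule le_u)
          show "u (x + y) - q x \<le> r y" if "r \<in> C" for r using both[OF q that] by simp
        qed
        have "u (x + y) - u y \<le> u x"
        proof (rule le_u)
          show "u (x + y) - u y \<le> q x" if "q \<in> C" for q using one[OF that] by simp
        qed
        then show "u (x + y) \<le> u x + u y" by simp
      next
        fix r :: real and x assume r: "0 < r"
        have "inverse r * u (r *\<^sub>R x) \<le> u x"
        proof (rule le_u)
          fix q assume q: "q \<in> C"
          have "u (r *\<^sub>R x) \<le> r * q x" using order_trans[OF u_le[OF q] sublinearD(3)[OF sub[OF q] r]] .
          then show "inverse r * u (r *\<^sub>R x) \<le> q x" using r by (simp add: field_simps)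
        qed
        then show "u (r *\<^sub>R x) \<le> r * u x" using r by (simp add: field_simps)
      qed
      moreover have "u \<le> q" if "q \<in> C" for q using u_le[OF that] by (rule le_funI)
      moreover have "u \<le> p" using \<open>\<And>q. q \<in> C \<Longrightarrow> u \<le> q\<close>[OF q0] le[OF q0] by (rule order_trans)
      ultimately show ?thesis by auto
    qed
  qed
  then obtain m where m: "sublinear m" "m \<le> p" "\<forall>q\<in>?A. q \<le> m \<longrightarrow> q = m" by auto
  have "q = m" if "sublinear q" "q \<le> m" for q
    using m(3) that order_trans[OF that(2) m(2)] by auto
  then show ?thesis using that m(1,2) by auto
qed

text \<open>A minimal sublinear functional is unchanged by flattening in any direction, hence additive.
  Flattening \<open>p\<close> itself in direction \<open>y\<close> beforehand forces the value at \<open>y\<close>.\<close>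

lemma Hahn_Banach_real:
  fixes p :: "'a::real_vector \<Rightarrow> real"
  assumes p: "sublinear p"
  obtains g where "linear g" "\<forall>x. g x \<le> p x" "p y \<le> g y"
proof -
  obtain m where m: "sublinear m" "m \<le> flatten p y" "\<forall>q. sublinear q \<longrightarrow> q \<le> m \<longrightarrow> q = m"
    by (rule minimal_sublinear_exists[OF sublinear_flatten[OF p]])
  have flat: "flatten m z = m" for z
  proof -
    have "flatten m z x \<le> m x" for x using flatten_le[OF m(1) order_refl, of z x] by simp
    then have "flatten m z \<le> m" by (rule le_funI)
    then show ?thesis using m(3) sublinear_flatten[OF m(1)] by blast
  qed
  have add: "m (x + z) = m x + m z" for x z
  proof (rule antisym)
    show "m (x + z) \<le> m x + m z" by (rule sublinearD(2)[OF m(1)])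
    have "m x \<le> m (x + z) - m z" using flatten_le[OF m(1) zero_le_one, of z x] flat[of z] by simp
    then show "m x + m z \<le> m (x + z)" by simp
  qed
  have neg: "m (- x) = - m x" for x using add[of x "- x"] sublinearD(1)[OF m(1)] by simp
  have scale: "m (r *\<^sub>R x) = r * m x" for r x
  proof (cases "0 \<le> r")
    case False
    then have "m ((- r) *\<^sub>R x) = (- r) * m x" by (intro sublinear_scaleR[OF m(1)]) simp
    then show ?thesis using neg[of "r *\<^sub>R x"] by simp
  qed (rule sublinear_scaleR[OF m(1)])
  have "linear m" by (rule linearI) (simp_all add: add scale)
  moreover have "m x \<le> p x" for x
    using le_funD[OF m(2), of x] flatten_le[OF p order_refl, of y x] by simp
  moreover have "p y \<le> m y"
    using le_funD[OF m(2), of "- y"] flatten_le[OF p zero_le_one, of y "- y"] neg[of y] sublinearD(1)[OF p] by simp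
  ultimately show ?thesis by (intro that[of m]) auto
qed

text \<open>A real functional \<open>g\<close> is the real part of the complex functional \<open>g x - \<i> g (\<i> x)\<close>. The bound for \<open>g\<close> carries
  over to its modulus after rotating \<open>x\<close> by a scalar of modulus \<open>1\<close>.\<close>

lemma Hahn_Banach_seminorm:
  fixes p :: "'a::complex_normed_vector \<Rightarrow> real"
  assumes add: "\<And>x z. p (x + z) \<le> p x + p z" and scale: "\<And>c x. p (c *\<^sub>C x) \<le> cmod c * p x"
    and bound: "\<And>x. p x \<le> K * norm x"
  obtains F :: "'a \<Rightarrow> complex" where "bounded_clinear F" "\<forall>x. cmod (F x) \<le> p x" "p y \<le> cmod (F y)"
proof -
  have p0: "p 0 = 0"
    using scale[of 0 0] add[of 0 0] by simp
  have pR: "p (r *\<^sub>R x) \<le> r * p x" if "0 < r" for r x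
    using scale[of "of_real r" x] that by (simp add: scaleC_of_real)
  have "sublinear p" unfolding sublinear_def using p0 add pR by auto
  then obtain g where g: "linear g" "\<forall>x. g x \<le> p x" "p y \<le> g y" by (rule Hahn_Banach_real)
  define F where "F x = Complex (g x) (- g (\<i> *\<^sub>C x))" for x
  have Fadd: "F (x + z) = F x + F z" for x z
    by (simp add: F_def scaleC_add_right linear_add[OF g(1)] complex_eq_iff)
  have FR: "F (of_real r *\<^sub>C x) = of_real r * F x" for r x
  proof -
    have "\<i> *\<^sub>C r *\<^sub>R x = r *\<^sub>R \<i> *\<^sub>C x"
      by (simp only: scaleC_of_real[symmetric] scaleC_scaleC mult.commute)
    then show ?thesis by (simp add: F_def scaleC_of_real linear_scale[OF g(1)] complex_eq_iff)
  qed
  have Fi: "F (\<i> *\<^sub>C x) = \<i> * F x" for x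
  proof -
    have "\<i> *\<^sub>C \<i> *\<^sub>C x = - x"
      using complex_vector.scale_minus_left[of 1 x] by (simp add: scaleC_scaleC scaleC_one)
    then show ?thesis by (simp add: F_def linear_neg[OF g(1)] complex_eq_iff)
  qed
  have Fscale: "F (c *\<^sub>C x) = c * F x" for c x
  proof -
    have "c *\<^sub>C x = of_real (Re c) *\<^sub>C x + \<i> *\<^sub>C of_real (Im c) *\<^sub>C x"
      unfolding scaleC_scaleC scaleC_add_left[symmetric] complex_eq[symmetric] ..
    then have "F (c *\<^sub>C x) = of_real (Re c) * F x + \<i> * (of_real (Im c) * F x)"
      by (simp only: Fadd Fi FR)
    also have "\<dots> = (of_real (Re c) + \<i> * of_real (Im c)) * F x" by (simp add: algebra_simps)
    finally show ?thesis by (simp only: complex_eq[symmetric])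
  qed
  have le: "cmod (F x) \<le> p x" for x
  proof -
    define c where "c = cnj (sgn (F x))"
    have "F (c *\<^sub>C x) = of_real (cmod (F x))"
    proof (cases "F x = 0")
      case False
      have "cnj (sgn (F x)) * F x = of_real (cmod (F x))"
        using False by (simp add: sgn_eq complex_norm_square[symmetric] mult.commute[of "cnj (F x)"] power2_eq_square)
      then show ?thesis by (simp add: Fscale c_def)
    qed (simp add: Fscale)
    then have "cmod (F x) = Re (F (c *\<^sub>C x))" by simp
    also have "\<dots> = g (c *\<^sub>C x)" by (simp add: F_def)
    also have "\<dots> \<le> p (c *\<^sub>C x)" using g(2) by simp
    also have "\<dots> \<le> cmod c * p x" by (rule scale)
    also have "\<dots> \<le> p x"
    proof -
      have "p (x + - 1 *\<^sub>C x) \<le> p x + p (- 1 *\<^sub>C x)" by (rule add)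
      also have "p (- 1 *\<^sub>C x) \<le> p x" using scale[of "- 1" x] by simp
      finally have "p x \<ge> 0" using p0 complex_vector.scale_minus_left[of 1 x] by (simp add: scaleC_one)
      moreover have "cmod c \<le> 1" by (simp add: c_def norm_sgn)
      ultimately show ?thesis using mult_right_mono[of "cmod c" 1 "p x"] by simp
    qed
    finally show ?thesis .
  qed
  have "bounded_clinear F"
    by (rule bounded_clinearI[where K = K])
      (simp_all add: Fadd Fscale scaleC_complex_def order_trans[OF le bound])
  moreover have "p y \<le> cmod (F y)"
    using g(3) complex_Re_le_cmod[of "F y"] by (simp add: F_def)
  ultimately show ?thesis using le by (intro that[of F]) auto
qed

section \<open>Dual operators\<close>

lemma bounded_clinear_cdual_apply: "bounded_clinear (cdual_apply f)"
proof -
  have "cdual_apply f (c *\<^sub>C x) = c * cdual_apply f x" for c x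
    using Rep_cdual[of f] by (simp add: cdual_apply.rep_eq)
  then show ?thesis
    unfolding bounded_clinear_def scaleC_complex_def
    by (simp add: cdual_apply.rep_eq blinfun.bounded_linear_right)
qed

lemma norm_cdual_apply_le: "cmod (cdual_apply f x) \<le> norm f * norm x"
  by (simp add: cdual_apply.rep_eq norm_cdual.rep_eq norm_blinfun)

lemma cdual_eqI: "(\<And>x. cdual_apply f x = cdual_apply g x) \<Longrightarrow> f = g"
  by (simp add: cdual_apply.rep_eq Rep_cdual_inject[symmetric] blinfun_eqI)

lemma cdual_apply_add: "cdual_apply (f + g) x = cdual_apply f x + cdual_apply g x"
  by (simp add: cdual_apply.rep_eq plus_cdual.rep_eq blinfun.add_left)

lemma cdual_apply_diff: "cdual_apply (f - g) x = cdual_apply f x - cdual_apply g x"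
  by (simp add: cdual_apply.rep_eq minus_cdual.rep_eq blinfun.diff_left)

lemma cdual_apply_zero: "cdual_apply 0 x = 0"
  by (simp add: cdual_apply.rep_eq zero_cdual.rep_eq)

lemma cdual_apply_scaleC: "cdual_apply (c *\<^sub>C f) x = c * cdual_apply f x"
  by (simp add: cdual_apply.rep_eq scaleC_cdual.rep_eq)

lemmas cdual_apply_simps = cdual_apply_add cdual_apply_diff cdual_apply_zero cdual_apply_scaleC

lemma norm_cdual_leI:
  assumes "0 \<le> K" "\<And>x. cmod (cdual_apply f x) \<le> K * norm x"
  shows "norm f \<le> K"
  using assms unfolding norm_cdual.rep_eq cdual_apply.rep_eq by (rule norm_blinfun_bound)

lemma cdual_of_functional:
  assumes "bounded_clinear F"
  obtains f where "\<forall>x. cdual_apply f x = F x"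
proof -
  have "blinfun_apply (Blinfun F) = F"
    using assms by (intro bounded_linear_Blinfun_apply) (simp add: bounded_clinear_def)
  then have "cdual_apply (Abs_cdual (Blinfun F)) x = F x" for x
    using bounded_clinear_scaleC[OF assms]
    by (simp add: cdual_apply.rep_eq Abs_cdual_inverse scaleC_complex_def)
  then show ?thesis by (intro that[of "Abs_cdual (Blinfun F)"]) simp
qed

lemma bounded_clinear_dual_operator:
  assumes S: "bounded_clinear S" shows "bounded_clinear (dual_operator S)"
proof -
  note ap = cdual_apply_dual_operator[OF S]
  obtain K where K: "K > 0" "\<And>x. norm (S x) \<le> K * norm x" using bounded_clinear_bound[OF S] by metis
  show ?thesis
  proof (rule bounded_clinearI[where K = K])
    show "dual_operator S (f + g) = dual_operator S f + dual_operator S g" for f g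
      by (rule cdual_eqI) (simp add: ap cdual_apply_simps)
    show "dual_operator S (c *\<^sub>C f) = c *\<^sub>C dual_operator S f" for c f
      by (rule cdual_eqI) (simp add: ap cdual_apply_simps)
    show "norm (dual_operator S f) \<le> K * norm f" for f
    proof (rule norm_cdual_leI)
      show "0 \<le> K * norm f" using K(1) by simp
      fix x
      have "cmod (cdual_apply (dual_operator S f) x) \<le> norm f * norm (S x)"
        unfolding ap by (rule norm_cdual_apply_le)
      also have "\<dots> \<le> norm f * (K * norm x)" by (intro mult_left_mono K(2)) simp
      finally show "cmod (cdual_apply (dual_operator S f) x) \<le> K * norm f * norm x" by (simp add: mult_ac)
    qed
  qed
qed

lemma dual_operator_shift:
  assumes T: "bounded_clinear T" shows "shift (dual_operator T) \<mu> = dual_operator (shift T \<mu>)"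
proof (rule ext, rule cdual_eqI)
  fix f x
  have "cdual_apply (shift (dual_operator T) \<mu> f) x = cdual_apply f (shift T \<mu> x)"
    unfolding shift_def
    by (simp add: cdual_apply_simps cdual_apply_dual_operator[OF T]
        bounded_clinear_diff[OF bounded_clinear_cdual_apply]
        bounded_clinear_scaleC[OF bounded_clinear_cdual_apply] scaleC_complex_def)
  then show "cdual_apply (shift (dual_operator T) \<mu> f) x = cdual_apply (dual_operator (shift T \<mu>) f) x"
    by (simp only: cdual_apply_dual_operator[OF bounded_clinear_shift[OF T]])
qed

lemma dual_operator_funpow:
  fixes S :: "'a::complex_normed_vector \<Rightarrow> 'a"
  assumes S: "bounded_clinear S" shows "dual_operator S ^^ n = dual_operator (S ^^ n)"
proof (rule ext, rule cdual_eqI)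
  fix f x
  have "cdual_apply ((dual_operator S ^^ n) f) x = cdual_apply f ((S ^^ n) x)" for x
  proof (induction n arbitrary: x)
    case (Suc n)
    then show ?case by (simp add: cdual_apply_dual_operator[OF S]) (simp add: funpow_swap1)
  qed simp
  then show "cdual_apply ((dual_operator S ^^ n) f) x = cdual_apply (dual_operator (S ^^ n) f) x"
    by (simp add: cdual_apply_dual_operator[OF bounded_clinear_funpow[OF S]])
qed

lemma invertible_operator_dual:
  assumes "bounded_clinear S" "invertible_operator S"
  shows "invertible_operator (dual_operator S)"
proof -
  obtain V where V: "bounded_clinear V" "\<And>x. V (S x) = x" "\<And>x. S (V x) = x"
    using invertible_operatorE[OF assms(2)] by metis
  show ?thesis
    by (rule invertible_operatorI[OF bounded_clinear_dual_operator[OF V(1)]]; rule cdual_eqI)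
      (simp_all add: cdual_apply_dual_operator assms(1) V)
qed

lemma group_invertible_dual:
  assumes S: "bounded_clinear S" and g: "group_invertible S"
  shows "group_invertible (dual_operator S)"
proof -
  obtain P where P: "bounded_clinear P" "\<forall>x. P (P x) = P x" "\<forall>x. S (P x) = 0" "\<forall>x. P (S x) = 0"
      "invertible_operator (\<lambda>x. S x + P x)"
    using g unfolding group_invertible_def by auto
  have SP: "bounded_clinear (\<lambda>x. S x + P x)" by (rule bounded_clinear_plus[OF S P(1)])
  have sum: "dual_operator (\<lambda>x. S x + P x) = (\<lambda>f. dual_operator S f + dual_operator P f)"
    by (rule ext, rule cdual_eqI)
      (simp add: cdual_apply_dual_operator SP S P(1) cdual_apply_simps
        bounded_clinear_add[OF bounded_clinear_cdual_apply])
  have zero: "cdual_apply f 0 = 0" for f :: "'a cdual" by (rule bounded_clinear_0[OF bounded_clinear_cdual_apply])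
  show ?thesis
    unfolding group_invertible_def
  proof (intro exI[of _ "dual_operator P"] conjI allI)
    show "invertible_operator (\<lambda>f. dual_operator S f + dual_operator P f)"
      using invertible_operator_dual[OF SP P(5)] unfolding sum .
  qed (auto intro!: cdual_eqI bounded_clinear_dual_operator
      simp: cdual_apply_dual_operator S P zero cdual_apply_zero)
qed

text \<open>This is the Hahn--Banach theorem for the distance to \<open>Y\<close>, which is a seminorm.\<close>

lemma separating_functional:
  fixes Y :: "'a::complex_normed_vector set"
  assumes Y: "csubspace Y" and x: "x \<notin> closure Y"
  obtains f where "\<forall>y\<in>Y. cdual_apply f y = 0" "cdual_apply f x \<noteq> 0"
proof -
  have ne: "Y \<noteq> {}" using complex_vector.subspace_0[OF Y] by auto
  have bound: "infdist z Y \<le> 1 * norm z" for z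
    using infdist_le[OF complex_vector.subspace_0[OF Y], of z] by simp
  obtain F :: "'a \<Rightarrow> complex" where F: "bounded_clinear F" "\<forall>z. cmod (F z) \<le> infdist z Y" "infdist x Y \<le> cmod (F x)"
    by (rule Hahn_Banach_seminorm[OF infdist_add_le[OF Y] _ bound]) (simp_all add: infdist_scaleC[OF Y])
  obtain f where f: "\<forall>z. cdual_apply f z = F z" by (rule cdual_of_functional[OF F(1)])
  have "F y = 0" if "y \<in> Y" for y using F(2)[rule_format, of y] that by simp
  moreover have "infdist x Y > 0"
    using x in_closure_iff_infdist_zero[OF ne, of x] infdist_nonneg[of x Y] by linarith
  then have "F x \<noteq> 0" using F(3) by auto
  ultimately show ?thesis using f by (intro that[of f]) auto
qed

text \<open>The gauge of the convex hull of \<open>S(B)\<close> and \<open>\<epsilon> B\<close>, where \<open>B\<close> denotes the unit balls.\<close>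

definition image_seminorm ::
    "('a::complex_normed_vector \<Rightarrow> 'b::complex_normed_vector) \<Rightarrow> real \<Rightarrow> 'b \<Rightarrow> real" where
  "image_seminorm S \<epsilon> y = (INF x. norm x + norm (y - S x) / \<epsilon>)"

lemma image_seminorm_le: "\<epsilon> > 0 \<Longrightarrow> image_seminorm S \<epsilon> y \<le> norm x + norm (y - S x) / \<epsilon>"
  unfolding image_seminorm_def by (rule cINF_lower) (auto intro!: bdd_belowI2[where m = 0])

lemma le_image_seminorm: "(\<And>x. c \<le> norm x + norm (y - S x) / \<epsilon>) \<Longrightarrow> c \<le> image_seminorm S \<epsilon> y"
  unfolding image_seminorm_def by (rule cINF_greatest) auto

lemma image_seminorm_add:
  assumes S: "bounded_clinear S" and e: "\<epsilon> > 0"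
  shows "image_seminorm S \<epsilon> (y + z) \<le> image_seminorm S \<epsilon> y + image_seminorm S \<epsilon> z"
proof -
  let ?p = "image_seminorm S \<epsilon>"
  have both: "?p (y + z) \<le> (norm u + norm (y - S u) / \<epsilon>) + (norm v + norm (z - S v) / \<epsilon>)" for u v
  proof -
    have "?p (y + z) \<le> norm (u + v) + norm (y + z - S (u + v)) / \<epsilon>" by (rule image_seminorm_le[OF e])
    also have "y + z - S (u + v) = (y - S u) + (z - S v)" by (simp add: bounded_clinear_add[OF S])
    also have "norm (u + v) + norm \<dots> / \<epsilon> \<le> (norm u + norm v) + (norm (y - S u) + norm (z - S v)) / \<epsilon>"
      using e by (intro add_mono divide_right_mono norm_triangle_ineq) auto
    finally show ?thesis by (simp add: add_divide_distrib)
  qed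
  have one: "?p (y + z) - (norm u + norm (y - S u) / \<epsilon>) \<le> ?p z" for u
  proof (rule le_image_seminorm)
    show "?p (y + z) - (norm u + norm (y - S u) / \<epsilon>) \<le> norm v + norm (z - S v) / \<epsilon>" for v
      using both[of u v] by linarith
  qed
  have "?p (y + z) - ?p z \<le> ?p y"
  proof (rule le_image_seminorm)
    show "?p (y + z) - ?p z \<le> norm u + norm (y - S u) / \<epsilon>" for u
      using one[of u] by linarith
  qed
  then show ?thesis by simp
qed

lemma image_seminorm_scaleC:
  assumes S: "bounded_clinear S" and e: "\<epsilon> > 0"
  shows "image_seminorm S \<epsilon> (c *\<^sub>C y) \<le> cmod c * image_seminorm S \<epsilon> y"
proof (cases "c = 0")
  case True
  then show ?thesis using image_seminorm_le[OF e, of S 0 0] bounded_clinear_0[OF S] by simp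
next
  case False
  have "image_seminorm S \<epsilon> (c *\<^sub>C y) / cmod c \<le> image_seminorm S \<epsilon> y"
  proof (rule le_image_seminorm)
    fix x
    have "image_seminorm S \<epsilon> (c *\<^sub>C y) \<le> norm (c *\<^sub>C x) + norm (c *\<^sub>C y - S (c *\<^sub>C x)) / \<epsilon>"
      by (rule image_seminorm_le[OF e])
    also have "c *\<^sub>C y - S (c *\<^sub>C x) = c *\<^sub>C (y - S x)"
      by (simp only: bounded_clinear_scaleC[OF S] complex_vector.scale_right_diff_distrib)
    finally have "image_seminorm S \<epsilon> (c *\<^sub>C y) \<le> cmod c * (norm x + norm (y - S x) / \<epsilon>)"
      by (simp add: norm_scaleC distrib_left)
    then show "image_seminorm S \<epsilon> (c *\<^sub>C y) / cmod c \<le> norm x + norm (y - S x) / \<epsilon>"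
      using False by (simp add: pos_divide_le_eq mult.commute)
  qed
  then show ?thesis using False by (simp add: field_simps)
qed

text \<open>The difficult half of the closed range theorem. A functional \<open>F\<close> bounded by the seminorm above
  satisfies \<open>\<parallel>S\<^sup>* F\<parallel> \<le> 1\<close>, so it may be replaced by one of norm at most \<open>C\<close> with
  the same values on the closure of the range. Hence the seminorm is at most \<open>C \<parallel>y\<parallel>\<close> there, which
  means that \<open>S x = y\<close> is approximately solvable with control of \<open>x\<close>.\<close>

lemma closed_range_of_dual:
  fixes S :: "'a::complex_banach \<Rightarrow> 'b::complex_banach"
  assumes S: "bounded_clinear S" and cl: "closed (range (dual_operator S))"
  shows "closed (range S)"
proof -
  note ap = cdual_apply_dual_operator[OF S]
  obtain C where C: "C > 0" "\<And>g. g \<in> range (dual_operator S) \<Longrightarrow> \<exists>f. dual_operator S f = g \<and> norm f \<le> C * norm g"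
    using open_mapping_closed_range[OF bounded_clinear_dual_operator[OF S] cl] by blast
  define Y where "Y = closure (range S)"
  have Y: "csubspace Y" unfolding Y_def by (rule csubspace_closure[OF csubspace_range[OF S]])
  have SY: "range S \<subseteq> Y" unfolding Y_def by (rule closure_subset)
  have bound: "image_seminorm S \<epsilon> y \<le> C * norm y" if y: "y \<in> Y" and e: "\<epsilon> > 0" for y \<epsilon>
  proof -
    have le: "image_seminorm S \<epsilon> z \<le> 1 / \<epsilon> * norm z" for z
      using image_seminorm_le[OF e, of S z 0] bounded_clinear_0[OF S] by simp
    obtain F where F: "bounded_clinear F" "\<forall>z. cmod (F z) \<le> image_seminorm S \<epsilon> z"
        "image_seminorm S \<epsilon> y \<le> cmod (F y)"
      by (rule Hahn_Banach_seminorm[OF image_seminorm_add[OF S e] image_seminorm_scaleC[OF S e] le])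
    obtain f where f: "\<forall>z. cdual_apply f z = F z" by (rule cdual_of_functional[OF F(1)])
    have f1: "norm (dual_operator S f) \<le> 1"
    proof (rule norm_cdual_leI)
      show "cmod (cdual_apply (dual_operator S f) x) \<le> 1 * norm x" for x
        using order_trans[OF F(2)[rule_format, of "S x"] image_seminorm_le[OF e, of S "S x" x]] by (simp add: ap f)
    qed simp
    obtain h where h: "dual_operator S h = dual_operator S f" "norm h \<le> C * norm (dual_operator S f)"
      using C(2)[of "dual_operator S f"] by blast
    have hC: "norm h \<le> C" using order_trans[OF h(2) mult_left_mono[OF f1, of C]] C(1) by simp
    have "range S \<subseteq> kernel (cdual_apply (h - f))"
    proof (rule image_subsetI, rule CollectI)
      show "cdual_apply (h - f) (S x) = 0" for x
        using h(1) ap[of h x] ap[of f x] by (simp add: cdual_apply_diff)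
    qed
    then have "Y \<subseteq> kernel (cdual_apply (h - f))"
      unfolding Y_def by (rule closure_minimal) (rule closed_kernel[OF bounded_clinear_cdual_apply])
    then have "cdual_apply h y = F y" using y f by (auto simp: cdual_apply_diff)
    then have "image_seminorm S \<epsilon> y \<le> norm h * norm y" using F(3) norm_cdual_apply_le[of h y] by simp
    also have "\<dots> \<le> C * norm y" by (intro mult_right_mono hC) simp
    finally show ?thesis .
  qed
  have approx: "\<exists>x. norm x \<le> (C + 1) * norm y \<and> norm (y - S x) \<le> e" if y: "y \<in> Y" and e: "e > 0" for y e
  proof (cases "y = 0")
    case True
    then show ?thesis using e bounded_clinear_0[OF S] by (intro exI[of _ 0]) simp
  next
    case False
    define k where "k = (C + 1) * norm y"
    have k: "k > 0" using False C(1) by (simp add: k_def)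
    define \<epsilon> where "\<epsilon> = e / k"
    have eps: "\<epsilon> > 0" using e k by (simp add: \<epsilon>_def)
    have "norm y > 0" using False by simp
    then have "image_seminorm S \<epsilon> y < k" using bound[OF y eps] unfolding k_def distrib_right by linarith
    then have "\<not> (\<forall>x. k \<le> norm x + norm (y - S x) / \<epsilon>)" using le_image_seminorm[of k y S \<epsilon>] by auto
    then obtain x where x: "norm x + norm (y - S x) / \<epsilon> < k" by (auto simp: not_le)
    have "norm (y - S x) / \<epsilon> \<ge> 0" using eps by simp
    then have "norm x \<le> k" using x by linarith
    moreover have "norm (y - S x) / \<epsilon> \<le> k" using x norm_ge_zero[of x] by linarith
    then have "norm (y - S x) \<le> e" using eps k by (simp add: \<epsilon>_def field_simps)
    ultimately show ?thesis unfolding k_def by blast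
  qed
  have "Y \<subseteq> range S"
  proof
    fix y assume "y \<in> Y"
    moreover have "C + 1 > 0" using C(1) by simp
    ultimately have "\<exists>x. S x = y \<and> norm x \<le> 2 * (C + 1) * norm y"
      by (intro almost_open_imp_open[OF S Y SY _ approx])
    then show "y \<in> range S" by auto
  qed
  then have "closure (range S) = range S" using SY unfolding Y_def by (rule equalityI)
  then show ?thesis by (simp only: closure_eq)
qed

text \<open>The range of \<open>S\<close> is closed, and a functional vanishing on it is in the kernel of \<open>S\<^sup>*\<close>.\<close>

lemma surj_if_dual_bounded_below:
  fixes S :: "'a::complex_banach \<Rightarrow> 'b::complex_banach"
  assumes S: "bounded_clinear S" and bb: "bounded_below (dual_operator S)"
  shows "range S = UNIV"
proof (rule ccontr)
  assume "range S \<noteq> UNIV"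
  then obtain x where x: "x \<notin> range S" by auto
  have "closed (range S)"
    by (rule closed_range_of_dual[OF S bounded_below_closed_range[OF bounded_clinear_dual_operator[OF S] bb]])
  then have "x \<notin> closure (range S)" using x by simp
  then obtain f where f: "\<forall>y\<in>range S. cdual_apply f y = 0" "cdual_apply f x \<noteq> 0"
    by (rule separating_functional[OF csubspace_range[OF S]])
  have "dual_operator S f = 0"
    by (rule cdual_eqI) (simp add: cdual_apply_dual_operator[OF S] f(1) cdual_apply_zero)
  moreover obtain c where c: "c > 0" "\<And>f. c * norm f \<le> norm (dual_operator S f)"
    using bb unfolding bounded_below_def by auto
  ultimately have "c * norm f \<le> 0" using c(2)[of f] by simp
  then have "f = 0" using c(1) by (simp add: mult_le_0_iff)
  then show False using f(2) by (simp add: cdual_apply_zero)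
qed

text \<open>The functionals in the kernel of \<open>S\<^sup>*\<close> separate the points of the kernel of \<open>S\<close>, since the
  latter meets the closure of the range only in \<open>0\<close>.\<close>

lemma multiplier_nullity_finite_if_dual:
  fixes S :: "'a::complex_banach_algebra \<Rightarrow> 'a"
  assumes ss: "semisimple TYPE('a)" and S: "multiplier S" and fin: "nullity (dual_operator S) < \<infinity>"
  shows "nullity S < \<infinity>"
proof -
  have bS: "bounded_clinear S" by (rule multiplier_bounded_clinear[OF S])
  obtain B where B: "finite B" "cspan B = kernel (dual_operator S)"
    by (rule edim_finiteE[OF fin[unfolded nullity_def]])
  have "\<exists>F. finite F \<and> kernel S \<subseteq> cspan F"
  proof (rule edim_finite_if_separated[of "cdual_apply ` B"])
    show "finite (cdual_apply ` B)" using B(1) by simp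
    show "csubspace (kernel S)" by (rule csubspace_kernel[OF bS])
    show "bounded_clinear f" if "f \<in> cdual_apply ` B" for f
      using that bounded_clinear_cdual_apply by auto
    fix x assume x: "x \<in> kernel S" and zero: "\<And>f. f \<in> cdual_apply ` B \<Longrightarrow> f x = 0"
    have "csubspace {f. cdual_apply f x = 0}"
      by (rule complex_vector.subspaceI) (simp_all add: cdual_apply_simps)
    moreover have "B \<subseteq> {f. cdual_apply f x = 0}" using zero by auto
    ultimately have "cspan B \<subseteq> {f. cdual_apply f x = 0}" by (intro complex_vector.span_minimal)
    then have ker: "cdual_apply f x = 0" if "dual_operator S f = 0" for f
      using that unfolding B(2) by auto
    have cl: "x \<in> closure (range S)"
    proof (rule ccontr)
      assume "x \<notin> closure (range S)"
      then obtain f where f: "\<forall>y\<in>range S. cdual_apply f y = 0" "cdual_apply f x \<noteq> 0"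
        by (rule separating_functional[OF csubspace_range[OF bS]])
      have "dual_operator S f = 0"
        by (rule cdual_eqI) (simp add: cdual_apply_dual_operator[OF bS] f(1) cdual_apply_zero)
      then show False using ker f(2) by simp
    qed
    have "S x = 0" using x by simp
    then show "x = 0" using cl by (rule multiplier_kernel_closure_range[OF ss S])
  qed
  then obtain F where F: "finite F" "kernel S \<subseteq> cspan F" by auto
  have "nullity S \<le> enat (card F)" unfolding nullity_def by (rule edim_le_card[OF csubspace_kernel[OF bS] F])
  then show ?thesis by (rule le_less_trans) simp
qed

lemma multiplier_bounded_below_if_surj:
  fixes S :: "'a::complex_banach_algebra \<Rightarrow> 'a"
  assumes ss: "semisimple TYPE('a)" and S: "multiplier S" and surj: "range S = UNIV"
  shows "bounded_below S"
proof (rule inj_closed_range_bounded_below[OF multiplier_bounded_clinear[OF S]])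
  show "closed (range S)" unfolding surj by simp
  have "x = 0" if "S x = 0" for x
    by (rule multiplier_kernel_closure_range[OF ss S that]) (simp add: surj)
  then show "kernel S = {0}" using bounded_clinear_0[OF multiplier_bounded_clinear[OF S]] by auto
qed

text \<open>Each condition on \<open>S\<^sup>*\<close>, for \<open>S = T - \<mu>\<close>, is transported to \<open>S\<close>; group invertibility passes back. If \<open>\<mu>\<close> is isolated
  in the approximate point spectrum of \<open>T\<^sup>*\<close>, then the neighbouring operators \<open>T\<^sup>* - \<nu>\<close> are bounded below, so
  the \<open>T - \<nu>\<close> are onto, and a multiplier that is onto is injective.\<close>

theorem dual_multiplier_properties_z_az:
  fixes T :: "'a::complex_banach_algebra \<Rightarrow> 'a"
  assumes ss: "semisimple TYPE('a)" and comm: "commutative TYPE('a)" and reg: "regular_algebra TYPE('a)"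
    and taub: "tauberian TYPE('a)" and T: "multiplier T"
  shows "property_z (dual_operator T) \<and> property_az (dual_operator T)"
proof (rule property_z_and_az_if_group_invertible[OF bounded_clinear_dual_operator[OF multiplier_bounded_clinear[OF T]]])
  fix \<mu>
  let ?S = "shift T \<mu>"
  have bT: "bounded_clinear T" by (rule multiplier_bounded_clinear[OF T])
  have S: "multiplier ?S" by (rule multiplier_shift[OF T])
  have bS: "bounded_clinear ?S" by (rule multiplier_bounded_clinear[OF S])
  note dual = dual_operator_shift[OF bT]
  assume "nullity (shift (dual_operator T) \<mu>) < \<infinity>"
  then have fin: "nullity ?S < \<infinity>" unfolding dual by (rule multiplier_nullity_finite_if_dual[OF ss S])
  have gd: "group_invertible (shift (dual_operator T) \<mu>)" if "group_invertible ?S"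
    unfolding dual by (rule group_invertible_dual[OF bS that])
  show "group_invertible (shift (dual_operator T) \<mu>)"
    if cl: "closed (range (shift (dual_operator T) \<mu> ^^ Suc n))" for n
  proof (rule gd)
    have "closed (range (?S ^^ Suc n))"
      using cl unfolding dual dual_operator_funpow[OF bS]
      by (rule closed_range_of_dual[OF bounded_clinear_funpow[OF bS]])
    then show "group_invertible ?S"
      by (rule multiplier_group_invertible_if_closed_range[OF ss comm reg taub S _ fin])
  qed
  show "group_invertible (shift (dual_operator T) \<mu>)"
    if iso: "\<mu> isolated_in approx_point_spectrum (dual_operator T)"
  proof (rule gd)
    obtain d where d: "d > 0" "\<forall>\<nu>. 0 < cmod \<nu> \<longrightarrow> cmod \<nu> < d \<longrightarrow> bounded_below (shift (shift (dual_operator T) \<mu>) \<nu>)"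
      by (rule isolated_in_punctured[OF bounded_clinear_dual_operator[OF bT] iso])
    have "bounded_below (shift ?S \<nu>)" if "0 < cmod \<nu>" "cmod \<nu> < d" for \<nu>
    proof (rule multiplier_bounded_below_if_surj[OF ss multiplier_shift[OF S]])
      have "bounded_below (dual_operator (shift ?S \<nu>))"
        using d(2) that unfolding dual dual_operator_shift[OF bS] by blast
      then show "range (shift ?S \<nu>) = UNIV"
        by (rule surj_if_dual_bounded_below[OF bounded_clinear_shift[OF bS]])
    qed
    then show "group_invertible ?S"
      by (rule multiplier_group_invertible_if_punctured[OF ss comm reg taub S fin d(1)])
  qed
qed

theorem proposition2p1:
  fixes T :: "'a::complex_banach_algebra \<Rightarrow> 'a"
  assumes "semisimple TYPE('a)"
    and "infinite_dimensional TYPE('a)"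
    and "multiplier T"
  shows "(SVEP T \<and> ascent T \<le> 1 \<and> nullity T \<le> deficiency T) \<and>
    (commutative TYPE('a) \<and> regular_algebra TYPE('a) \<and> tauberian TYPE('a) \<longrightarrow>
      (property_z T \<and> property_az T) \<and>
      (SVEP (dual_operator T) \<longrightarrow>
        property_z (dual_operator T) \<and> property_az (dual_operator T)))"
proof (intro conjI impI)
  show "SVEP T" by (rule multiplier_SVEP[OF assms(1,3)])
  show "ascent T \<le> 1" "nullity T \<le> deficiency T" by (rule multiplier_ascent_nullity[OF assms(1,3)])+
  assume alg: "commutative TYPE('a) \<and> regular_algebra TYPE('a) \<and> tauberian TYPE('a)"
  then have z_az: "property_z T \<and> property_az T"
    by (intro multiplier_properties_z_az assms(1,3)) auto
  then show "property_z T" "property_az T" by auto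
  have dual_z_az: "property_z (dual_operator T) \<and> property_az (dual_operator T)"
    using alg by (intro dual_multiplier_properties_z_az assms(1,3)) auto
  then show "property_z (dual_operator T)" "property_az (dual_operator T)" by auto
qed

end
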